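(* Let $(\bar y,\bar p,\bar u)\in H_0^1(\Omega)\times H_0^1(\Omega)\times\mathbb{U}_{ad}$, with associated subgradient $\bar\lambda$, be the solution to the continuous optimality system and, for a mesh $\mathscr{T}\in\mathbb{T}$, let $(\bar y_{\mathscr{T}},\bar p_{\mathscr{T}},\bar u_{\mathscr{T}})\in\mathbb{V}(\mathscr{T})\times\mathbb{V}(\mathscr{T})\times\mathbb{U}_{ad,1}(\mathscr{T})$, with associated discrete subgradient $\bar\lambda_{\mathscr{T}}$, be the solution to the discrete optimality system with piecewise linear controls. Then, for every $K\in\mathscr{T}$, $$E_{y,K}\lesssim\|\bar y-\bar y_{\mathscr{T}}\|_{L^2(\Omega_K)}+h_K^2\|\bar u-\bar u_{\mathscr{T}}\|_{L^2(\Omega_K)}+\mathrm{osc}_{\mathscr{T},1}(f;\Omega_K),$$ $$E_{p,K}\lesssim\|\bar p-\bar p_{\mathscr{T}}\|_{L^2(\Omega_K)}+h_K^2\|\bar y-\bar y_{\mathscr{T}}\|_{L^2(\Omega_K)}+\mathrm{osc}_{\mathscr{T},1}(y_\Omega;\Omega_K),$$ $$E_{u,K}\le\|\bar u-\bar u_{\mathscr{T}}\|_{L^2(K)}+2\alpha^{-1}\|\bar p-\bar p_{\mathscr{T}}\|_{L^2(K)},$$ $$E_{\lambda,K}\le\|\bar\lambda-\bar\lambda_{\mathscr{T}}\|_{L^2(K)}+\beta^{-1}\|\bar p-\bar p_{\mathscr{T}}\|_{L^2(K)},$$ where the hidden constants are independent of the optimal variables, their approximations, the size of the elements in the mesh $\mathscr{T}$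 and $\#\mathscr{T}$.
   Context: $A\lesssim B$ means $A\le CB$ with a constant $C$ (with the independence stated in the claim). Data. $d\in\{2,3\}$; $\Omega\subset\mathbb{R}^d$ is an open bounded polytopal domain with Lipschitz boundary; $f,y_\Omega\in L^2(\Omega)$; $\alpha>0$, $\beta>0$; $a,b\in\mathbb{R}$ with $a<0<b$; $\mathbb{U}_{ad}=\{v\in L^2(\Omega): a\le v(x)\le b \text{ for a.e. } x\in\Omega\}$. Continuous optimality system. With $\psi(u)=\|u\|_{L^1(\Omega)}$ and $\partial\psi$ its convex subdifferential, find $(\bar y,\bar p,\bar u)\in H_0^1(\Omega)\times H_0^1(\Omega)\times\mathbb{U}_{ad}$ and $\bar\lambda\in\partial\psi(\bar u)$ such that $(\nabla\bar y,\nabla v)_{L^2(\Omega)}=(\bar u+f,v)_{L^2(\Omega)}$ for all $v\in H_0^1(\Omega)$; $(\nabla w,\nabla\bar p)_{L^2(\Omega)}=(\bar y-y_\Omega,w)_{L^2(\Omega)}$ for all $w\in H_0^1(\Omega)$; $(\bar p+\alpha\bar u+\beta\bar\lambda,u-\bar u)_{L^2(\Omega)}\ge0$ for all $u\in\mathbb{U}_{ad}$. Both $(\bar y,\bar p,\bar u)$ and $\bar\lambda$ are uniquely determined, and $\bar u=\Pi_{[a,b]}(-\tfrac1\alpha(\bar p+\beta\bar\lambda))$, $\bar\lambda=\Pi_{[-1,1]}(-\tfrac1\beta\bar p)$, where $\Pi_{[\mathfrak a,\mathfrak b]}(v)(x)=\min\{\mathfrak b,\max\{\mathfrak a,v(x)\}\}$.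 Meshes. $\mathbb{T}$ is a collection of conforming, (uniformly) shape regular simplicial meshes $\mathscr{T}=\{K\}$ of $\bar\Omega$ that are refinements of an initial mesh $\mathscr{T}_0$; $h_K=\mathrm{diam}(K)$. $\mathbb{V}(\mathscr{T})$ is the space of continuous functions on $\bar\Omega$ that are affine on each $K\in\mathscr{T}$ and vanish on $\partial\Omega$. $\mathscr{S}$ is the set of internal $(d-1)$-dimensional interelement sides of $\mathscr{T}$, $\mathscr{S}_K\subset\mathscr{S}$ the set of those that are sides of $K$, and $\Omega_K=\bigcup\{K'\in\mathscr{T}:\mathscr{S}_K\cap\mathscr{S}_{K'}\ne\emptyset\}$ (also regarded as the corresponding subset of $\mathscr{T}$). Discrete system (piecewise linear controls). $\mathbb{U}_1(\mathscr{T})=\{u_{\mathscr{T}}\in C(\bar\Omega): u_{\mathscr{T}}|_K\in\mathbb{P}_1(K)\ \forall K\in\mathscr{T}\}$, $\mathbb{U}_{ad,1}(\mathscr{T})=\mathbb{U}_1(\mathscr{T})\cap\mathbb{U}_{ad}$. Let $\mathcal V(\mathscr{T})$ be the set of all vertices of $\mathscr{T}$ and $\phi_{\mathsf v}\in\mathbb{U}_1(\mathscr{T})$ the nodal basis function of the vertex $\mathsf v$. Define $(u_{\mathscr{T}},v_{\mathscr{T}})_{\mathscr{T}}=\sum_{\mathsf v\in\mathcal V(\mathscr{T})}u_{\mathscr{T}}(\mathsf v)v_{\mathscr{T}}(\mathsf v)\int_\Omega\phi_{\mathsf v}\,dx$ and $\psi_{\mathscr{T}}(u_{\mathscr{T}})=\sum_{\mathsf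 v\in\mathcal V(\mathscr{T})}|u_{\mathscr{T}}(\mathsf v)|\int_\Omega\phi_{\mathsf v}\,dx$ on $\mathbb{U}_1(\mathscr{T})$. Find $(\bar y_{\mathscr{T}},\bar p_{\mathscr{T}},\bar u_{\mathscr{T}})\in\mathbb{V}(\mathscr{T})\times\mathbb{V}(\mathscr{T})\times\mathbb{U}_{ad,1}(\mathscr{T})$ and $\bar\lambda_{\mathscr{T}}\in\partial\psi_{\mathscr{T}}(\bar u_{\mathscr{T}})$ such that $(\nabla\bar y_{\mathscr{T}},\nabla v_{\mathscr{T}})_{L^2(\Omega)}=(\bar u_{\mathscr{T}}+f,v_{\mathscr{T}})_{L^2(\Omega)}$ and $(\nabla w_{\mathscr{T}},\nabla\bar p_{\mathscr{T}})_{L^2(\Omega)}=(\bar y_{\mathscr{T}}-y_\Omega,w_{\mathscr{T}})_{L^2(\Omega)}$ for all $v_{\mathscr{T}},w_{\mathscr{T}}\in\mathbb{V}(\mathscr{T})$, and $(\bar p_{\mathscr{T}},u_{\mathscr{T}}-\bar u_{\mathscr{T}})_{L^2(\Omega)}+(\alpha\bar u_{\mathscr{T}}+\beta\bar\lambda_{\mathscr{T}},u_{\mathscr{T}}-\bar u_{\mathscr{T}})_{\mathscr{T}}\ge0$ for all $u_{\mathscr{T}}\in\mathbb{U}_{ad,1}(\mathscr{T})$. Here $\bar\lambda_{\mathscr{T}}$ is identified with an element of $\mathbb{U}_1(\mathscr{T})$ through $(\cdot,\cdot)_{\mathscr{T}}$, i.e. $\bar\lambda_{\mathscr{T}}(\mathsf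 v)=1$ if $\bar u_{\mathscr{T}}(\mathsf v)>0$, $=-1$ if $\bar u_{\mathscr{T}}(\mathsf v)<0$, and $\in[-1,1]$ if $\bar u_{\mathscr{T}}(\mathsf v)=0$; it is uniquely determined. Indicators. For $\gamma\in\mathscr{S}$ shared by $K^+\ne K^-$ and $z_{\mathscr{T}}\in\mathbb{V}(\mathscr{T})$, $[\![\nabla z_{\mathscr{T}}\cdot\nu]\!]_\gamma=\nu^+\cdot\nabla z_{\mathscr{T}}|_{K^+}+\nu^-\cdot\nabla z_{\mathscr{T}}|_{K^-}$, where $\nu^\pm$ is the unit normal to $\gamma$ pointing outward of $K^\pm$. Set $\tilde\lambda=\Pi_{[-1,1]}(-\tfrac1\beta\bar p_{\mathscr{T}})$, $\tilde u=\Pi_{[a,b]}(-\tfrac1\alpha(\bar p_{\mathscr{T}}+\beta\tilde\lambda))$ and $E_{y,K}^2=h_K^4\|\bar u_{\mathscr{T}}+f\|_{L^2(K)}^2+h_K^3\|[\![\nabla\bar y_{\mathscr{T}}\cdot\nu]\!]_\gamma\|_{L^2(\partial K\setminus\partial\Omega)}^2$, $E_{p,K}^2=h_K^4\|\bar y_{\mathscr{T}}-y_\Omega\|_{L^2(K)}^2+h_K^3\|[\![\nabla\bar p_{\mathscr{T}}\cdot\nu]\!]_\gamma\|_{L^2(\partial K\setminus\partial\Omega)}^2$, $E_{u,K}^2=\|\tilde u-\bar u_{\mathscr{T}}\|_{L^2(K)}^2$, $E_{\lambda,K}^2=\|\tilde\lambda-\bar\lambda_{\mathscr{T}}\|_{L^2(K)}^2$.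 Oscillation. For $\ell\in\{0,1\}$ (either choice), $\Pi_K^\ell$ is the $L^2(K)$-orthogonal projection onto $\mathbb{P}_\ell(K)$; for $\kappa\in\{0,1\}$, $g\in L^2(\Omega)$ and $\mathscr{M}\subset\mathscr{T}$, $\mathrm{osc}_{\mathscr{T},\kappa}(g;\mathscr{M})=\big(\sum_{K\in\mathscr{M}}h_K^{2(\kappa+1)}\|g-\Pi_K^\ell(g)\|_{L^2(K)}^2\big)^{1/2}$.
   Formalization: The patch Ω_K is taken to contain K itself always; this differs from the stated definition only when the mesh consists of a single element, where Ω_K would be empty and the first two estimates would fail. *)

theory Defs
  imports "HOL-Analysis.Analysis"
begin

section \<open>Lebesgue and Sobolev spaces\<close>

text \<open>
  Elements of the function spaces are represented by functions on the whole ambient space; values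
  outside the set under consideration, or on a null set, never matter.
\<close>

definition L2_space :: "'a::euclidean_space set \<Rightarrow> ('a \<Rightarrow> 'b::euclidean_space) set" where
  "L2_space S = {f. f \<in> borel_measurable (lebesgue_on S) \<and>
                    integrable (lebesgue_on S) (\<lambda>x. (norm (f x))\<^sup>2)}"

definition L2_inner ::
    "'a::euclidean_space set \<Rightarrow> ('a \<Rightarrow> 'b::euclidean_space) \<Rightarrow> ('a \<Rightarrow> 'b) \<Rightarrow> real" where
  "L2_inner S f g = (LINT x|lebesgue_on S. f x \<bullet> g x)"

definition L2_norm :: "'a::euclidean_space set \<Rightarrow> ('a \<Rightarrow> 'b::euclidean_space) \<Rightarrow> real" where
  "L2_norm S f = sqrt (LINT x|lebesgue_on S. (norm (f x))\<^sup>2)"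

definition L1_norm :: "'a::euclidean_space set \<Rightarrow> ('a \<Rightarrow> real) \<Rightarrow> real" where
  "L1_norm S f = (LINT x|lebesgue_on S. \<bar>f x\<bar>)"

definition grad :: "('a::euclidean_space \<Rightarrow> real) \<Rightarrow> 'a \<Rightarrow> 'a" where
  "grad \<phi> x = (\<Sum>i\<in>Basis. frechet_derivative \<phi> (at x) i *\<^sub>R i)"

primrec C_k :: "nat \<Rightarrow> ('a::euclidean_space \<Rightarrow> real) \<Rightarrow> bool" where
  "C_k 0 \<phi> \<longleftrightarrow> continuous_on UNIV \<phi>"
| "C_k (Suc k) \<phi> \<longleftrightarrow> (\<forall>x. \<phi> differentiable (at x)) \<and>
      (\<forall>i\<in>Basis. C_k k (\<lambda>x. frechet_derivative \<phi> (at x) i))"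

definition test_functions :: "'a::euclidean_space set \<Rightarrow> ('a \<Rightarrow> real) set" where
  "test_functions \<Omega> = {\<phi>. (\<forall>k. C_k k \<phi>) \<and> compact (closure {x. \<phi> x \<noteq> 0}) \<and>
                          closure {x. \<phi> x \<noteq> 0} \<subseteq> \<Omega>}"

definition has_weak_gradient ::
    "'a::euclidean_space set \<Rightarrow> ('a \<Rightarrow> real) \<Rightarrow> ('a \<Rightarrow> 'a) \<Rightarrow> bool" where
  "has_weak_gradient \<Omega> v G \<longleftrightarrow> G \<in> L2_space \<Omega> \<and>
     (\<forall>\<phi>\<in>test_functions \<Omega>.
        (LINT x|lebesgue_on \<Omega>. v x *\<^sub>R grad \<phi> x) = - (LINT x|lebesgue_on \<Omega>. \<phi> x *\<^sub>R G x))"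

text \<open>The weak gradient is unique up to null sets, so the choice below is immaterial.\<close>

definition weak_grad :: "'a::euclidean_space set \<Rightarrow> ('a \<Rightarrow> real) \<Rightarrow> 'a \<Rightarrow> 'a" where
  "weak_grad \<Omega> v = (SOME G. has_weak_gradient \<Omega> v G)"

definition H1 :: "'a::euclidean_space set \<Rightarrow> ('a \<Rightarrow> real) set" where
  "H1 \<Omega> = {v \<in> L2_space \<Omega>. \<exists>G. has_weak_gradient \<Omega> v G}"

text \<open>The closure of the test functions in the norm of \<open>H1\<close>.\<close>

definition H1_0 :: "'a::euclidean_space set \<Rightarrow> ('a \<Rightarrow> real) set" where
  "H1_0 \<Omega> = {v \<in> H1 \<Omega>. \<exists>\<phi>. (\<forall>n::nat. \<phi> n \<in> test_functions \<Omega>) \<and>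
      (\<lambda>n. L2_norm \<Omega> (\<lambda>x. v x - \<phi> n x)) \<longlonglongrightarrow> 0 \<and>
      (\<lambda>n. L2_norm \<Omega> (\<lambda>x. weak_grad \<Omega> v x - grad (\<phi> n) x)) \<longlonglongrightarrow> 0}"


section \<open>Domains and meshes\<close>

text \<open>Locally the domain lies strictly on one side of a Lipschitz graph over a hyperplane
  orthogonal to a unit vector \<open>e\<close>.\<close>

definition lipschitz_boundary :: "'a::euclidean_space set \<Rightarrow> bool" where
  "lipschitz_boundary \<Omega> \<longleftrightarrow>
     (\<forall>x0\<in>frontier \<Omega>. \<exists>e r L \<phi>. norm e = 1 \<and> 0 < r \<and> L-lipschitz_on {z. z \<bullet> e = 0} \<phi> \<and>
        \<Omega> \<inter> ball x0 r = {x \<in> ball x0 r. \<phi> (x - (x \<bullet> e) *\<^sub>R e) < x \<bullet> e})"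

definition polytopal_lipschitz_domain :: "'a::euclidean_space set \<Rightarrow> bool" where
  "polytopal_lipschitz_domain \<Omega> \<longleftrightarrow>
     \<Omega> \<noteq> {} \<and> open \<Omega> \<and> connected \<Omega> \<and> bounded \<Omega> \<and> lipschitz_boundary \<Omega> \<and>
     (\<exists>\<P>. finite \<P> \<and> (\<forall>P\<in>\<P>. polytope P) \<and> closure \<Omega> = \<Union>\<P>)"

text \<open>\<open>triangulation\<close> contributes finiteness and conformity: the intersection of two elements is
  a (possibly empty) common face.\<close>

definition conforming_mesh :: "'a::euclidean_space set \<Rightarrow> 'a set set \<Rightarrow> bool" where
  "conforming_mesh \<Omega> \<T> \<longleftrightarrow>
     triangulation \<T> \<and> (\<forall>K\<in>\<T>. int DIM('a) simplex K) \<and> \<Union>\<T> = closure \<Omega>"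

definition mesh_refines :: "'a set set \<Rightarrow> 'a set set \<Rightarrow> bool" where
  "mesh_refines \<T> \<T>\<^sub>0 \<longleftrightarrow> (\<forall>K\<in>\<T>. \<exists>K\<^sub>0\<in>\<T>\<^sub>0. K \<subseteq> K\<^sub>0)"

text \<open>The diameter of the largest ball contained in \<open>K\<close>.\<close>

definition inball_diameter :: "'a::euclidean_space set \<Rightarrow> real" where
  "inball_diameter K = Sup {2 * r | x r. 0 \<le> r \<and> cball x r \<subseteq> K}"

definition uniformly_shape_regular :: "'a::euclidean_space set set set \<Rightarrow> bool" where
  "uniformly_shape_regular TT \<longleftrightarrow>
     (\<exists>\<sigma>>0. \<forall>\<T>\<in>TT. \<forall>K\<in>\<T>. diameter K \<le> \<sigma> * inball_diameter K)"

definition mesh_family ::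
    "'a::euclidean_space set \<Rightarrow> 'a set set \<Rightarrow> 'a set set set \<Rightarrow> bool" where
  "mesh_family \<Omega> \<T>\<^sub>0 TT \<longleftrightarrow>
     conforming_mesh \<Omega> \<T>\<^sub>0 \<and>
     (\<forall>\<T>\<in>TT. conforming_mesh \<Omega> \<T> \<and> mesh_refines \<T> \<T>\<^sub>0) \<and>
     uniformly_shape_regular TT"

definition internal_sides :: "'a::euclidean_space set set \<Rightarrow> 'a set set" where
  "internal_sides \<T> = {\<gamma>. \<exists>K\<in>\<T>. \<exists>K'\<in>\<T>. K \<noteq> K' \<and> \<gamma> = K \<inter> K' \<and> \<gamma> facet_of K \<and> \<gamma> facet_of K'}"

definition sides_of :: "'a::euclidean_space set set \<Rightarrow> 'a set \<Rightarrow> 'a set set" where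
  "sides_of \<T> K = {\<gamma> \<in> internal_sides \<T>. \<gamma> facet_of K}"

text \<open>
  The set of elements forming \<open>\<Omega>\<^sub>K\<close>. The disjunct \<open>K' = K\<close> is redundant as soon as \<open>K\<close> has an
  internal side; it only matters for a mesh consisting of a single element, where without it
  \<open>\<Omega>\<^sub>K\<close> would be empty.
\<close>

definition patch :: "'a::euclidean_space set set \<Rightarrow> 'a set \<Rightarrow> 'a set set" where
  "patch \<T> K = {K'\<in>\<T>. K' = K \<or> sides_of \<T> K \<inter> sides_of \<T> K' \<noteq> {}}"

definition vertices :: "'a::euclidean_space set set \<Rightarrow> 'a set" where
  "vertices \<T> = {w. \<exists>K\<in>\<T>. w extreme_point_of K}"


section \<open>Finite element spaces\<close>

text \<open>Polynomials of degree at most \<open>l\<close>, used for \<open>l \<in> {0, 1}\<close> only.\<close>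

definition Poly_le :: "nat \<Rightarrow> ('a::euclidean_space \<Rightarrow> real) set" where
  "Poly_le l = {\<lambda>x. g \<bullet> x + c | g c. l = 0 \<longrightarrow> g = 0}"

definition P1_functions :: "'a::euclidean_space set \<Rightarrow> 'a set set \<Rightarrow> ('a \<Rightarrow> real) set" where
  "P1_functions \<Omega> \<T> = {v. continuous_on (closure \<Omega>) v \<and>
                          (\<forall>K\<in>\<T>. \<exists>q\<in>Poly_le 1. \<forall>x\<in>K. v x = q x)}"

definition P1_functions_0 :: "'a::euclidean_space set \<Rightarrow> 'a set set \<Rightarrow> ('a \<Rightarrow> real) set" where
  "P1_functions_0 \<Omega> \<T> = {v \<in> P1_functions \<Omega> \<T>. \<forall>x\<in>frontier \<Omega>. v x = 0}"

text \<open>Unique on \<open>closure \<Omega>\<close>; the values elsewhere are irrelevant.\<close>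

definition nodal_basis :: "'a::euclidean_space set \<Rightarrow> 'a set set \<Rightarrow> 'a \<Rightarrow> 'a \<Rightarrow> real" where
  "nodal_basis \<Omega> \<T> w = (SOME \<phi>. \<phi> \<in> P1_functions \<Omega> \<T> \<and>
                             (\<forall>w'\<in>vertices \<T>. \<phi> w' = (if w' = w then 1 else 0)))"

definition lumped_inner ::
    "'a::euclidean_space set \<Rightarrow> 'a set set \<Rightarrow> ('a \<Rightarrow> real) \<Rightarrow> ('a \<Rightarrow> real) \<Rightarrow> real" where
  "lumped_inner \<Omega> \<T> u v =
     (\<Sum>w\<in>vertices \<T>. u w * v w * (LINT x|lebesgue_on \<Omega>. nodal_basis \<Omega> \<T> w x))"

definition lumped_L1_norm :: "'a::euclidean_space set \<Rightarrow> 'a set set \<Rightarrow> ('a \<Rightarrow> real) \<Rightarrow> real" where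
  "lumped_L1_norm \<Omega> \<T> u =
     (\<Sum>w\<in>vertices \<T>. \<bar>u w\<bar> * (LINT x|lebesgue_on \<Omega>. nodal_basis \<Omega> \<T> w x))"


section \<open>Optimality systems\<close>

text \<open>Convex subdifferential of \<open>\<psi>\<close> at \<open>u\<close> on the function space \<open>X\<close>, where functionals are
  identified with elements of \<open>X\<close> through the inner product \<open>ip\<close>.\<close>

definition subdifferential ::
    "('a \<Rightarrow> real) set \<Rightarrow> (('a \<Rightarrow> real) \<Rightarrow> ('a \<Rightarrow> real) \<Rightarrow> real) \<Rightarrow> (('a \<Rightarrow> real) \<Rightarrow> real) \<Rightarrow>
     ('a \<Rightarrow> real) \<Rightarrow> ('a \<Rightarrow> real) set" where
  "subdifferential X ip \<psi> u = {l \<in> X. \<forall>v\<in>X. \<psi> u + ip l (\<lambda>x. v x - u x) \<le> \<psi> v}"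

definition U_ad :: "'a::euclidean_space set \<Rightarrow> real \<Rightarrow> real \<Rightarrow> ('a \<Rightarrow> real) set" where
  "U_ad \<Omega> a b = {v \<in> L2_space \<Omega>. AE x in lebesgue_on \<Omega>. a \<le> v x \<and> v x \<le> b}"

definition U_ad1 ::
    "'a::euclidean_space set \<Rightarrow> 'a set set \<Rightarrow> real \<Rightarrow> real \<Rightarrow> ('a \<Rightarrow> real) set" where
  "U_ad1 \<Omega> \<T> a b = P1_functions \<Omega> \<T> \<inter> U_ad \<Omega> a b"

definition continuous_solution ::
    "'a::euclidean_space set \<Rightarrow> ('a \<Rightarrow> real) \<Rightarrow> ('a \<Rightarrow> real) \<Rightarrow> real \<Rightarrow> real \<Rightarrow> real \<Rightarrow> real \<Rightarrow>
     ('a \<Rightarrow> real) \<Rightarrow> ('a \<Rightarrow> real) \<Rightarrow> ('a \<Rightarrow> real) \<Rightarrow> ('a \<Rightarrow> real) \<Rightarrow> bool" where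
  "continuous_solution \<Omega> f y\<^sub>\<Omega> \<alpha> \<beta> a b y p u lam \<longleftrightarrow>
     y \<in> H1_0 \<Omega> \<and> p \<in> H1_0 \<Omega> \<and> u \<in> U_ad \<Omega> a b \<and>
     lam \<in> subdifferential (L2_space \<Omega>) (L2_inner \<Omega>) (L1_norm \<Omega>) u \<and>
     (\<forall>v\<in>H1_0 \<Omega>. L2_inner \<Omega> (weak_grad \<Omega> y) (weak_grad \<Omega> v) = L2_inner \<Omega> (\<lambda>x. u x + f x) v) \<and>
     (\<forall>w\<in>H1_0 \<Omega>. L2_inner \<Omega> (weak_grad \<Omega> w) (weak_grad \<Omega> p) = L2_inner \<Omega> (\<lambda>x. y x - y\<^sub>\<Omega> x) w) \<and>
     (\<forall>v\<in>U_ad \<Omega> a b. 0 \<le> L2_inner \<Omega> (\<lambda>x. p x + \<alpha> * u x + \<beta> * lam x) (\<lambda>x. v x - u x))"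

definition discrete_solution ::
    "'a::euclidean_space set \<Rightarrow> 'a set set \<Rightarrow> ('a \<Rightarrow> real) \<Rightarrow> ('a \<Rightarrow> real) \<Rightarrow>
     real \<Rightarrow> real \<Rightarrow> real \<Rightarrow> real \<Rightarrow>
     ('a \<Rightarrow> real) \<Rightarrow> ('a \<Rightarrow> real) \<Rightarrow> ('a \<Rightarrow> real) \<Rightarrow> ('a \<Rightarrow> real) \<Rightarrow> bool" where
  "discrete_solution \<Omega> \<T> f y\<^sub>\<Omega> \<alpha> \<beta> a b y p u lam \<longleftrightarrow>
     y \<in> P1_functions_0 \<Omega> \<T> \<and> p \<in> P1_functions_0 \<Omega> \<T> \<and> u \<in> U_ad1 \<Omega> \<T> a b \<and>
     lam \<in> subdifferential (P1_functions \<Omega> \<T>) (lumped_inner \<Omega> \<T>) (lumped_L1_norm \<Omega> \<T>) u \<and>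
     (\<forall>v\<in>P1_functions_0 \<Omega> \<T>.
        L2_inner \<Omega> (weak_grad \<Omega> y) (weak_grad \<Omega> v) = L2_inner \<Omega> (\<lambda>x. u x + f x) v) \<and>
     (\<forall>w\<in>P1_functions_0 \<Omega> \<T>.
        L2_inner \<Omega> (weak_grad \<Omega> w) (weak_grad \<Omega> p) = L2_inner \<Omega> (\<lambda>x. y x - y\<^sub>\<Omega> x) w) \<and>
     (\<forall>v\<in>U_ad1 \<Omega> \<T> a b.
        0 \<le> L2_inner \<Omega> p (\<lambda>x. v x - u x) +
            lumped_inner \<Omega> \<T> (\<lambda>x. \<alpha> * u x + \<beta> * lam x) (\<lambda>x. v x - u x))"


section \<open>Error indicators and oscillation\<close>

definition clip :: "real \<Rightarrow> real \<Rightarrow> ('a \<Rightarrow> real) \<Rightarrow> 'a \<Rightarrow> real" where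
  "clip l r v x = min r (max l (v x))"

definition grad_on :: "'a::euclidean_space set \<Rightarrow> ('a \<Rightarrow> real) \<Rightarrow> 'a" where
  "grad_on K z = (THE g. \<exists>c. \<forall>x\<in>K. z x = g \<bullet> x + c)"

definition outer_normal :: "'a::euclidean_space set \<Rightarrow> 'a set \<Rightarrow> 'a" where
  "outer_normal K \<gamma> = (THE \<nu>. norm \<nu> = 1 \<and> (\<exists>c. \<gamma> \<subseteq> {x. \<nu> \<bullet> x = c} \<and> K \<subseteq> {x. \<nu> \<bullet> x \<le> c}))"

text \<open>An internal side belongs to exactly two elements, so the sum has two terms.\<close>

definition normal_jump :: "'a::euclidean_space set set \<Rightarrow> ('a \<Rightarrow> real) \<Rightarrow> 'a set \<Rightarrow> real" where
  "normal_jump \<T> z \<gamma> = (\<Sum>K | K \<in> \<T> \<and> \<gamma> facet_of K. outer_normal K \<gamma> \<bullet> grad_on K z)"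

text \<open>
  The \<open>(d - 1)\<close>-dimensional Lebesgue measure on a hyperplane \<open>H\<close>: the image of the
  \<open>d\<close>-dimensional one on the slab of thickness 1 around \<open>H\<close> under orthogonal projection onto \<open>H\<close>.
\<close>

definition hyperplane_measure :: "'a::euclidean_space set \<Rightarrow> 'a measure" where
  "hyperplane_measure H =
     distr (restrict_space lborel {x. infdist x H \<le> 1/2}) borel (closest_point H)"

text \<open>Up to a set of surface measure zero, the part of the boundary of \<open>K\<close> inside \<open>\<Omega>\<close> is the
  union of the internal sides of \<open>K\<close>.\<close>

definition jump_norm :: "'a::euclidean_space set set \<Rightarrow> ('a \<Rightarrow> real) \<Rightarrow> 'a set \<Rightarrow> real" where
  "jump_norm \<T> z K = sqrt (\<Sum>\<gamma>\<in>sides_of \<T> K.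
     set_lebesgue_integral (hyperplane_measure (affine hull \<gamma>)) \<gamma> (\<lambda>x. (normal_jump \<T> z \<gamma>)\<^sup>2))"

definition ind_y ::
    "('a::euclidean_space \<Rightarrow> real) \<Rightarrow> 'a set set \<Rightarrow> ('a \<Rightarrow> real) \<Rightarrow> ('a \<Rightarrow> real) \<Rightarrow> 'a set \<Rightarrow> real" where
  "ind_y f \<T> yT uT K = sqrt (diameter K ^ 4 * (L2_norm K (\<lambda>x. uT x + f x))\<^sup>2 +
                             diameter K ^ 3 * (jump_norm \<T> yT K)\<^sup>2)"

definition ind_p ::
    "('a::euclidean_space \<Rightarrow> real) \<Rightarrow> 'a set set \<Rightarrow> ('a \<Rightarrow> real) \<Rightarrow> ('a \<Rightarrow> real) \<Rightarrow> 'a set \<Rightarrow> real" where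
  "ind_p y\<^sub>\<Omega> \<T> yT pT K = sqrt (diameter K ^ 4 * (L2_norm K (\<lambda>x. yT x - y\<^sub>\<Omega> x))\<^sup>2 +
                               diameter K ^ 3 * (jump_norm \<T> pT K)\<^sup>2)"

definition lambda_tilde :: "real \<Rightarrow> ('a \<Rightarrow> real) \<Rightarrow> 'a \<Rightarrow> real" where
  "lambda_tilde \<beta> pT = clip (-1) 1 (\<lambda>x. - (1 / \<beta>) * pT x)"

definition u_tilde :: "real \<Rightarrow> real \<Rightarrow> real \<Rightarrow> real \<Rightarrow> ('a \<Rightarrow> real) \<Rightarrow> 'a \<Rightarrow> real" where
  "u_tilde \<alpha> \<beta> a b pT = clip a b (\<lambda>x. - (1 / \<alpha>) * (pT x + \<beta> * lambda_tilde \<beta> pT x))"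

definition ind_u ::
    "real \<Rightarrow> real \<Rightarrow> real \<Rightarrow> real \<Rightarrow> ('a::euclidean_space \<Rightarrow> real) \<Rightarrow> ('a \<Rightarrow> real) \<Rightarrow> 'a set \<Rightarrow> real" where
  "ind_u \<alpha> \<beta> a b pT uT K = L2_norm K (\<lambda>x. u_tilde \<alpha> \<beta> a b pT x - uT x)"

definition ind_lambda ::
    "real \<Rightarrow> ('a::euclidean_space \<Rightarrow> real) \<Rightarrow> ('a \<Rightarrow> real) \<Rightarrow> 'a set \<Rightarrow> real" where
  "ind_lambda \<beta> pT lamT K = L2_norm K (\<lambda>x. lambda_tilde \<beta> pT x - lamT x)"

definition L2_proj :: "nat \<Rightarrow> 'a::euclidean_space set \<Rightarrow> ('a \<Rightarrow> real) \<Rightarrow> 'a \<Rightarrow> real" where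
  "L2_proj l K g = (THE q. q \<in> Poly_le l \<and> (\<forall>r\<in>Poly_le l. L2_inner K (\<lambda>x. g x - q x) r = 0))"

definition osc :: "nat \<Rightarrow> nat \<Rightarrow> ('a::euclidean_space \<Rightarrow> real) \<Rightarrow> 'a set set \<Rightarrow> real" where
  "osc l \<kappa> g M =
     sqrt (\<Sum>K\<in>M. diameter K ^ (2 * (\<kappa> + 1)) * (L2_norm K (\<lambda>x. g x - L2_proj l K g x))\<^sup>2)"

end

theory Submission
  imports Defs
begin

text \<open>
  For a test function \<open>v\<close>, two integrations by parts give
  \<open>\<integral> y * laplace v = - \<integral> (u + f) * v\<close>, and the Laplacian of the discrete state acts on \<open>v\<close> through
  its normal jumps only. Thus the residual is controlled by \<open>L2\<close> norms of the errors once \<open>v\<close> and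
  its Laplacian are. Two kinds of smooth \<open>v\<close> suffice: on a ball inscribed in an element, the product
  of a radial bump with the affine approximation of \<open>uT + f\<close> yields the element residual; on a ball
  centred on an interior side and contained in the two adjacent elements, the radial bump alone
  yields the (constant) jump. Shape regularity makes both radii comparable to the element
  diameter. The bounds for the control and the subgradient follow from the pointwise projection
  formulas and the Lipschitz continuity of the projections.
\<close>

section \<open>Smooth bump functions\<close>

text \<open>The errors are measured in \<open>L2\<close>, so both derivatives have to fall on the
  test function, which must vanish at the edge of its support together with its normal derivative.
  Products of barycentric coordinates vanish there only to first order; a smooth compactly supported
  bump avoids this and lies in \<open>H1_0\<close> without any density argument. A ball can replace
  an element because an affine function on a simplex is controlled by its size on an inscribed ball,
  and a ball can replace a side because a jump is a single number per side. What remains is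
  geometry: a point of the side far enough from its rim, and two neighbours of comparable size.
  Moreover, elements are closed and may touch the boundary, while the tests need closed balls inside
  the open domain; the Lipschitz boundary gives
  \<open>interior (closure \<Omega>) = \<Omega>\<close>, which closes this gap. The final constant
  depends on the dimension, on the shape regularity and, through the comparison of surface measure
  with volume, on the diameter of the domain.\<close>

lemma C_k_Suc_imp: "C_k (Suc k) \<phi> \<Longrightarrow> C_k k \<phi>"
proof (induction k arbitrary: \<phi>)
  case 0
  then show ?case
    by (auto simp: continuous_on_eq_continuous_at intro: differentiable_imp_continuous_within)
next
  case (Suc k)
  then show ?case by (metis C_k.simps(2))
qed

lemma C_k_const: "C_k k (\<lambda>x::'a::euclidean_space. c::real)"
  by (induction k arbitrary: c) (auto)

lemma frechet_derivative_add_real: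
  fixes f g :: "'a::euclidean_space \<Rightarrow> real"
  assumes "f differentiable (at x)" "g differentiable (at x)"
  shows "frechet_derivative (\<lambda>x. f x + g x) (at x) i =
     frechet_derivative f (at x) i + frechet_derivative g (at x) i"
  using frechet_derivative_at[OF has_derivative_add[OF assms[unfolded frechet_derivative_works]]]
  by metis

lemma C_k_add:
  fixes f g :: "'a::euclidean_space \<Rightarrow> real"
  shows "C_k k f \<Longrightarrow> C_k k g \<Longrightarrow> C_k k (\<lambda>x. f x + g x)"
proof (induction k arbitrary: f g)
  case 0
  then show ?case by (auto intro: continuous_intros)
next
  case (Suc k)
  then show ?case
    by (auto simp: frechet_derivative_add_real)
qed

lemma frechet_derivative_mult_real:
  fixes f g :: "'a::euclidean_space \<Rightarrow> real"
  assumes "f differentiable (at x)" "g differentiable (at x)"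
  shows "frechet_derivative (\<lambda>x. f x * g x) (at x) i =
     frechet_derivative f (at x) i * g x + f x * frechet_derivative g (at x) i"
  using frechet_derivative_at[OF has_derivative_mult[OF assms[unfolded frechet_derivative_works]]]
  by (metis add.commute)

lemma C_k_mult:
  fixes f g :: "'a::euclidean_space \<Rightarrow> real"
  shows "C_k k f \<Longrightarrow> C_k k g \<Longrightarrow> C_k k (\<lambda>x. f x * g x)"
proof (induction k arbitrary: f g)
  case 0
  then show ?case by (auto intro: continuous_intros)
next
  case (Suc k)
  have "C_k k f" "C_k k g"
    using Suc.prems C_k_Suc_imp by blast+
  then show ?case
    using Suc by (auto simp: frechet_derivative_mult_real intro!: C_k_add)
qed

lemma C_k_diff:
  fixes f g :: "'a::euclidean_space \<Rightarrow> real"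
  assumes "C_k k f" "C_k k g"
  shows "C_k k (\<lambda>x. f x - g x)"
  using C_k_add[OF assms(1) C_k_mult[OF C_k_const[of k "-1"] assms(2)]] by simp

lemma C_k_inner: "C_k k (\<lambda>x::'a::euclidean_space. g \<bullet> x)"
proof (cases k)
  case 0
  then show ?thesis by (auto intro: continuous_intros)
next
  case (Suc k)
  have "frechet_derivative (\<lambda>x. g \<bullet> x) (at x) = (\<lambda>x. g \<bullet> x)" for x :: 'a
    by (metis bounded_linear_imp_has_derivative bounded_linear_inner_right frechet_derivative_at)
  moreover have "(\<lambda>x. g \<bullet> x) differentiable (at x)" for x :: 'a
    by (simp add: bounded_linear_imp_differentiable bounded_linear_inner_right)
  ultimately show ?thesis
    using Suc by (auto simp: C_k_const)
qed

lemma C_k_affine: "C_k k (\<lambda>x::'a::euclidean_space. g \<bullet> x + c)"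
  by (intro C_k_add C_k_inner C_k_const)

section \<open>The flat function exp (- 1/t) and its derivatives\<close>

text \<open>Each derivative of exp (- 1/t) is a combination of functions exp (- 1/t) / t^m. Indexing
  by \<open>m\<close> gives a family closed under differentiation, so smoothness follows by
  induction for all \<open>m\<close> at once.\<close>

definition expinv :: "nat \<Rightarrow> real \<Rightarrow> real" where
  "expinv m t = (if t \<le> 0 then 0 else exp (- (1 / t)) / t ^ m)"

lemma expinv_nonneg: "0 \<le> expinv m t"
  by (auto simp: expinv_def)

text \<open>Substituting s = 1/t turns this into the limit of s^m / exp s at infinity.\<close>

lemma expinv_at_right_0: "(expinv m \<longlongrightarrow> 0) (at_right 0)"
proof -
  have "((\<lambda>t. exp (- (1 / t)) / t ^ m) \<longlongrightarrow> 0) (at_right (0::real))"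
  proof -
    have "((\<lambda>t::real. t ^ m / exp t) \<longlongrightarrow> 0) at_top"
      by (rule tendsto_power_div_exp_0)
    then have "((\<lambda>t::real. inverse t ^ m / exp (inverse t)) \<longlongrightarrow> 0) (at_right 0)"
      using filterlim_compose filterlim_inverse_at_top_right by blast
    then show ?thesis
      by (rule Lim_transform_eventually) (auto simp: eventually_at_filter field_simps exp_minus power_inverse)
  qed
  then show ?thesis
    by (rule Lim_transform_eventually) (auto simp: eventually_at_filter expinv_def)
qed

lemma expinv_tendsto_0: "(expinv m \<longlongrightarrow> 0) (at 0)"
proof -
  have "(expinv m \<longlongrightarrow> 0) (at_left 0)"
    by (rule Lim_transform_eventually[OF tendsto_const]) (auto simp: eventually_at_filter expinv_def)
  then show ?thesis
    using expinv_at_right_0 filterlim_at_split by blast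
qed

lemma expinv_has_derivative:
  "(expinv m has_real_derivative (expinv (m+2) t - m * expinv (m+1) t)) (at t)"
proof -
  consider "t < 0" | "t = 0" | "t > 0" by linarith
  then show ?thesis
  proof cases
    case 1
    have "((\<lambda>t. 0) has_real_derivative 0) (at t)" by simp
    then have "(expinv m has_real_derivative 0) (at t)"
      by (rule has_field_derivative_transform_within_open[of _ _ _ "{..<0}"]) (use 1 in \<open>auto simp: expinv_def\<close>)
    then show ?thesis using 1 by (simp add: expinv_def)
  next
    case 2
    \<comment> \<open>At 0 the difference quotient of \<open>expinv m\<close> is
      \<open>expinv (m+1) h\<close> itself, so its limit is already known.\<close>
    have "((\<lambda>h. expinv (m+1) h) \<longlongrightarrow> 0) (at 0)" by (rule expinv_tendsto_0)
    then have "((\<lambda>h. (expinv m h - expinv m 0) / h) \<longlongrightarrow> 0) (at 0)"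
      by (rule Lim_transform_eventually) (auto simp: eventually_at_filter expinv_def field_simps)
    then show ?thesis
      unfolding has_field_derivative_iff using 2 by (simp add: expinv_def)
  next
    case 3
    have "((\<lambda>t. exp (- (1 / t)) / t ^ m) has_real_derivative
        exp (- (1 / t)) / t ^ (m+2) - m * (exp (- (1 / t)) / t ^ (m+1))) (at t)"
    proof -
      have p: "((\<lambda>t::real. t ^ m) has_real_derivative (m * t ^ (m - Suc 0))) (at t)"
        by (rule DERIV_pow)
      have q: "((\<lambda>t. exp (- (1 / t))) has_real_derivative (exp (- (1 / t)) / t\<^sup>2)) (at t)"
        using 3 by (auto intro!: derivative_eq_intros simp: power2_eq_square)
      have "(exp (- (1 / t)) / t\<^sup>2 * t ^ m - exp (- (1 / t)) * (m * t ^ (m - Suc 0))) / (t ^ m * t ^ m)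
         = exp (- (1 / t)) / t ^ (m+2) - m * (exp (- (1 / t)) / t ^ (m+1))"
        using 3 by (cases m) (auto simp: field_simps power2_eq_square)
      then show ?thesis using DERIV_divide[OF q p] 3 by simp
    qed
    then have "(expinv m has_real_derivative
        exp (- (1 / t)) / t ^ (m+2) - m * (exp (- (1 / t)) / t ^ (m+1))) (at t)"
      by (rule has_field_derivative_transform_within_open[of _ _ _ "{0<..}"]) (use 3 in \<open>auto simp: expinv_def\<close>)
    then show ?thesis using 3 by (simp add: expinv_def)
  qed
qed

lemma expinv_continuous: "continuous_on S (expinv m)"
  using expinv_has_derivative
  by (meson continuous_at_imp_continuous_on DERIV_isCont)

lemma C_k_expinv_comp:
  fixes s :: "'a::euclidean_space \<Rightarrow> real"
  assumes "\<And>k. C_k k s"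
  shows "C_k k (\<lambda>x. expinv m (s x))"
proof (induction k arbitrary: m)
  case 0
  have "continuous_on UNIV s" using assms[of 0] by simp
  then show ?case
    using continuous_on_compose2[OF expinv_continuous[of UNIV]] by auto
next
  case (Suc k)
  have s: "s differentiable (at x)" for x using assms[of "Suc 0"] by simp
  have d: "((\<lambda>x. expinv m (s x)) has_derivative
      (\<lambda>h. frechet_derivative s (at x) h * (expinv (m+2) (s x) - m * expinv (m+1) (s x)))) (at x)" for x
    using has_derivative_compose[OF s[of x, unfolded frechet_derivative_works]
        expinv_has_derivative[of m "s x", unfolded has_field_derivative_def]] by (simp add: mult.commute)
  have "frechet_derivative (\<lambda>x. expinv m (s x)) (at x) =
     (\<lambda>h. frechet_derivative s (at x) h * (expinv (m+2) (s x) - real m * expinv (m+1) (s x)))" for x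
    using frechet_derivative_at[OF d] by auto
  moreover have "C_k k (\<lambda>x. frechet_derivative s (at x) i)" if "i \<in> Basis" for i
    using assms[of "Suc k"] that by simp
  ultimately show ?case
    using d by (auto simp: differentiable_def intro!: C_k_mult C_k_diff C_k_const Suc)
qed


text \<open>With s = 1/t, the single term s^m / m! of the exponential series lies below exp s. The
  bound is uniform in t and makes the constants of the Laplacian estimate explicit.\<close>

lemma expinv_le_fact: "expinv m t \<le> fact m"
proof (cases "t \<le> 0")
  case False
  have "(1/t) ^ m / fact m \<le> exp (1/t)"
  proof -
    have "(1/t) ^ m / fact m \<le> (\<Sum>n. (1/t) ^ n / fact n)"
      using sum_le_suminf[OF summable_exp_generic, of "{m}" "1/t"] False
      by (simp add: divide_inverse mult.commute)
    then show ?thesis by (simp add: exp_def divide_inverse mult.commute)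
  qed
  with False show ?thesis
    by (simp add: expinv_def exp_minus field_simps)
qed (simp add: expinv_def)

section \<open>Radial bumps with an affine factor\<close>

text \<open>For r > 0 this is positive exactly on the open ball. The squared norm makes it a
  polynomial, smooth also at the centre.\<close>

definition bump_arg :: "'a::euclidean_space \<Rightarrow> real \<Rightarrow> 'a \<Rightarrow> real" where
  "bump_arg z r x = 1 - (norm (x - z))\<^sup>2 / r\<^sup>2"

definition bump :: "'a::euclidean_space \<Rightarrow> real \<Rightarrow> 'a \<Rightarrow> real" where
  "bump z r x = expinv 0 (bump_arg z r x)"

lemma bump_arg_has_derivative:
  "(bump_arg z r has_derivative (\<lambda>h. - 2 * ((x - z) \<bullet> h) / r\<^sup>2)) (at x)"
proof -
  have "bump_arg z r = (\<lambda>x. 1 - inverse (r\<^sup>2) * ((x - z) \<bullet> (x - z)))"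
    by (simp add: bump_arg_def fun_eq_iff power2_norm_eq_inner divide_inverse mult.commute)
  moreover have "((\<lambda>x. 1 - inverse (r\<^sup>2) * ((x - z) \<bullet> (x - z))) has_derivative (\<lambda>h. - 2 * ((x - z) \<bullet> h) / r\<^sup>2)) (at x)"
    by (auto intro!: derivative_eq_intros simp: inner_commute divide_inverse fun_eq_iff)
  ultimately show ?thesis by simp
qed

lemma C_k_bump_arg: "C_k k (bump_arg z r)"
proof (cases k)
  case 0
  then show ?thesis
    using bump_arg_has_derivative by (auto simp: continuous_on_eq_continuous_at intro: has_derivative_continuous)
next
  case (Suc j)
  have "C_k j (\<lambda>x. (- (2 / r\<^sup>2) *\<^sub>R i) \<bullet> x + 2 * (z \<bullet> i) / r\<^sup>2)" for i
    by (rule C_k_affine)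
  moreover have "(- (2 / r\<^sup>2) *\<^sub>R i) \<bullet> x + 2 * (z \<bullet> i) / r\<^sup>2 = frechet_derivative (bump_arg z r) (at x) i" for i x
    by (simp flip: frechet_derivative_at[OF bump_arg_has_derivative])
       (simp add: inner_commute[of _ i] inner_diff_right diff_divide_distrib right_diff_distrib)
  ultimately show ?thesis
    using differentiableI[OF bump_arg_has_derivative] Suc by auto
qed

lemma expinv_bump_has_derivative:
  "((\<lambda>x. expinv m (bump_arg z r x)) has_derivative
      (\<lambda>h. (expinv (m+2) (bump_arg z r x) - m * expinv (m+1) (bump_arg z r x)) * (- 2 * ((x - z) \<bullet> h) / r\<^sup>2))) (at x)"
  using has_derivative_compose[OF bump_arg_has_derivative
      expinv_has_derivative[of m "bump_arg z r x", unfolded has_field_derivative_def]] by simp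

definition laplace :: "('a::euclidean_space \<Rightarrow> real) \<Rightarrow> 'a \<Rightarrow> real" where
  "laplace v x = (\<Sum>i\<in>Basis. frechet_derivative (\<lambda>x. frechet_derivative v (at x) i) (at x) i)"

text \<open>Centring the affine factor at \<open>z\<close> makes |g| r + |c| its natural size on the
  ball. The values g = 0, c = 1 give back the plain bump used on sides.\<close>

definition abump :: "'a::euclidean_space \<Rightarrow> real \<Rightarrow> 'a \<Rightarrow> real \<Rightarrow> 'a \<Rightarrow> real" where
  "abump z r g c x = (g \<bullet> (x - z) + c) * bump z r x"

lemma abump_frechet_derivative:
  "frechet_derivative (abump z r g c) (at x) i =
     (g \<bullet> i) * bump z r x + (g \<bullet> (x - z) + c) * (expinv 2 (bump_arg z r x) * (- 2 * ((x - z) \<bullet> i) / r\<^sup>2))"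
proof -
  have "(abump z r g c has_derivative (\<lambda>i. (g \<bullet> i) * bump z r x + (g \<bullet> (x - z) + c) * (expinv 2 (bump_arg z r x) * (- 2 * ((x - z) \<bullet> i) / r\<^sup>2)))) (at x)"
  proof -
    have q: "((\<lambda>x. g \<bullet> (x - z) + c) has_derivative (\<lambda>h. g \<bullet> h)) (at x)"
      by (auto intro!: derivative_eq_intros)
    show ?thesis
      unfolding abump_def[abs_def] bump_def
      by (rule has_derivative_eq_rhs[OF has_derivative_mult[OF q expinv_bump_has_derivative]])
         (simp add: fun_eq_iff algebra_simps diff_divide_distrib add_divide_distrib numeral_2_eq_2)
  qed
  from fun_cong[OF frechet_derivative_at[OF this], symmetric] show ?thesis .
qed

lemma abump_frechet_derivative2:
  "frechet_derivative (\<lambda>x. frechet_derivative (abump z r g c) (at x) i) (at x) i =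
     (g \<bullet> i) * (expinv 2 (bump_arg z r x) * (- 2 * ((x - z) \<bullet> i) / r\<^sup>2)) * 2 +
     (g \<bullet> (x - z) + c) * ((expinv 4 (bump_arg z r x) - 2 * expinv 3 (bump_arg z r x)) * (- 2 * ((x - z) \<bullet> i) / r\<^sup>2)\<^sup>2
        - expinv 2 (bump_arg z r x) * (2 * (i \<bullet> i) / r\<^sup>2))"
proof -
  have e: "((\<lambda>x. expinv 2 (bump_arg z r x)) has_derivative
      (\<lambda>h. (expinv 4 (bump_arg z r x) - 2 * expinv 3 (bump_arg z r x)) * (- 2 * ((x - z) \<bullet> h) / r\<^sup>2))) (at x)"
    using expinv_bump_has_derivative[of 2 z r x] by simp
  have l: "((\<lambda>x. - 2 * ((x - z) \<bullet> i) / r\<^sup>2) has_derivative (\<lambda>h. - 2 * (h \<bullet> i) / r\<^sup>2)) (at x)"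
    unfolding divide_inverse by (auto intro!: derivative_eq_intros)
  have "((\<lambda>x. (g \<bullet> i) * expinv 0 (bump_arg z r x) + (g \<bullet> (x - z) + c) * (expinv 2 (bump_arg z r x) * (- 2 * ((x - z) \<bullet> i) / r\<^sup>2)))
     has_derivative (\<lambda>h. (g \<bullet> i) * (expinv 2 (bump_arg z r x) * (- 2 * ((x - z) \<bullet> h) / r\<^sup>2)) +
       (g \<bullet> h) * (expinv 2 (bump_arg z r x) * (- 2 * ((x - z) \<bullet> i) / r\<^sup>2)) +
      (g \<bullet> (x - z) + c) * ((expinv 4 (bump_arg z r x) - 2 * expinv 3 (bump_arg z r x)) * (- 2 * ((x - z) \<bullet> h) / r\<^sup>2) * (- 2 * ((x - z) \<bullet> i) / r\<^sup>2)
        - expinv 2 (bump_arg z r x) * (2 * (h \<bullet> i) / r\<^sup>2)))) (at x)"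
  proof -
    have q: "((\<lambda>x. g \<bullet> (x - z) + c) has_derivative (\<lambda>h. g \<bullet> h)) (at x)"
      by (auto intro!: derivative_eq_intros)
    show ?thesis
      by (rule has_derivative_eq_rhs[OF has_derivative_add[OF
            has_derivative_mult_right[OF expinv_bump_has_derivative]
            has_derivative_mult[OF q has_derivative_mult[OF e l]]]])
         (simp add: fun_eq_iff algebra_simps diff_divide_distrib add_divide_distrib numeral_2_eq_2)
  qed
  note D = fun_cong[OF frechet_derivative_at[OF this], symmetric]
  show ?thesis
    unfolding abump_frechet_derivative bump_def
    by (rule trans[OF D]) (simp add: power2_eq_square mult.commute mult.left_commute)
qed

text \<open>Up to the factor (|g| r + |c|) / r^2, the cross term of the two gradients gives 8 = 4 *
  2!, the squared first derivatives of \<open>bump_arg\<close> give 144 = 4 * 36 with the crude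
  bound 36 = 4! + 2 * 3!, and its second derivatives give 2 * 2! in each of the d directions.
  Outside the ball \<open>bump_arg\<close> is nonpositive and all terms vanish.\<close>

lemma laplace_abump_bound:
  assumes "0 < r"
  shows "\<bar>laplace (abump z r g c) (x :: 'a::euclidean_space)\<bar> \<le>
    (152 + 4 * real DIM('a)) * (norm g * r + \<bar>c\<bar>) / r\<^sup>2 * indicator (ball z r) x"
proof (cases "x \<in> ball z r")
  case False
  then have "r\<^sup>2 \<le> (norm (x - z))\<^sup>2"
    using assms by (intro power_mono) (auto simp: dist_norm norm_minus_commute)
  then have "bump_arg z r x \<le> 0" using assms by (simp add: bump_arg_def)
  then have "laplace (abump z r g c) x = 0"
    by (simp add: laplace_def abump_frechet_derivative2 expinv_def)
  then show ?thesis using assms by simp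
next
  case True
  then have n: "norm (x - z) \<le> r" by (simp add: dist_norm norm_minus_commute)
  let ?t = "bump_arg z r x" and ?q = "g \<bullet> (x - z) + c"
  have 1: "(\<Sum>i\<in>Basis. (g \<bullet> i) * ((x - z) \<bullet> i)) = g \<bullet> (x - z)"
    by (rule euclidean_inner[symmetric])
  have 2: "(\<Sum>i\<in>Basis. ((x - z) \<bullet> i)\<^sup>2) = (norm (x - z))\<^sup>2"
    by (subst power2_norm_eq_inner, subst euclidean_inner) (simp add: power2_eq_square)
  have "laplace (abump z r g c) x =
     (\<Sum>i\<in>Basis. (-4 / r\<^sup>2) * expinv 2 ?t * ((g \<bullet> i) * ((x - z) \<bullet> i)) +
       ?q * (expinv 4 ?t - 2 * expinv 3 ?t) * (4 / r^4) * ((x - z) \<bullet> i)\<^sup>2 - ?q * expinv 2 ?t * (2 / r\<^sup>2))"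
  proof -
    have "a * (e * (- 2 * y / r\<^sup>2)) * 2 + q * (d * (- 2 * y / r\<^sup>2)\<^sup>2 - e * (2 * 1 / r\<^sup>2)) =
      - 4 / r\<^sup>2 * e * (a * y) + q * d * (4 / r ^ 4) * y\<^sup>2 - q * e * (2 / r\<^sup>2)" for a e y q d :: real
    proof -
      have "(- 2 * y / r\<^sup>2)\<^sup>2 = 4 * y\<^sup>2 / r ^ 4"
        by (simp add: power_divide power_mult_distrib flip: power_mult)
      then show ?thesis by (simp add: algebra_simps)
    qed
    then show ?thesis
      unfolding laplace_def abump_frechet_derivative2 by (intro sum.cong refl) (simp only: inner_same_Basis)
  qed
  also have "\<dots> = (-4 / r\<^sup>2) * expinv 2 ?t * (g \<bullet> (x - z)) +
       ?q * (expinv 4 ?t - 2 * expinv 3 ?t) * (4 / r^4) * (norm (x - z))\<^sup>2 - ?q * expinv 2 ?t * (2 / r\<^sup>2) * real DIM('a)"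
    unfolding sum.distrib sum_subtractf sum_distrib_left[symmetric] 1 2 by simp
  finally have eq: "laplace (abump z r g c) x = \<dots>" .
  have E: "\<bar>expinv 2 ?t\<bar> \<le> 2" "\<bar>expinv 4 ?t - 2 * expinv 3 ?t\<bar> \<le> 36"
    using expinv_le_fact[of 2 ?t] expinv_le_fact[of 3 ?t] expinv_le_fact[of 4 ?t]
      expinv_nonneg[of 2 ?t] expinv_nonneg[of 3 ?t] expinv_nonneg[of 4 ?t]
    by (auto simp: fact_numeral abs_if)
  have gx: "\<bar>g \<bullet> (x - z)\<bar> \<le> norm g * r"
    using Cauchy_Schwarz_ineq2[of g "x - z"] mult_left_mono[OF n, of "norm g"] by simp
  let ?M = "norm g * r + \<bar>c\<bar>"
  have q: "\<bar>?q\<bar> \<le> ?M" using gx by linarith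
  have M: "0 \<le> ?M" using assms by simp
  have a: "\<bar>(-4 / r\<^sup>2) * expinv 2 ?t * (g \<bullet> (x - z))\<bar> \<le> 4 / r\<^sup>2 * 2 * ?M"
    unfolding abs_mult by (intro mult_mono E) (use gx in auto)
  have nn: "(norm (x - z))\<^sup>2 \<le> r\<^sup>2" using n by (simp add: power_mono)
  have "\<bar>?q * (expinv 4 ?t - 2 * expinv 3 ?t) * (4 / r^4) * (norm (x - z))\<^sup>2\<bar> \<le> ?M * 36 * (4 / r^4) * r\<^sup>2"
    unfolding abs_mult by (intro mult_mono E q) (use nn M in auto)
  also have "\<dots> = ?M * 144 / r\<^sup>2" using assms by (simp add: field_simps power2_eq_square power4_eq_xxxx)
  finally have b: "\<bar>?q * (expinv 4 ?t - 2 * expinv 3 ?t) * (4 / r^4) * (norm (x - z))\<^sup>2\<bar> \<le> ?M * 144 / r\<^sup>2" .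
  have c: "\<bar>?q * expinv 2 ?t * (2 / r\<^sup>2) * real DIM('a)\<bar> \<le> ?M * 2 * (2 / r\<^sup>2) * real DIM('a)"
    unfolding abs_mult by (intro mult_mono E q) (use M in auto)
  have "\<bar>laplace (abump z r g c) x\<bar> \<le> 4 / r\<^sup>2 * 2 * ?M + ?M * 144 / r\<^sup>2 + ?M * 2 * (2 / r\<^sup>2) * real DIM('a)"
    unfolding eq using a b c by linarith
  also have "\<dots> = (152 + 4 * real DIM('a)) * ?M / r\<^sup>2"
    by (simp add: algebra_simps add_divide_distrib)
  finally show ?thesis using True by simp
qed

lemma bump_bounds: "0 \<le> bump z r x" "bump z r x \<le> 1"
  using expinv_le_fact[of 0] expinv_nonneg[of 0] by (auto simp: bump_def)

lemma bump_outside: "0 < r \<Longrightarrow> x \<notin> ball z r \<Longrightarrow> bump z r x = 0"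
proof -
  assume r: "0 < r" "x \<notin> ball z r"
  then have "r\<^sup>2 \<le> (norm (x - z))\<^sup>2"
    by (intro power_mono) (auto simp: dist_norm norm_minus_commute)
  then show ?thesis using r by (simp add: bump_def bump_arg_def expinv_def)
qed

lemma abump_test_function:
  assumes "0 < r" "cball z r \<subseteq> \<Omega>"
  shows "abump z r g c \<in> test_functions \<Omega>"
proof -
  have "C_k k (\<lambda>x. g \<bullet> x + (c - g \<bullet> z))" for k by (rule C_k_affine)
  then have "C_k k (\<lambda>x. (g \<bullet> x + (c - g \<bullet> z)) * expinv 0 (bump_arg z r x))" for k
    by (intro C_k_mult C_k_expinv_comp C_k_bump_arg)
  then have C: "C_k k (abump z r g c)" for k
    unfolding abump_def[abs_def] bump_def by (simp add: inner_diff_right algebra_simps)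
  have "{x. abump z r g c x \<noteq> 0} \<subseteq> cball z r"
    using bump_outside[OF assms(1)] ball_subset_cball unfolding abump_def by fastforce
  then have s: "closure {x. abump z r g c x \<noteq> 0} \<subseteq> cball z r"
    by (simp add: closure_minimal)
  then have "compact (closure {x. abump z r g c x \<noteq> 0})"
    using compact_cball closed_closure compact_eq_bounded_closed bounded_subset by metis
  then show ?thesis using C s assms by (auto simp: test_functions_def)
qed

section \<open>Test functions and integration by parts\<close>

lemma test_functions_C_k: "v \<in> test_functions \<Omega> \<Longrightarrow> C_k k v"
  by (simp add: test_functions_def)

lemma test_functions_differentiable: "v \<in> test_functions \<Omega> \<Longrightarrow> v differentiable (at x)"
  using test_functions_C_k[of v \<Omega> "Suc 0"] by simp

lemma test_functions_continuous: "v \<in> test_functions \<Omega> \<Longrightarrow> continuous_on S v"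
  using test_functions_C_k[of v \<Omega> 0] continuous_on_subset by auto

lemma test_functions_outside: "v \<in> test_functions \<Omega> \<Longrightarrow> x \<notin> \<Omega> \<Longrightarrow> v x = 0"
  by (auto simp: test_functions_def closure_def)

lemma test_functions_bounded_support: "v \<in> test_functions \<Omega> \<Longrightarrow> bounded {x. v x \<noteq> 0}"
  unfolding test_functions_def by (auto intro: bounded_subset[OF compact_imp_bounded closure_subset])

lemma test_functions_mono: "v \<in> test_functions \<Omega> \<Longrightarrow> \<Omega> \<subseteq> \<Omega>' \<Longrightarrow> v \<in> test_functions \<Omega>'"
  by (auto simp: test_functions_def)

lemma test_functions_mult:
  assumes v: "v \<in> test_functions \<Omega>" and w: "\<And>k. C_k k w"
  shows "(\<lambda>x. w x * v x) \<in> test_functions \<Omega>"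
proof -
  have "closure {x. w x * v x \<noteq> 0} \<subseteq> closure {x. v x \<noteq> 0}"
    by (rule closure_mono) auto
  moreover have "compact (closure {x. v x \<noteq> 0})" "closure {x. v x \<noteq> 0} \<subseteq> \<Omega>"
    using v by (auto simp: test_functions_def)
  ultimately have "compact (closure {x. w x * v x \<noteq> 0})" "closure {x. w x * v x \<noteq> 0} \<subseteq> \<Omega>"
    by (meson bounded_subset closed_closure compact_eq_bounded_closed, blast)
  then show ?thesis
    using v w by (auto simp: test_functions_def intro!: C_k_mult)
qed

lemma test_functions_partial:
  assumes v: "v \<in> test_functions \<Omega>" and i: "i \<in> Basis"
  shows "(\<lambda>x. frechet_derivative v (at x) i) \<in> test_functions \<Omega>"
proof -
  let ?S = "closure {x. v x \<noteq> 0}"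
  have "frechet_derivative v (at x) i = 0" if "x \<notin> ?S" for x
  proof -
    have "((\<lambda>x. 0) has_derivative (\<lambda>h. 0)) (at x)" by simp
    then have "(v has_derivative (\<lambda>h. 0)) (at x)"
      by (rule has_derivative_transform_within_open[of _ _ _ _ "- ?S"])
         (use that closure_subset[of "{x. v x \<noteq> 0}"] in \<open>auto intro: open_Compl closed_closure simp del: Compl_iff closure_def\<close>)
    from frechet_derivative_at[OF this] show ?thesis by metis
  qed
  then have "{x. frechet_derivative v (at x) i \<noteq> 0} \<subseteq> ?S" by blast
  then have s: "closure {x. frechet_derivative v (at x) i \<noteq> 0} \<subseteq> ?S"
    by (simp add: closure_minimal)
  moreover have "compact ?S" "?S \<subseteq> \<Omega>" using v by (auto simp: test_functions_def)
  ultimately have "compact (closure {x. frechet_derivative v (at x) i \<noteq> 0})"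
    by (meson bounded_subset closed_closure compact_eq_bounded_closed)
  moreover have "C_k k (\<lambda>x. frechet_derivative v (at x) i)" for k
    using test_functions_C_k[OF v, of "Suc k"] i by simp
  ultimately show ?thesis using s \<open>?S \<subseteq> \<Omega>\<close> by (auto simp: test_functions_def)
qed

lemma test_functions_bounded:
  assumes v: "v \<in> test_functions \<Omega>"
  obtains B where "0 \<le> B" "\<And>x. \<bar>v x\<bar> \<le> B"
proof -
  let ?S = "closure {x. v x \<noteq> 0}"
  have "compact (v ` ?S)"
    by (rule compact_continuous_image) (use v test_functions_continuous[OF v] in \<open>auto simp: test_functions_def\<close>)
  then obtain B where "\<And>y. y \<in> v ` ?S \<Longrightarrow> \<bar>y\<bar> \<le> B"
    using compact_imp_bounded bounded_real by metis
  then have "\<bar>v x\<bar> \<le> max B 0" for x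
    by (cases "v x = 0") (auto simp: closure_def image_iff le_max_iff_disj)
  then show ?thesis using that[of "max B 0"] by auto
qed

lemma frechet_derivative_real_Basis:
  fixes v :: "'a::euclidean_space \<Rightarrow> real"
  assumes "v differentiable (at x)"
  shows "frechet_derivative v (at x) h = (\<Sum>i\<in>Basis. (h \<bullet> i) * frechet_derivative v (at x) i)"
proof -
  have l: "linear (frechet_derivative v (at x))"
    by (rule linear_frechet_derivative[OF assms])
  have "frechet_derivative v (at x) (\<Sum>i\<in>Basis. (h \<bullet> i) *\<^sub>R i) = (\<Sum>i\<in>Basis. (h \<bullet> i) * frechet_derivative v (at x) i)"
    by (simp add: linear_sum[OF l] linear_scale[OF l])
  then show ?thesis by (simp add: euclidean_representation)
qed

text \<open>Partial derivatives are again test functions and hence bounded, so the derivative has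
  bounded operator norm. The Lipschitz constant supplies the dominating function for difference
  quotients.\<close>

lemma test_functions_lipschitz:
  fixes v :: "'a::euclidean_space \<Rightarrow> real"
  assumes v: "v \<in> test_functions \<Omega>"
  obtains L where "L-lipschitz_on UNIV v"
proof -
  have "\<exists>B. \<forall>x. \<bar>frechet_derivative v (at x) i\<bar> \<le> B" if "i \<in> Basis" for i
    using test_functions_bounded[OF test_functions_partial[OF v that]] by metis
  then obtain B where B: "\<And>i x. i \<in> Basis \<Longrightarrow> \<bar>frechet_derivative v (at x) i\<bar> \<le> B i"
    by metis
  have "\<bar>frechet_derivative v (at x) h\<bar> \<le> (\<Sum>i\<in>Basis. B i) * norm h" for x h
  proof -
    have "\<bar>frechet_derivative v (at x) h\<bar> \<le> (\<Sum>i\<in>Basis. \<bar>(h \<bullet> i) * frechet_derivative v (at x) i\<bar>)"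
      unfolding frechet_derivative_real_Basis[OF test_functions_differentiable[OF v], of x h] by (rule sum_abs)
    also have "\<dots> \<le> (\<Sum>i\<in>Basis. norm h * B i)"
      unfolding abs_mult using B by (intro sum_mono mult_mono) (auto simp: Basis_le_norm)
    finally show ?thesis by (simp add: sum_distrib_left mult.commute)
  qed
  then have "onorm (frechet_derivative v (at x)) \<le> (\<Sum>i\<in>Basis. B i)" for x
    by (intro onorm_le) auto
  moreover have "0 \<le> (\<Sum>i\<in>Basis. B i)"
    by (intro sum_nonneg) (use B abs_ge_zero order_trans in blast)
  ultimately have "(\<Sum>i\<in>Basis. B i)-lipschitz_on UNIV v"
    using test_functions_differentiable[OF v, unfolded frechet_derivative_works]
    by (intro bounded_derivative_imp_lipschitz[where f'="\<lambda>x. frechet_derivative v (at x)"]) (auto intro: has_derivative_at_withinI)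
  then show ?thesis using that by blast
qed

lemma integrable_bounded_support:
  fixes f :: "'a::euclidean_space \<Rightarrow> real"
  assumes "f \<in> borel_measurable lborel" "\<And>x. \<bar>f x\<bar> \<le> B" "\<And>x. x \<notin> ball z r \<Longrightarrow> f x = 0"
  shows "integrable lborel f"
proof (rule Bochner_Integration.integrable_bound)
  show "integrable lborel (\<lambda>x. B * indicator (ball z r) x)"
    by (intro integrable_mult_right integrable_real_indicator) (use emeasure_bounded_finite[OF bounded_ball] in auto)
  show "AE x in lborel. norm (f x) \<le> norm (B * indicator (ball z r) x)"
    using assms by (auto intro!: AE_I2 split: split_indicator) (meson abs_ge_self order_trans)
qed (use assms in auto)

lemma test_functions_measurable [measurable]: "v \<in> test_functions \<Omega> \<Longrightarrow> v \<in> borel_measurable borel"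
  using test_functions_continuous[of v \<Omega> UNIV] by (rule borel_measurable_continuous_onI)

lemma test_functions_integrable: "v \<in> test_functions \<Omega> \<Longrightarrow> integrable lborel v"
proof -
  assume v: "v \<in> test_functions \<Omega>"
  obtain r where "{x. v x \<noteq> 0} \<subseteq> ball 0 r"
    using bounded_subset_ballD[OF test_functions_bounded_support[OF v]] by metis
  moreover obtain B where "\<And>x. \<bar>v x\<bar> \<le> B" using test_functions_bounded[OF v] by metis
  ultimately show ?thesis
    by (intro integrable_bounded_support[of v B 0 r]) (use test_functions_continuous[OF v] in \<open>auto simp: borel_measurable_continuous_onI\<close>)
qed

text \<open>Phrased for the steps 1/(n+1), because dominated convergence asks for a
  sequence.\<close>

lemma has_derivative_imp_quotient_tendsto:
  fixes w :: "'a::real_normed_vector \<Rightarrow> real"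
  assumes "(w has_derivative w') (at x)"
  shows "(\<lambda>n. (w (x + (1 / Suc n) *\<^sub>R e) - w x) * Suc n) \<longlonglongrightarrow> w' e"
proof -
  have l: "((\<lambda>t::real. x + t *\<^sub>R e) has_derivative (\<lambda>t. t *\<^sub>R e)) (at 0)"
    by (auto intro!: derivative_eq_intros)
  have "((\<lambda>t. w (x + t *\<^sub>R e)) has_derivative (\<lambda>t. w' (t *\<^sub>R e))) (at 0)"
    using has_derivative_compose[OF l, of w w'] assms by simp
  moreover have "w' (t *\<^sub>R e) = t * w' e" for t
    using has_derivative_linear[OF assms] by (simp add: linear_scale)
  ultimately have "((\<lambda>t. w (x + t *\<^sub>R e)) has_real_derivative (w' e)) (at 0)"
    by (simp add: has_field_derivative_def mult.commute[of _ "w' e"])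
  then have "((\<lambda>t. (w (x + t *\<^sub>R e) - w x) / t) \<longlongrightarrow> w' e) (at 0)"
    by (simp add: has_field_derivative_iff)
  moreover have "filterlim (\<lambda>n. 1 / real (Suc n)) (at 0) sequentially"
    using LIMSEQ_inverse_real_of_nat by (auto simp: filterlim_at inverse_eq_divide)
  ultimately have "(\<lambda>n. (w (x + (1 / real (Suc n)) *\<^sub>R e) - w x) / (1 / real (Suc n))) \<longlonglongrightarrow> w' e"
    by (rule filterlim_compose)
  then show ?thesis by simp
qed

text \<open>The difference quotients have integral zero by translation invariance.\<close>

lemma integral_directional_derivative_eq_0:
  fixes w D :: "'a::euclidean_space \<Rightarrow> real"
  assumes L: "L-lipschitz_on UNIV w" and supp: "\<And>x. x \<notin> ball 0 R \<Longrightarrow> w x = 0"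
    and D [measurable]: "D \<in> borel_measurable borel"
    and lim: "AE x in lborel. (\<lambda>n. (w (x + (1 / Suc n) *\<^sub>R e) - w x) * Suc n) \<longlonglongrightarrow> D x"
  shows "integrable lborel D" "(LINT x|lborel. D x) = 0"
proof -
  have L0: "0 \<le> L" using L by (rule lipschitz_on_nonneg)
  have [measurable]: "w \<in> borel_measurable borel"
    using lipschitz_on_continuous_on[OF L] by (rule borel_measurable_continuous_onI)
  let ?q = "\<lambda>n x. (w (x + (1 / Suc n) *\<^sub>R e) - w x) * Suc n"
  \<comment> \<open>Lipschitz continuity bounds the quotients by L |e|, and a shift of length at
    most |e| keeps them zero outside the enlarged ball. The absolute value covers a negative
    \<open>R\<close>.\<close>
  let ?g = "\<lambda>x. L * norm e * indicator (ball 0 (\<bar>R\<bar> + norm e)) x"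
  have bound: "norm (?q n x) \<le> ?g x" for n x
  proof (cases "x \<in> ball 0 (\<bar>R\<bar> + norm e)")
    case True
    have "\<bar>w (x + (1 / Suc n) *\<^sub>R e) - w x\<bar> \<le> L * norm ((1 / Suc n) *\<^sub>R e)"
      using lipschitz_onD[OF L, of "x + (1 / Suc n) *\<^sub>R e" x] by (simp add: dist_norm)
    then have "\<bar>w (x + (1 / Suc n) *\<^sub>R e) - w x\<bar> * Suc n \<le> L * norm ((1 / Suc n) *\<^sub>R e) * Suc n"
      by (rule mult_right_mono) simp
    also have "\<dots> = L * norm e" by simp
    finally show ?thesis using True by (simp add: abs_mult)
  next
    case False
    have "norm ((1 / Suc n) *\<^sub>R e) \<le> norm e"
      by (simp add: divide_le_eq mult_le_cancel_left1)
    then have "norm (x + (1 / Suc n) *\<^sub>R e) \<ge> \<bar>R\<bar>"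
      using False norm_triangle_ineq2[of x "- ((1 / Suc n) *\<^sub>R e)"] by simp
    then have "w (x + (1 / Suc n) *\<^sub>R e) = 0" "w x = 0"
      using False abs_ge_self[of R] norm_ge_zero[of e] by (auto intro!: supp simp del: norm_ge_zero)
    then show ?thesis using False by simp
  qed
  have g: "integrable lborel ?g"
    by (intro integrable_mult_right integrable_real_indicator) (use emeasure_bounded_finite[OF bounded_ball] in auto)
  have wi: "integrable lborel w"
  proof -
    have "compact (cball (0::'a) R)" by simp
    then have "bounded (w ` cball 0 R)"
      using compact_continuous_image[OF continuous_on_subset[OF lipschitz_on_continuous_on[OF L] subset_UNIV]] compact_imp_bounded by blast
    then obtain B where B: "\<And>x. x \<in> cball 0 R \<Longrightarrow> \<bar>w x\<bar> \<le> B"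
      unfolding bounded_real by blast
    then have "\<bar>w x\<bar> \<le> max B 0" for x
      using supp[of x] by (cases "x \<in> ball 0 R") (auto simp: le_max_iff_disj)
    then show ?thesis by (intro integrable_bounded_support[of _ "max B 0" 0 R]) (auto simp: supp)
  qed
  have "(LINT x|lborel. ?q n x) = 0" for n
  proof -
    have wt: "integrable lborel (\<lambda>x. w ((1 / Suc n) *\<^sub>R e + x))"
      using integrable_distr[of "\<lambda>x. (1 / Suc n) *\<^sub>R e + x" lborel borel w] wi
      unfolding lborel_distr_plus[of "(1 / Suc n) *\<^sub>R e"] by simp
    have "(LINT x|lborel. w ((1 / Suc n) *\<^sub>R e + x)) = (LINT x|lborel. w x)"
      using integral_distr[of "\<lambda>x. (1 / Suc n) *\<^sub>R e + x" lborel borel w]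
      unfolding lborel_distr_plus[of "(1 / Suc n) *\<^sub>R e"] by simp
    then show ?thesis
      using wt wi by (simp add: add.commute)
  qed
  moreover have "(\<lambda>n. LINT x|lborel. ?q n x) \<longlonglongrightarrow> (LINT x|lborel. D x)"
    by (rule integral_dominated_convergence[OF _ _ g lim]) (use bound in auto)
  ultimately have "(\<lambda>n::nat. 0) \<longlonglongrightarrow> (LINT x|lborel. D x)"
    by (simp only:)
  then show "(LINT x|lborel. D x) = 0"
    by (simp add: LIMSEQ_const_iff)
  show "integrable lborel D"
    by (rule integrable_dominated_convergence[OF _ _ g lim]) (use bound in auto)
qed

lemma integral_test_partial_eq_0:
  assumes v: "v \<in> test_functions \<Omega>" and i: "i \<in> Basis"
  shows "(LINT x|lborel. frechet_derivative v (at x) i) = 0"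
proof -
  obtain R where R: "{x. v x \<noteq> 0} \<subseteq> ball 0 R"
    using bounded_subset_ballD[OF test_functions_bounded_support[OF v]] by metis
  obtain L where L: "L-lipschitz_on UNIV v" using test_functions_lipschitz[OF v] .
  show ?thesis
  proof (rule integral_directional_derivative_eq_0[OF L])
    show "v x = 0" if "x \<notin> ball 0 R" for x using R that by auto
    show "(\<lambda>x. frechet_derivative v (at x) i) \<in> borel_measurable borel"
      using test_functions_measurable[OF test_functions_partial[OF v i]] .
    show "AE x in lborel. (\<lambda>n. (v (x + (1 / Suc n) *\<^sub>R i) - v x) * Suc n) \<longlonglongrightarrow> frechet_derivative v (at x) i"
      using test_functions_differentiable[OF v, unfolded frechet_derivative_works]
      by (intro AE_I2 has_derivative_imp_quotient_tendsto)
  qed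
qed

lemma test_functions_laplace:
  assumes "v \<in> test_functions \<Omega>"
  shows "laplace v \<in> borel_measurable borel" "integrable lborel (laplace v)"
    "x \<notin> \<Omega> \<Longrightarrow> laplace v x = 0"
proof -
  have *: "(\<lambda>x. frechet_derivative (\<lambda>x. frechet_derivative v (at x) i) (at x) i) \<in> test_functions \<Omega>" if "i \<in> Basis" for i
    using test_functions_partial[OF test_functions_partial[OF assms that] that] .
  show "laplace v \<in> borel_measurable borel" 
    unfolding laplace_def[abs_def] using * test_functions_measurable by (intro borel_measurable_sum) blast
  show "integrable lborel (laplace v)"
    unfolding laplace_def[abs_def] using * test_functions_integrable by (intro Bochner_Integration.integrable_sum) blast
  show "x \<notin> \<Omega> \<Longrightarrow> laplace v x = 0"
    unfolding laplace_def[abs_def] using test_functions_outside[OF *] by (intro sum.neutral) blast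
qed

text \<open>Both derivatives can be moved onto the affine function, whose second derivatives vanish:
  the i-th partial derivative of (g x + c) d_i v has integral zero, and so has the term g_i d_i v
  from the product rule. This removes the discrete function wherever it is affine.\<close>

lemma integral_affine_laplace_eq_0:
  fixes v :: "'a::euclidean_space \<Rightarrow> real"
  assumes v: "v \<in> test_functions \<Omega>"
  shows "(LINT x|lborel. (g \<bullet> x + c) * laplace v x) = 0"
proof -
  have "(LINT x|lborel. (g \<bullet> x + c) * frechet_derivative (\<lambda>x. frechet_derivative v (at x) i) (at x) i) = 0
      \<and> integrable lborel (\<lambda>x. (g \<bullet> x + c) * frechet_derivative (\<lambda>x. frechet_derivative v (at x) i) (at x) i)" if i: "i \<in> Basis" for i
  proof -
    let ?d = "\<lambda>x. frechet_derivative v (at x) i"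
    have d: "?d \<in> test_functions \<Omega>" by (rule test_functions_partial[OF v i])
    have q: "(\<lambda>x. (g \<bullet> x + c) * ?d x) \<in> test_functions \<Omega>"
      by (intro test_functions_mult d C_k_affine)
    have ai: "integrable lborel (\<lambda>x. (g \<bullet> x + c) * frechet_derivative ?d (at x) i)"
      by (intro test_functions_integrable[of _ \<Omega>] test_functions_mult test_functions_partial[OF d i] C_k_affine)
    have "frechet_derivative (\<lambda>x. (g \<bullet> x + c) * ?d x) (at x) i = (g \<bullet> i) * ?d x + (g \<bullet> x + c) * frechet_derivative ?d (at x) i" for x
    proof -
      have "((\<lambda>x. g \<bullet> x + c) has_derivative (\<lambda>h. g \<bullet> h)) (at x)"
        by (auto intro!: derivative_eq_intros)
      from fun_cong[OF frechet_derivative_at[OF this], of i] differentiableI[OF this] show ?thesis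
        by (simp add: frechet_derivative_mult_real test_functions_differentiable[OF d])
    qed
    then have "0 = (LINT x|lborel. (g \<bullet> i) * ?d x + (g \<bullet> x + c) * frechet_derivative ?d (at x) i)"
      using integral_test_partial_eq_0[OF q i] by simp
    also have "\<dots> = (LINT x|lborel. (g \<bullet> x + c) * frechet_derivative ?d (at x) i)"
      using integral_test_partial_eq_0[OF v i] test_functions_integrable[OF d] ai by simp
    finally show ?thesis using ai by simp
  qed
  then show ?thesis
    unfolding laplace_def sum_distrib_left by simp
qed

section \<open>Square integrable functions and weak gradients\<close>

lemma L2_spaceD:
  assumes "f \<in> L2_space S"
  shows "f \<in> borel_measurable (lebesgue_on S)" "integrable (lebesgue_on S) (\<lambda>x. (norm (f x))\<^sup>2)"
  using assms by (auto simp: L2_space_def)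

lemma L2_space_integrable_mult:
  fixes f g :: "'a::euclidean_space \<Rightarrow> real"
  assumes f: "f \<in> L2_space S" and g: "g \<in> L2_space S"
  shows "integrable (lebesgue_on S) (\<lambda>x. f x * g x)"
proof (rule Bochner_Integration.integrable_bound)
  show "integrable (lebesgue_on S) (\<lambda>x. (norm (f x))\<^sup>2 + (norm (g x))\<^sup>2)"
    by (intro Bochner_Integration.integrable_add L2_spaceD(2) f g)
  have "\<bar>a * b\<bar> \<le> a\<^sup>2 + b\<^sup>2" for a b :: real
    using sum_squares_bound[of "\<bar>a\<bar>" "\<bar>b\<bar>"] mult_nonneg_nonneg[of "\<bar>a\<bar>" "\<bar>b\<bar>"]
    unfolding abs_mult power2_abs by linarith
  then show "AE x in lebesgue_on S. norm (f x * g x) \<le> norm ((norm (f x))\<^sup>2 + (norm (g x))\<^sup>2)"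
    by auto
  show "(\<lambda>x. f x * g x) \<in> borel_measurable (lebesgue_on S)"
    by (intro borel_measurable_times L2_spaceD(1) f g)
qed

lemma L2_space_dominated:
  fixes f :: "'a::euclidean_space \<Rightarrow> real"
  assumes "g \<in> L2_space S" "f \<in> borel_measurable (lebesgue_on S)" "AE x in lebesgue_on S. \<bar>f x\<bar> \<le> \<bar>g x :: real\<bar>"
  shows "f \<in> L2_space S"
proof -
  have "integrable (lebesgue_on S) (\<lambda>x. (norm (f x))\<^sup>2)"
    by (rule Bochner_Integration.integrable_bound[OF L2_spaceD(2)[OF assms(1)]])
       (use assms in \<open>auto simp: abs_le_square_iff\<close>)
  then show ?thesis using assms by (simp add: L2_space_def)
qed

lemma L2_space_cmult: "f \<in> L2_space S \<Longrightarrow> (\<lambda>x. c * f x :: real) \<in> L2_space S"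
  by (auto simp: L2_space_def power_mult_distrib)

lemma L2_space_add:
  fixes f g :: "'a::euclidean_space \<Rightarrow> real"
  assumes f: "f \<in> L2_space S" and g: "g \<in> L2_space S"
  shows "(\<lambda>x. f x + g x) \<in> L2_space S"
proof -
  have "integrable (lebesgue_on S) (\<lambda>x. (f x)\<^sup>2 + (g x)\<^sup>2 + 2 * (f x * g x))"
    using L2_spaceD(2)[OF f] L2_spaceD(2)[OF g] L2_space_integrable_mult[OF f g] by auto
  moreover have "(\<lambda>x. (f x)\<^sup>2 + (g x)\<^sup>2 + 2 * (f x * g x)) = (\<lambda>x. (f x + g x)\<^sup>2)"
    by (simp add: power2_sum fun_eq_iff)
  ultimately show ?thesis
    using f g by (auto simp: L2_space_def)
qed

lemma L2_space_diff:
  fixes f g :: "'a::euclidean_space \<Rightarrow> real"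
  assumes f: "f \<in> L2_space S" and g: "g \<in> L2_space S"
  shows "(\<lambda>x. f x - g x) \<in> L2_space S"
  using L2_space_add[OF f L2_space_cmult[OF g, of "-1"]] by simp

lemma L2_norm_nonneg: "0 \<le> L2_norm S f"
  by (simp add: L2_norm_def)

lemma L2_norm_power2: "(L2_norm S f)\<^sup>2 = (LINT x|lebesgue_on S. (norm (f x))\<^sup>2)"
  by (simp add: L2_norm_def)

text \<open>The polynomial t -> ||t f - g||^2 is nonnegative, so its discriminant is nonpositive; a
  vanishing leading coefficient is treated apart.\<close>

lemma L2_Cauchy_Schwarz:
  fixes f g :: "'a::euclidean_space \<Rightarrow> real"
  assumes f: "f \<in> L2_space S" and g: "g \<in> L2_space S"
  shows "\<bar>LINT x|lebesgue_on S. f x * g x\<bar> \<le> L2_norm S f * L2_norm S g"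
proof -
  let ?a = "LINT x|lebesgue_on S. (f x)\<^sup>2" and ?b = "LINT x|lebesgue_on S. (g x)\<^sup>2"
    and ?c = "LINT x|lebesgue_on S. f x * g x"
  have i: "integrable (lebesgue_on S) (\<lambda>x. (f x)\<^sup>2)" "integrable (lebesgue_on S) (\<lambda>x. (g x)\<^sup>2)"
    using L2_spaceD(2)[OF f] L2_spaceD(2)[OF g] by auto
  note ifg = L2_space_integrable_mult[OF f g]
  have q: "0 \<le> t\<^sup>2 * ?a - 2 * t * ?c + ?b" for t
  proof -
    have "0 \<le> (LINT x|lebesgue_on S. (t * f x - g x)\<^sup>2)" by simp
    also have "\<dots> = (LINT x|lebesgue_on S. t\<^sup>2 * (f x)\<^sup>2 - 2 * t * (f x * g x) + (g x)\<^sup>2)"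
      by (simp add: power2_diff power_mult_distrib algebra_simps)
    also have "\<dots> = t\<^sup>2 * ?a - 2 * t * ?c + ?b"
      using i ifg by simp
    finally show ?thesis .
  qed
  have "?c\<^sup>2 \<le> ?a * ?b"
  proof (cases "?a = 0")
    case True
    have "?c = 0"
    proof (rule ccontr)
      assume "?c \<noteq> 0"
      \<comment> \<open>At this t the remaining polynomial b - 2 t c takes the value -1.\<close>
      then show False using q[of "(?b + 1) / (2 * ?c)"] True by simp
    qed
    then show ?thesis using True by simp
  next
    case False
    have "0 \<le> ?a" by simp
    with False have "0 < ?a" by linarith
    then show ?thesis using q[of "?c / ?a"] by (simp add: power2_eq_square field_simps)
  qed
  then have "\<bar>?c\<bar> \<le> sqrt (?a * ?b)"
    using real_le_rsqrt[of "\<bar>?c\<bar>"] by simp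
  then show ?thesis by (simp add: L2_norm_def real_sqrt_mult)
qed

lemma L2_norm_triangle:
  fixes f g :: "'a::euclidean_space \<Rightarrow> real"
  assumes f: "f \<in> L2_space S" and g: "g \<in> L2_space S"
  shows "L2_norm S (\<lambda>x. f x + g x) \<le> L2_norm S f + L2_norm S g"
proof (rule power2_le_imp_le)
  have i: "integrable (lebesgue_on S) (\<lambda>x. (f x)\<^sup>2)" "integrable (lebesgue_on S) (\<lambda>x. (g x)\<^sup>2)"
    using L2_spaceD(2)[OF f] L2_spaceD(2)[OF g] by auto
  have "(L2_norm S (\<lambda>x. f x + g x))\<^sup>2 = (LINT x|lebesgue_on S. (f x)\<^sup>2 + (g x)\<^sup>2 + 2 * (f x * g x))"
    by (simp add: L2_norm_power2 power2_sum algebra_simps)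
  also have "\<dots> = (L2_norm S f)\<^sup>2 + (L2_norm S g)\<^sup>2 + 2 * (LINT x|lebesgue_on S. f x * g x)"
    using i L2_space_integrable_mult[OF f g] by (simp add: L2_norm_power2)
  also have "\<dots> \<le> (L2_norm S f)\<^sup>2 + (L2_norm S g)\<^sup>2 + 2 * (L2_norm S f * L2_norm S g)"
    using L2_Cauchy_Schwarz[OF f g] by linarith
  finally show "(L2_norm S (\<lambda>x. f x + g x))\<^sup>2 \<le> (L2_norm S f + L2_norm S g)\<^sup>2"
    by (simp add: power2_sum algebra_simps)
qed (simp add: L2_norm_nonneg)

lemma L2_norm_abs: "L2_norm S (\<lambda>x. \<bar>f x\<bar> :: real) = L2_norm S f"
  by (simp add: L2_norm_def)

lemma L2_norm_minus: "L2_norm S (\<lambda>x. - f x :: real) = L2_norm S f"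
  by (simp add: L2_norm_def)

lemma L2_norm_cmult: "L2_norm S (\<lambda>x. c * f x :: real) = \<bar>c\<bar> * L2_norm S f"
  by (simp add: L2_norm_def power_mult_distrib real_sqrt_mult)

lemma L2_norm_mono:
  fixes f g :: "'a::euclidean_space \<Rightarrow> real"
  assumes "g \<in> L2_space S" "f \<in> borel_measurable (lebesgue_on S)" "AE x in lebesgue_on S. \<bar>f x\<bar> \<le> \<bar>g x\<bar>"
  shows "L2_norm S f \<le> L2_norm S g"
  unfolding L2_norm_def
  by (intro real_sqrt_le_mono integral_mono_AE L2_spaceD(2) assms L2_space_dominated[OF assms])
     (use assms(3) in \<open>auto simp: abs_le_square_iff\<close>)

text \<open>The weight \<open>c\<close> lets one rule serve both the triangle inequality, with c =
  1, and the Lipschitz estimates of the projections, with c = 2/\<alpha> or c = 1/\<beta>.\<close>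

lemma L2_norm_dominated_add:
  fixes f g h :: "'a::euclidean_space \<Rightarrow> real"
  assumes g: "g \<in> L2_space S" and h: "h \<in> L2_space S" and f: "f \<in> borel_measurable (lebesgue_on S)"
    and le: "AE x in lebesgue_on S. \<bar>f x\<bar> \<le> \<bar>g x\<bar> + c * \<bar>h x\<bar>" and c: "0 \<le> c"
  shows "L2_norm S f \<le> L2_norm S g + c * L2_norm S h"
proof -
  have g': "(\<lambda>x. \<bar>g x\<bar>) \<in> L2_space S" and h': "(\<lambda>x. c * \<bar>h x\<bar>) \<in> L2_space S"
    using g h by (auto simp: L2_space_def power_mult_distrib)
  have "L2_norm S f \<le> L2_norm S (\<lambda>x. \<bar>g x\<bar> + c * \<bar>h x\<bar>)"
    by (rule L2_norm_mono[OF L2_space_add[OF g' h'] f]) (use le c in auto)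
  also have "\<dots> \<le> L2_norm S (\<lambda>x. \<bar>g x\<bar>) + L2_norm S (\<lambda>x. c * \<bar>h x\<bar>)"
    by (rule L2_norm_triangle[OF g' h'])
  finally show ?thesis using c by (simp add: L2_norm_abs L2_norm_cmult)
qed

lemma borel_measurable_lebesgue_on:
  "f \<in> borel_measurable borel \<Longrightarrow> f \<in> borel_measurable (lebesgue_on S)"
  by (auto intro!: measurable_restrict_space1 measurable_completion)

text \<open>Derivatives are integrated over the whole space, where translation invariance is
  available, whereas the function spaces use \<open>lebesgue_on\<close>. Functions vanishing off
  \<open>S\<close> pass between the two.\<close>

lemma integral_lebesgue_on_eq_lborel:
  fixes f :: "'a::euclidean_space \<Rightarrow> real"
  assumes S: "S \<in> sets lebesgue" and f: "f \<in> borel_measurable borel" and out: "\<And>x. x \<notin> S \<Longrightarrow> f x = 0"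
  shows "(LINT x|lebesgue_on S. f x) = (LINT x|lborel. f x)"
    "integrable (lebesgue_on S) f \<longleftrightarrow> integrable lborel f"
proof -
  have e: "(\<lambda>x. indicator S x *\<^sub>R f x) = f" using out by (auto simp: fun_eq_iff indicator_def)
  show "(LINT x|lebesgue_on S. f x) = (LINT x|lborel. f x)"
    using S f by (subst integral_restrict_space, simp) (simp only: e, simp add: integral_completion)
  show "integrable (lebesgue_on S) f \<longleftrightarrow> integrable lborel f"
    using S f by (subst integrable_restrict_space, simp) (simp only: e, simp add: integrable_completion)
qed

lemma test_functions_L2:
  assumes "v \<in> test_functions \<Omega>'" "\<Omega> \<in> sets lebesgue" "\<Omega>' \<subseteq> \<Omega>"
  shows "v \<in> L2_space \<Omega>"
proof -
  have v: "v \<in> test_functions \<Omega>" using assms test_functions_mono by blast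
  have "(\<lambda>x. v x * v x) \<in> test_functions \<Omega>"
    by (intro test_functions_mult v test_functions_C_k[OF v])
  then have "integrable (lebesgue_on \<Omega>) (\<lambda>x. v x * v x)"
    using integral_lebesgue_on_eq_lborel(2)[OF assms(2), of "\<lambda>x. v x * v x"]
      test_functions_integrable test_functions_measurable test_functions_outside by blast
  then show ?thesis
    using test_functions_measurable[OF v] by (auto simp: L2_space_def borel_measurable_lebesgue_on power2_eq_square)
qed

lemma L2_norm_bounded_le:
  fixes f :: "'a::euclidean_space \<Rightarrow> real"
  assumes f: "f \<in> borel_measurable (lebesgue_on S)" and S: "S \<in> lmeasurable" and B: "AE x in lebesgue_on S. \<bar>f x\<bar> \<le> B" "0 \<le> B"
  shows "f \<in> L2_space S" "L2_norm S f \<le> B * sqrt (measure lebesgue S)"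
proof -
  have c: "(\<lambda>x. B) \<in> L2_space S"
    using S by (auto simp: L2_space_def integrable_restrict_space fmeasurable_def)
  then show "f \<in> L2_space S" by (rule L2_space_dominated) (use f B in auto)
  have "L2_norm S f \<le> L2_norm S (\<lambda>x. B)"
    by (rule L2_norm_mono[OF c f]) (use B in auto)
  also have "(LINT x|lebesgue_on S. (norm B)\<^sup>2) = B\<^sup>2 * measure lebesgue S"
    using S by (simp add: measure_restrict_space fmeasurable_def)
  then have "L2_norm S (\<lambda>x. B) = B * sqrt (measure lebesgue S)"
    using B by (simp add: L2_norm_def real_sqrt_mult)
  finally show "L2_norm S f \<le> B * sqrt (measure lebesgue S)" .
qed

section \<open>The fundamental lemma of the calculus of variations\<close>

lemma C_k_real_polynomial_function:
  assumes "real_polynomial_function p" shows "C_k k (p :: 'a::euclidean_space \<Rightarrow> real)"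
  using assms
proof induction
  case (linear f)
  \<comment> \<open>Riesz representation of a linear functional on a finite-dimensional
    space.\<close>
  then have "f = (\<lambda>x. adjoint f 1 \<bullet> x)"
    by (auto simp: fun_eq_iff adjoint_works[OF bounded_linear.linear] inner_commute[of "adjoint f 1"])
  then show ?case using C_k_inner by metis
qed (auto intro: C_k_const C_k_add C_k_mult)

text \<open>By the Weierstrass theorem, \<open>bump * D\<close> is orthogonal to all continuous functions, hence to
  the pointwise a.e. limit \<open>sgn D\<close> of such functions.\<close>

lemma fundamental_lemma_calculus_of_variations_ball:
  fixes D :: "'a::euclidean_space \<Rightarrow> real"
  assumes \<Omega>: "open \<Omega>" and D: "D \<in> L2_space \<Omega>" and r: "0 < r" "cball z r \<subseteq> \<Omega>"
    and z: "\<And>\<phi>. \<phi> \<in> test_functions \<Omega> \<Longrightarrow> (LINT x|lebesgue_on \<Omega>. \<phi> x * D x) = 0"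
  shows "AE x in lebesgue_on \<Omega>. x \<in> ball z r \<longrightarrow> D x = 0"
proof -
  let ?M = "lebesgue_on \<Omega>"
  have \<Omega>m: "\<Omega> \<in> sets lebesgue" using \<Omega> by (simp add: borel_open)
  have [measurable]: "D \<in> borel_measurable ?M" using D by (auto dest: L2_spaceD)
  have ab: "abump z r 0 1 = bump z r" by (simp add: abump_def fun_eq_iff)
  have \<eta>: "bump z r \<in> test_functions \<Omega>" using abump_test_function[OF r, of 0 1] ab by simp
  have i\<eta>: "integrable ?M (\<lambda>x. bump z r x * D x)"
    by (rule L2_space_integrable_mult[OF test_functions_L2[OF \<eta> \<Omega>m order_refl] D])
  have [measurable]: "bump z r \<in> borel_measurable ?M"
    using test_functions_measurable[OF \<eta>] by (rule borel_measurable_lebesgue_on)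
  have poly: "(LINT x|?M. p x * (bump z r x * D x)) = 0" "integrable ?M (\<lambda>x. p x * (bump z r x * D x))" if "real_polynomial_function p" for p
  proof -
    have *: "(\<lambda>x. p x * bump z r x) \<in> test_functions \<Omega>"
      by (intro test_functions_mult \<eta> C_k_real_polynomial_function that)
    show "(LINT x|?M. p x * (bump z r x * D x)) = 0" using z[OF *] by (simp add: mult.assoc)
    show "integrable ?M (\<lambda>x. p x * (bump z r x * D x))"
      using L2_space_integrable_mult[OF test_functions_L2[OF * \<Omega>m order_refl] D] by (simp add: mult.assoc)
  qed
  have cont: "(LINT x|?M. g x * (bump z r x * D x)) = 0"
    if g: "continuous_on UNIV g" "\<And>x. \<bar>g x\<bar> \<le> 1" for g :: "'a \<Rightarrow> real"
  proof -
    have [measurable]: "g \<in> borel_measurable ?M"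
      by (intro borel_measurable_lebesgue_on borel_measurable_continuous_onI g)
    have ig: "integrable ?M (\<lambda>x. g x * (bump z r x * D x))"
      by (rule Bochner_Integration.integrable_bound[OF i\<eta>])
         (use g(2) in \<open>auto simp: abs_mult mult_le_cancel_right1 intro!: mult_left_le_one_le\<close>)
    have "\<bar>LINT x|?M. g x * (bump z r x * D x)\<bar> \<le> e * (LINT x|?M. \<bar>bump z r x * D x\<bar>)" if e: "0 < e" for e
    proof -
      obtain p where p: "real_polynomial_function p" "\<And>x. x \<in> cball z r \<Longrightarrow> \<bar>g x - p x\<bar> < e"
        using Stone_Weierstrass_real_polynomial_function[OF compact_cball continuous_on_subset[OF g(1) subset_UNIV] e] by metis
      have le: "\<bar>g x * (bump z r x * D x) - p x * (bump z r x * D x)\<bar> \<le> e * \<bar>bump z r x * D x\<bar>" for x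
      proof (cases "x \<in> cball z r")
        case True
        then have "\<bar>g x - p x\<bar> \<le> e" using p by fastforce
        then have "\<bar>g x - p x\<bar> * \<bar>bump z r x * D x\<bar> \<le> e * \<bar>bump z r x * D x\<bar>"
          by (rule mult_right_mono) simp
        then show ?thesis by (simp add: left_diff_distrib flip: abs_mult)
      next
        case False
        then have "bump z r x = 0" using ball_subset_cball by (intro bump_outside[OF r(1)]) blast
        then show ?thesis by simp
      qed
      have "\<bar>LINT x|?M. g x * (bump z r x * D x)\<bar> = \<bar>LINT x|?M. g x * (bump z r x * D x) - p x * (bump z r x * D x)\<bar>"
        using poly[OF p(1)] ig by simp
      also have "\<dots> \<le> (LINT x|?M. \<bar>g x * (bump z r x * D x) - p x * (bump z r x * D x)\<bar>)"
        by (rule integral_abs_bound)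
      also have "\<dots> \<le> (LINT x|?M. e * \<bar>bump z r x * D x\<bar>)"
        by (rule integral_mono) (use le poly[OF p(1)] ig i\<eta> in auto)
      also have "\<dots> = e * (LINT x|?M. \<bar>bump z r x * D x\<bar>)" by simp
      finally show ?thesis .
    qed
    note small = this
    let ?I = "LINT x|?M. \<bar>bump z r x * D x\<bar>"
    have I0: "0 \<le> ?I" by simp
    have I1: "i / (2 * (i + 1)) < 1" if "0 \<le> i" for i :: real
      using that by (simp add: field_simps)
    show ?thesis
    proof (rule ccontr)
      assume n: "\<not> ?thesis"
      let ?A = "\<bar>LINT x|?M. g x * (bump z r x * D x)\<bar>"
      have A: "0 < ?A" using n by simp
      \<comment> \<open>The tolerance A / (2 (I + 1)) gives A \<le> A I / (2 (I + 1)) < A whatever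
        the size of I, including I = 0.\<close>
      have "?A \<le> ?A / (2 * (?I + 1)) * ?I"
        by (rule small) (use A I0 in \<open>auto intro!: divide_pos_pos add_nonneg_pos\<close>)
      also have "?A / (2 * (?I + 1)) * ?I = ?A * (?I / (2 * (?I + 1)))" by simp
      also have "\<dots> < ?A * 1"
      proof (rule mult_strict_left_mono[OF _ A])
        show "?I / (2 * (?I + 1)) < 1" by (rule I1[OF I0])
      qed
      finally show False by simp
    qed
  qed
  let ?s = "\<lambda>x. if x \<in> \<Omega> then sgn (D x) else 0"
  have "(\<lambda>x. sgn (D x)) \<in> borel_measurable ?M" by measurable
  then have "?s \<in> borel_measurable lebesgue"
    using borel_measurable_if[OF \<Omega>m, of "\<lambda>x. sgn (D x)"] by simp
  then have "?s measurable_on UNIV"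
    using lebesgue_measurable_imp_measurable_on[of ?s UNIV] by simp
  \<comment> \<open>\<open>measurable_on\<close> means being the limit of continuous functions off a
    negligible set; extending sgn D by 0 makes them available on the whole space.\<close>
  then obtain N g where N: "negligible N" and g: "\<And>n::nat. continuous_on UNIV (g n)"
    and lim: "\<And>x. x \<notin> N \<Longrightarrow> (\<lambda>n. g n x) \<longlonglongrightarrow> ?s x"
    unfolding measurable_on_def by auto
  \<comment> \<open>Truncation to [-1, 1] does not change the limit; it makes \<open>cont\<close>
    applicable and |bump D| a dominating function.\<close>
  define h where "h n x = max (-1) (min 1 (g n x))" for n x
  have h: "continuous_on UNIV (h n)" "\<bar>h n x\<bar> \<le> 1" for n x
    unfolding h_def using g by (auto intro!: continuous_intros)
  have hlim: "(\<lambda>n. h n x) \<longlonglongrightarrow> ?s x" if "x \<notin> N" for x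
  proof -
    have "(\<lambda>n. h n x) \<longlonglongrightarrow> max (-1) (min 1 (?s x))"
      unfolding h_def by (intro tendsto_intros lim that)
    moreover have "max (-1) (min 1 (?s x)) = ?s x" by (auto simp: sgn_if)
    ultimately show ?thesis by simp
  qed
  have [measurable]: "h n \<in> borel_measurable ?M" for n
    by (intro borel_measurable_lebesgue_on borel_measurable_continuous_onI h)
  have aeN: "AE x in ?M. x \<notin> N"
    using N \<Omega>m by (auto simp: AE_restrict_space_iff negligible_iff_null_sets intro: AE_not_in eventually_mono)
  have "(\<lambda>n. LINT x|?M. h n x * (bump z r x * D x)) \<longlonglongrightarrow> (LINT x|?M. bump z r x * \<bar>D x\<bar>)"
  proof (rule integral_dominated_convergence[where w="\<lambda>x. \<bar>bump z r x * D x\<bar>"])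
    show "integrable ?M (\<lambda>x. \<bar>bump z r x * D x\<bar>)" using i\<eta> by simp
    have *: "(\<lambda>n. h n x * (bump z r x * D x)) \<longlonglongrightarrow> bump z r x * \<bar>D x\<bar>" if "x \<notin> N" "x \<in> \<Omega>" for x
    proof -
      have "(\<lambda>n. h n x * (bump z r x * D x)) \<longlonglongrightarrow> ?s x * (bump z r x * D x)"
        by (intro tendsto_intros hlim that)
      moreover have "?s x * (bump z r x * D x) = bump z r x * \<bar>D x\<bar>"
        using that by (auto simp: sgn_if)
      ultimately show ?thesis by simp
    qed
    show "AE x in ?M. (\<lambda>n. h n x * (bump z r x * D x)) \<longlonglongrightarrow> bump z r x * \<bar>D x\<bar>"
      using aeN AE_space by eventually_elim (use * in auto)
    show "AE x in ?M. norm (h n x * (bump z r x * D x)) \<le> \<bar>bump z r x * D x\<bar>" for n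
      using h(2) by (auto simp: abs_mult intro!: mult_left_le_one_le)
  qed auto
  then have "(LINT x|?M. bump z r x * \<bar>D x\<bar>) = 0"
    using cont[OF h] by (simp add: LIMSEQ_const_iff)
  moreover have "integrable ?M (\<lambda>x. bump z r x * \<bar>D x\<bar>)"
    using integrable_abs[OF i\<eta>] bump_bounds(1)[of z r] by (simp add: abs_mult)
  ultimately have "AE x in ?M. bump z r x * \<bar>D x\<bar> = 0"
    using integral_nonneg_eq_0_iff_AE[of ?M "\<lambda>x. bump z r x * \<bar>D x\<bar>"] bump_bounds(1)[of z r]
    by (metis (no_types, lifting) AE_I2 abs_ge_zero mult_nonneg_nonneg)
  moreover have nz: "bump z r x \<noteq> 0" if "x \<in> ball z r" for x
  proof -
    have "norm (x - z) < r"
      using that by (auto simp: dist_norm norm_minus_commute)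
    then have "norm (x - z) < r" "(norm (x - z))\<^sup>2 < r\<^sup>2"
      using r by (auto intro: power_strict_mono)
    then show ?thesis using r by (simp add: bump_def bump_arg_def expinv_def)
  qed
  ultimately show ?thesis
    by eventually_elim (use nz in simp)
qed

text \<open>Each ball comes with its own exceptional null set; by Lindelof countably many balls
  cover \<Omega>, so these sets can be united.\<close>

lemma fundamental_lemma_calculus_of_variations:
  fixes D :: "'a::euclidean_space \<Rightarrow> real"
  assumes \<Omega>: "open \<Omega>" and D: "D \<in> L2_space \<Omega>"
    and z: "\<And>\<phi>. \<phi> \<in> test_functions \<Omega> \<Longrightarrow> (LINT x|lebesgue_on \<Omega>. \<phi> x * D x) = 0"
  shows "AE x in lebesgue_on \<Omega>. D x = 0"
proof -
  let ?F = "{ball z r | z r. 0 < r \<and> cball z r \<subseteq> \<Omega>}"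
  obtain F where F: "F \<subseteq> ?F" "countable F" "\<Union>F = \<Union>?F"
    using Lindelof[of ?F] by auto
  have "AE x in lebesgue_on \<Omega>. \<forall>S\<in>F. x \<in> S \<longrightarrow> D x = 0"
  proof (subst AE_ball_countable[OF F(2)], intro ballI)
    fix S assume "S \<in> F"
    then obtain z r where "S = ball z r" "0 < r" "cball z r \<subseteq> \<Omega>" using F(1) by blast
    then show "AE x in lebesgue_on \<Omega>. x \<in> S \<longrightarrow> D x = 0"
      using fundamental_lemma_calculus_of_variations_ball[OF \<Omega> D _ _ z] by blast
  qed
  moreover have "AE x in lebesgue_on \<Omega>. x \<in> \<Omega>"
    using AE_space[of "lebesgue_on \<Omega>"] by simp
  ultimately show ?thesis
  proof eventually_elim
    case (elim x)
    obtain r where "0 < r" "cball x r \<subseteq> \<Omega>" using \<Omega> elim(2) open_contains_cball by blast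
    then have "x \<in> \<Union>F" using F(3) by (auto intro!: exI[of _ "ball x r"])
    then show ?case using elim(1) by auto
  qed
qed

section \<open>Weak gradients and the very weak form of the equations\<close>

lemma L2_space_inner_Basis:
  assumes "G \<in> L2_space S" "i \<in> Basis"
  shows "(\<lambda>x. G x \<bullet> i) \<in> L2_space S"
proof -
  have m: "(\<lambda>x. G x \<bullet> i) \<in> borel_measurable (lebesgue_on S)"
    using L2_spaceD(1)[OF assms(1)] by measurable
  have "integrable (lebesgue_on S) (\<lambda>x. (norm (G x \<bullet> i))\<^sup>2)"
    by (rule Bochner_Integration.integrable_bound[OF L2_spaceD(2)[OF assms(1)]])
       (use m assms(2) in \<open>auto intro!: power_mono simp: Basis_le_norm abs_le_square_iff[symmetric]\<close>)
  then show ?thesis using m by (simp add: L2_space_def)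
qed

lemma L2_spaceI_Basis:
  fixes G :: "'a::euclidean_space \<Rightarrow> 'b::euclidean_space"
  assumes "\<And>i. i \<in> Basis \<Longrightarrow> (\<lambda>x. G x \<bullet> i) \<in> L2_space S"
  shows "G \<in> L2_space S"
proof -
  have "integrable (lebesgue_on S) (\<lambda>x. \<Sum>i\<in>Basis. (norm (G x \<bullet> i))\<^sup>2)"
    using assms by (intro Bochner_Integration.integrable_sum L2_spaceD(2)) auto
  moreover have "(\<lambda>x. \<Sum>i\<in>Basis. (norm (G x \<bullet> i))\<^sup>2) = (\<lambda>x. (norm (G x))\<^sup>2)"
    by (subst power2_norm_eq_inner, subst euclidean_inner) (simp add: power2_eq_square)
  moreover have "G \<in> borel_measurable (lebesgue_on S)"
    using assms by (subst borel_measurable_euclidean_space) (auto dest: L2_spaceD)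
  ultimately show ?thesis by (simp add: L2_space_def)
qed

lemma L2_space_integrable_inner:
  fixes F G :: "'a::euclidean_space \<Rightarrow> 'b::euclidean_space"
  assumes "F \<in> L2_space S" "G \<in> L2_space S"
  shows "integrable (lebesgue_on S) (\<lambda>x. F x \<bullet> G x)"
    "L2_inner S F G = (\<Sum>i\<in>Basis. LINT x|lebesgue_on S. (F x \<bullet> i) * (G x \<bullet> i))"
proof -
  have *: "integrable (lebesgue_on S) (\<lambda>x. (F x \<bullet> i) * (G x \<bullet> i))" if "i \<in> Basis" for i
    using assms that by (intro L2_space_integrable_mult L2_space_inner_Basis)
  show "integrable (lebesgue_on S) (\<lambda>x. F x \<bullet> G x)"
    by (subst euclidean_inner) (use * in auto)
  show "L2_inner S F G = (\<Sum>i\<in>Basis. LINT x|lebesgue_on S. (F x \<bullet> i) * (G x \<bullet> i))"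
    unfolding L2_inner_def by (subst euclidean_inner) (use * in auto)
qed

lemma grad_inner_Basis: "i \<in> Basis \<Longrightarrow> grad v x \<bullet> i = frechet_derivative v (at x) i"
  by (simp add: grad_def inner_sum_left inner_Basis if_distrib cong: if_cong)

lemma integrable_scaleR_L2:
  fixes G :: "'a::euclidean_space \<Rightarrow> 'b::euclidean_space"
  assumes v: "v \<in> L2_space S" and G: "G \<in> L2_space S"
  shows "integrable (lebesgue_on S) (\<lambda>x. v x *\<^sub>R G x)"
proof -
  have "integrable (lebesgue_on S) (\<lambda>x. \<Sum>i\<in>Basis. (v x * (G x \<bullet> i)) *\<^sub>R i)"
    using v G by (intro Bochner_Integration.integrable_sum integrable_scaleR_left L2_space_integrable_mult L2_space_inner_Basis)
  moreover have "(\<Sum>i\<in>Basis. (v x * (G x \<bullet> i)) *\<^sub>R i) = v x *\<^sub>R G x" for x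
    by (simp only: scaleR_scaleR[symmetric] scaleR_sum_right[symmetric] euclidean_representation)
  ultimately show ?thesis by simp
qed

lemma integral_scaleR_inner_Basis:
  fixes G :: "'a::euclidean_space \<Rightarrow> 'b::euclidean_space"
  assumes v: "v \<in> L2_space S" and G: "G \<in> L2_space S"
  shows "(LINT x|lebesgue_on S. v x *\<^sub>R G x) \<bullet> i = (LINT x|lebesgue_on S. v x * (G x \<bullet> i))"
  using integral_inner_left[of i "lebesgue_on S" "\<lambda>x. v x *\<^sub>R G x"] integrable_scaleR_L2[OF v G] by simp

context
  fixes \<Omega> :: "'a::euclidean_space set"
  assumes \<Omega>: "open \<Omega>"
begin

lemma sets_lebesgue_\<Omega>: "\<Omega> \<in> sets lebesgue"
  using \<Omega> by (simp add: borel_open)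

lemma test_L2: "v \<in> test_functions \<Omega> \<Longrightarrow> v \<in> L2_space \<Omega>"
  using test_functions_L2[of v \<Omega> \<Omega>] sets_lebesgue_\<Omega> by blast

lemma grad_test_L2: "v \<in> test_functions \<Omega> \<Longrightarrow> grad v \<in> L2_space \<Omega>"
  by (rule L2_spaceI_Basis) (simp add: grad_inner_Basis test_L2 test_functions_partial)

text \<open>Inner products with basis vectors turn the vector identity into scalar ones, to which
  the facts on partial derivatives and the fundamental lemma apply. Membership of \<open>v\<close>
  in \<open>L2_space\<close> provides the integrability for moving the inner product under the
  integral.\<close>

lemma has_weak_gradient_iff:
  assumes "v \<in> L2_space \<Omega>"
  shows "has_weak_gradient \<Omega> v G \<longleftrightarrow> G \<in> L2_space \<Omega> \<and> (\<forall>\<phi>\<in>test_functions \<Omega>. \<forall>i\<in>Basis.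
     (LINT x|lebesgue_on \<Omega>. v x * frechet_derivative \<phi> (at x) i) = - (LINT x|lebesgue_on \<Omega>. \<phi> x * (G x \<bullet> i)))"
proof -
  have "(LINT x|lebesgue_on \<Omega>. v x *\<^sub>R grad \<phi> x) = - (LINT x|lebesgue_on \<Omega>. \<phi> x *\<^sub>R G x) \<longleftrightarrow>
     (\<forall>i\<in>Basis. (LINT x|lebesgue_on \<Omega>. v x * frechet_derivative \<phi> (at x) i) = - (LINT x|lebesgue_on \<Omega>. \<phi> x * (G x \<bullet> i)))"
    if "G \<in> L2_space \<Omega>" "\<phi> \<in> test_functions \<Omega>" for \<phi>
    unfolding euclidean_eq_iff[where 'a='a]
    using that assms by (simp add: integral_scaleR_inner_Basis grad_inner_Basis grad_test_L2 test_L2 cong: ball_cong)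
  then show ?thesis unfolding has_weak_gradient_def by blast
qed

lemma has_weak_gradient_test:
  assumes v: "v \<in> test_functions \<Omega>"
  shows "has_weak_gradient \<Omega> v (grad v)"
  unfolding has_weak_gradient_iff[OF test_L2[OF v]]
proof (intro conjI ballI)
  show "grad v \<in> L2_space \<Omega>" using grad_test_L2[OF v] .
  fix \<phi> i assume \<phi>: "\<phi> \<in> test_functions \<Omega>" and i: "(i::'a) \<in> Basis"
  have 1: "(\<lambda>x. v x * frechet_derivative \<phi> (at x) i) \<in> test_functions \<Omega>"
    by (intro test_functions_mult test_functions_partial \<phi> i test_functions_C_k[OF v])
  have 2: "(\<lambda>x. \<phi> x * frechet_derivative v (at x) i) \<in> test_functions \<Omega>"
    by (intro test_functions_mult test_functions_partial v i test_functions_C_k[OF \<phi>])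
  have "0 = (LINT x|lborel. frechet_derivative (\<lambda>x. v x * \<phi> x) (at x) i)"
    using integral_test_partial_eq_0[OF test_functions_mult[OF \<phi> test_functions_C_k[OF v]] i] by simp
  also have "\<dots> = (LINT x|lborel. \<phi> x * frechet_derivative v (at x) i + v x * frechet_derivative \<phi> (at x) i)"
    by (simp add: frechet_derivative_mult_real test_functions_differentiable[OF v] test_functions_differentiable[OF \<phi>] mult.commute add.commute)
  also have "\<dots> = (LINT x|lborel. \<phi> x * frechet_derivative v (at x) i) + (LINT x|lborel. v x * frechet_derivative \<phi> (at x) i)"
    by (intro Bochner_Integration.integral_add test_functions_integrable[OF 1] test_functions_integrable[OF 2])
  finally have 0: "0 = \<dots>" .
  have "(LINT x|lebesgue_on \<Omega>. w x) = (LINT x|lborel. w x)" if "w \<in> test_functions \<Omega>" for w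
    by (rule integral_lebesgue_on_eq_lborel(1)[OF sets_lebesgue_\<Omega> test_functions_measurable[OF that] test_functions_outside[OF that]])
  then show "(LINT x|lebesgue_on \<Omega>. v x * frechet_derivative \<phi> (at x) i) = - (LINT x|lebesgue_on \<Omega>. \<phi> x * (grad v x \<bullet> i))"
    using 0 1 2 i by (simp add: grad_inner_Basis)
qed

text \<open>\<open>weak_grad\<close> is an arbitrary choice of a weak gradient; uniqueness up to
  null sets is what identifies it with the classical gradient on test functions.\<close>

lemma has_weak_gradient_unique:
  assumes v: "v \<in> L2_space \<Omega>" and G: "has_weak_gradient \<Omega> v G" "has_weak_gradient \<Omega> v G'"
  shows "AE x in lebesgue_on \<Omega>. G x = G' x"
proof -
  have L: "G \<in> L2_space \<Omega>" "G' \<in> L2_space \<Omega>" using G by (auto simp: has_weak_gradient_def)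
  have "AE x in lebesgue_on \<Omega>. G x \<bullet> i - G' x \<bullet> i = 0" if i: "i \<in> Basis" for i
  proof (rule fundamental_lemma_calculus_of_variations[OF \<Omega>])
    show "(\<lambda>x. G x \<bullet> i - G' x \<bullet> i) \<in> L2_space \<Omega>"
      by (intro L2_space_diff L2_space_inner_Basis L i)
    fix \<phi> assume \<phi>: "\<phi> \<in> test_functions \<Omega>"
    have "(LINT x|lebesgue_on \<Omega>. \<phi> x * (G x \<bullet> i)) = (LINT x|lebesgue_on \<Omega>. \<phi> x * (G' x \<bullet> i))"
    proof -
      have "(LINT x|lebesgue_on \<Omega>. v x * frechet_derivative \<phi> (at x) i) = - (LINT x|lebesgue_on \<Omega>. \<phi> x * (H x \<bullet> i))"
        if "has_weak_gradient \<Omega> v H" for H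
        using that \<phi> i unfolding has_weak_gradient_iff[OF v] by blast
      from this[OF G(1)] this[OF G(2)] show ?thesis by simp
    qed
    then show "(LINT x|lebesgue_on \<Omega>. \<phi> x * (G x \<bullet> i - G' x \<bullet> i)) = 0"
      using L2_space_integrable_mult[OF test_L2[OF \<phi>] L2_space_inner_Basis[OF L(1) i]]
        L2_space_integrable_mult[OF test_L2[OF \<phi>] L2_space_inner_Basis[OF L(2) i]]
      by (simp add: right_diff_distrib)
  qed
  then have "AE x in lebesgue_on \<Omega>. \<forall>i\<in>Basis. G x \<bullet> i - G' x \<bullet> i = 0"
    by (intro AE_finite_allI) auto
  then show ?thesis by eventually_elim (auto simp: euclidean_eq_iff[where 'a='a])
qed

lemma weak_grad_H1:
  assumes "v \<in> H1 \<Omega>" shows "has_weak_gradient \<Omega> v (weak_grad \<Omega> v)"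
  using assms someI_ex[of "has_weak_gradient \<Omega> v"] unfolding H1_def weak_grad_def by blast

lemma test_in_H1: "v \<in> test_functions \<Omega> \<Longrightarrow> v \<in> H1 \<Omega>"
  unfolding H1_def using test_L2 has_weak_gradient_test by blast

lemma weak_grad_test:
  assumes "v \<in> test_functions \<Omega>"
  shows "AE x in lebesgue_on \<Omega>. weak_grad \<Omega> v x = grad v x"
  using has_weak_gradient_unique[OF test_L2 weak_grad_H1 has_weak_gradient_test] test_in_H1 assms by blast

lemma test_in_H1_0:
  assumes v: "v \<in> test_functions \<Omega>"
  shows "v \<in> H1_0 \<Omega>"
proof -
  have "L2_norm \<Omega> (\<lambda>x. weak_grad \<Omega> v x - grad v x) = L2_norm \<Omega> (\<lambda>x. 0::'a)"
    unfolding L2_norm_def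
    by (intro arg_cong[where f=sqrt] integral_cong_AE) 
       (use weak_grad_test[OF v] L2_spaceD(1)[OF grad_test_L2[OF v]] weak_grad_H1[OF test_in_H1[OF v]] in \<open>auto simp: has_weak_gradient_def L2_space_def\<close>)
  then have "(\<lambda>n::nat. L2_norm \<Omega> (\<lambda>x. weak_grad \<Omega> v x - grad v x)) \<longlonglongrightarrow> 0"
    by (simp add: L2_norm_def)
  moreover have "(\<lambda>n::nat. L2_norm \<Omega> (\<lambda>x. v x - v x)) \<longlonglongrightarrow> 0"
    by (simp add: L2_norm_def)
  ultimately show ?thesis
    unfolding H1_0_def using test_in_H1[OF v] v by (intro CollectI conjI exI[of _ "\<lambda>n. v"]) auto
qed

text \<open>One integration by parts is the equation itself, tested with v; the other is the
  defining property of the weak gradient of y, applied to the test functions d_i v. The right-hand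
  side \<open>F\<close> is left open so that the state and the adjoint state are both
  covered.\<close>

lemma very_weak_form:
  assumes y: "y \<in> H1_0 \<Omega>"
    and eq: "\<And>v. v \<in> H1_0 \<Omega> \<Longrightarrow> L2_inner \<Omega> (weak_grad \<Omega> y) (weak_grad \<Omega> v) = L2_inner \<Omega> F v"
    and v: "v \<in> test_functions \<Omega>"
  shows "(LINT x|lebesgue_on \<Omega>. y x * laplace v x) = - (LINT x|lebesgue_on \<Omega>. F x * v x)"
proof -
  have yH: "y \<in> H1 \<Omega>" and yL: "y \<in> L2_space \<Omega>" using y by (auto simp: H1_0_def H1_def)
  have G: "weak_grad \<Omega> y \<in> L2_space \<Omega>" and
    Gi: "\<And>\<phi> i. \<phi> \<in> test_functions \<Omega> \<Longrightarrow> i \<in> Basis \<Longrightarrow>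
      (LINT x|lebesgue_on \<Omega>. y x * frechet_derivative \<phi> (at x) i) = - (LINT x|lebesgue_on \<Omega>. \<phi> x * (weak_grad \<Omega> y x \<bullet> i))"
    using weak_grad_H1[OF yH] unfolding has_weak_gradient_iff[OF yL] by auto
  have "(LINT x|lebesgue_on \<Omega>. F x * v x) = L2_inner \<Omega> (weak_grad \<Omega> y) (weak_grad \<Omega> v)"
    using eq[OF test_in_H1_0[OF v]] by (simp add: L2_inner_def)
  also have "\<dots> = L2_inner \<Omega> (weak_grad \<Omega> y) (grad v)"
    unfolding L2_inner_def
    by (intro integral_cong_AE)
       (use weak_grad_test[OF v] G L2_spaceD(1)[OF grad_test_L2[OF v]] weak_grad_H1[OF test_in_H1[OF v]] in \<open>auto simp: has_weak_gradient_def L2_space_def\<close>)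
  also have "\<dots> = (\<Sum>i\<in>Basis. LINT x|lebesgue_on \<Omega>. frechet_derivative v (at x) i * (weak_grad \<Omega> y x \<bullet> i))"
    by (simp add: L2_space_integrable_inner(2)[OF G grad_test_L2[OF v]] grad_inner_Basis mult.commute)
  also have "\<dots> = (\<Sum>i\<in>Basis. - (LINT x|lebesgue_on \<Omega>. y x * frechet_derivative (\<lambda>x. frechet_derivative v (at x) i) (at x) i))"
    by (intro sum.cong refl) (simp add: Gi[OF test_functions_partial[OF v]])
  also have "\<dots> = - (LINT x|lebesgue_on \<Omega>. y x * laplace v x)"
    unfolding laplace_def sum_distrib_left sum_negf
    by (subst Bochner_Integration.integral_sum)
       (auto intro!: L2_space_integrable_mult yL test_L2 test_functions_partial v)
  finally show ?thesis by simp
qed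

end

section \<open>Integrals of bump functions\<close>

lemma lipschitz_on_mult_bounded:
  fixes f g :: "'a::metric_space \<Rightarrow> real"
  assumes f: "L-lipschitz_on U f" "\<And>x. x \<in> U \<Longrightarrow> \<bar>f x\<bar> \<le> A"
    and g: "M-lipschitz_on U g" "\<And>x. x \<in> U \<Longrightarrow> \<bar>g x\<bar> \<le> B" and AB: "0 \<le> A" "0 \<le> B"
  shows "(A * M + B * L)-lipschitz_on U (\<lambda>x. f x * g x)"
proof (rule lipschitz_onI)
  show "0 \<le> A * M + B * L"
    using lipschitz_on_nonneg[OF f(1)] lipschitz_on_nonneg[OF g(1)] AB by simp
  fix x y assume xy: "x \<in> U" "y \<in> U"
  have "f x * g x - f y * g y = f x * (g x - g y) + g y * (f x - f y)" by algebra
  then have "\<bar>f x * g x - f y * g y\<bar> \<le> \<bar>f x\<bar> * \<bar>g x - g y\<bar> + \<bar>g y\<bar> * \<bar>f x - f y\<bar>"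
    by (metis abs_mult abs_triangle_ineq)
  also have "\<dots> \<le> A * (M * dist x y) + B * (L * dist x y)"
    using lipschitz_onD[OF f(1) xy] lipschitz_onD[OF g(1) xy] f(2) g(2) xy AB
    by (intro add_mono mult_mono) (auto simp: dist_real_def)
  finally show "dist (f x * g x) (f y * g y) \<le> (A * M + B * L) * dist x y"
    by (simp add: dist_real_def algebra_simps)
qed

lemma AE_not_hyperplane:
  fixes \<nu> :: "'a::euclidean_space"
  assumes "\<nu> \<noteq> 0"
  shows "AE x in lborel. \<nu> \<bullet> (x - z) \<noteq> 0"
proof -
  have "negligible {x. \<nu> \<bullet> x = \<nu> \<bullet> z}" using negligible_hyperplane assms by blast
  then have "AE x in lebesgue. x \<notin> {x. \<nu> \<bullet> x = \<nu> \<bullet> z}"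
    by (intro AE_not_in) (simp add: negligible_iff_null_sets)
  then show ?thesis by (simp add: AE_completion_iff inner_diff_right)
qed

text \<open>The product of the positive part and a partial derivative of the bump is only Lipschitz; its
  directional derivative exists off the hyperplane, which suffices for integration by parts.\<close>

lemma integral_positive_part_laplace_bump:
  fixes z \<nu> :: "'a::euclidean_space"
  assumes r: "0 < r" and \<nu>: "norm \<nu> = 1"
  defines "v \<equiv> abump z r 0 1"
  shows "(LINT x|lborel. max (\<nu> \<bullet> (x - z)) 0 * laplace v x) =
      (LINT x|lborel. max (\<nu> \<bullet> (x - z)) 0 * (2 / r\<^sup>2) * expinv 2 (bump_arg z r x))"
    and "integrable lborel (\<lambda>x. max (\<nu> \<bullet> (x - z)) 0 * laplace v x)"
    and "integrable lborel (\<lambda>x. max (\<nu> \<bullet> (x - z)) 0 * (2 / r\<^sup>2) * expinv 2 (bump_arg z r x))"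
proof -
  let ?t = "\<lambda>x. \<nu> \<bullet> (x - z)"
  let ?T = "\<lambda>x. max (?t x) 0"
  let ?P = "\<lambda>x. ?T x * (2 / r\<^sup>2) * expinv 2 (bump_arg z r x)"
  have v: "v \<in> test_functions (cball z r)"
    unfolding v_def by (rule abump_test_function[OF r order_refl])
  have tle: "\<bar>?t x\<bar> \<le> r" if "x \<in> cball z r" for x
    using Cauchy_Schwarz_ineq2[of \<nu> "x - z"] that \<nu> by (auto simp: dist_norm norm_minus_commute)
  have [measurable]: "?T \<in> borel_measurable borel"
    by (intro borel_measurable_continuous_onI continuous_intros)
  \<comment> \<open>Off the hyperplane this is the i-th partial derivative of T * d_i v. Its sum
    over i is T times the Laplacian plus, on the half space, the inner product of \<nu> with the
    gradient of v, which equals - \<open>?P\<close>; the integral of each summand vanishes.\<close>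
  let ?D = "\<lambda>i x. (if 0 < ?t x then (\<nu> \<bullet> i) * frechet_derivative v (at x) i else 0) +
      ?T x * frechet_derivative (\<lambda>x. frechet_derivative v (at x) i) (at x) i"
  have Di: "integrable lborel (?D i) \<and> (LINT x|lborel. ?D i x) = 0" if i: "i \<in> Basis" for i
  proof -
    let ?\<phi> = "\<lambda>x. frechet_derivative v (at x) i"
    have \<phi>: "?\<phi> \<in> test_functions (cball z r)" by (rule test_functions_partial[OF v i])
    obtain M where M: "M-lipschitz_on UNIV ?\<phi>" using test_functions_lipschitz[OF \<phi>] .
    obtain B where B: "0 \<le> B" "\<And>x. \<bar>?\<phi> x\<bar> \<le> B" using test_functions_bounded[OF \<phi>] by metis
    \<comment> \<open>T is unbounded, while the product rule for Lipschitz functions asks for bounds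
      on both factors. Cutting T at r is harmless since the other factor vanishes outside the
      ball.\<close>
    have w: "?T x * ?\<phi> x = min (?T x) r * ?\<phi> x" for x
    proof (cases "x \<in> cball z r")
      case True
      then have "?T x \<le> r" using tle[OF True] r by auto
      then show ?thesis by (simp add: min_absorb1)
    qed (use test_functions_outside[OF \<phi>] in simp)
    have Tl: "1-lipschitz_on UNIV (\<lambda>x. min (?T x) r)"
    proof (rule lipschitz_onI)
      fix x y
      have "\<bar>?t x - ?t y\<bar> \<le> norm (x - y)"
        using Cauchy_Schwarz_ineq2[of \<nu> "x - y"] \<nu> by (simp add: inner_diff_right)
      then show "dist (min (?T x) r) (min (?T y) r) \<le> 1 * dist x y"
        unfolding dist_real_def by (auto simp: dist_norm)
    qed simp
    have Tb: "\<bar>min (?T x) r\<bar> \<le> r" for x using r by auto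
    have L: "(r * M + B * 1)-lipschitz_on UNIV (\<lambda>x. ?T x * ?\<phi> x)"
      unfolding w by (intro lipschitz_on_mult_bounded Tl M) (use Tb B r in auto)
    obtain R where R: "cball z r \<subseteq> ball 0 R"
      using bounded_subset_ballD[OF bounded_cball] by metis
    have [measurable]: "?\<phi> \<in> borel_measurable borel" "(\<lambda>x. frechet_derivative ?\<phi> (at x) i) \<in> borel_measurable borel"
      using test_functions_measurable[OF \<phi>] test_functions_measurable[OF test_functions_partial[OF \<phi> i]] .
    have m: "?D i \<in> borel_measurable borel" by measurable
    have lim: "AE x in lborel. (\<lambda>n. (?T (x + (1 / Suc n) *\<^sub>R i) * ?\<phi> (x + (1 / Suc n) *\<^sub>R i) - ?T x * ?\<phi> x) * Suc n) \<longlonglongrightarrow> ?D i x"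
    proof -
      have "AE x in lborel. ?t x \<noteq> 0" using \<nu> by (intro AE_not_hyperplane) auto
      then show ?thesis
      proof eventually_elim
        case (elim x)
        have o: "open {x. 0 < ?t x}" "open {x. ?t x < 0}"
          by (intro open_Collect_less continuous_intros)+
        have d: "(?\<phi> has_derivative frechet_derivative ?\<phi> (at x)) (at x)"
          using test_functions_differentiable[OF \<phi>] frechet_derivative_works by blast
        show ?case
        proof (cases "0 < ?t x")
          case True
          have dt: "(?t has_derivative (\<lambda>h. \<nu> \<bullet> h)) (at x)" by (auto intro!: derivative_eq_intros)
          have "((\<lambda>x. ?t x * ?\<phi> x) has_derivative (\<lambda>h. ?t x * frechet_derivative ?\<phi> (at x) h + (\<nu> \<bullet> h) * ?\<phi> x)) (at x)"
            by (rule has_derivative_mult[OF dt d])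
          then have "((\<lambda>x. ?T x * ?\<phi> x) has_derivative (\<lambda>h. ?t x * frechet_derivative ?\<phi> (at x) h + (\<nu> \<bullet> h) * ?\<phi> x)) (at x)"
            by (rule has_derivative_transform_within_open[OF _ o(1)]) (use True in auto)
          from has_derivative_imp_quotient_tendsto[OF this, of i] show ?thesis
            using True by (simp add: add.commute max_def)
        next
          case False
          then have "?t x < 0" using elim by linarith
          have "((\<lambda>x. 0) has_derivative (\<lambda>h. 0)) (at x)" by simp
          then have "((\<lambda>x. ?T x * ?\<phi> x) has_derivative (\<lambda>h. 0)) (at x)"
            by (rule has_derivative_transform_within_open[OF _ o(2)]) (use \<open>?t x < 0\<close> in auto)
          from has_derivative_imp_quotient_tendsto[OF this, of i] show ?thesis
            using \<open>?t x < 0\<close> by (simp add: max_def)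
        qed
      qed
    qed
    have out: "?T x * ?\<phi> x = 0" if "x \<notin> ball 0 R" for x
    proof -
      have "x \<notin> cball z r" using R that by blast
      then show ?thesis using test_functions_outside[OF \<phi>] by simp
    qed
    show ?thesis
      using integral_directional_derivative_eq_0[OF L out m lim] by blast
  qed
  have E0: "expinv 2 (bump_arg z r x) = 0" if "x \<notin> cball z r" for x
  proof -
    have "r\<^sup>2 \<le> (norm (x - z))\<^sup>2"
      using that r by (intro power_mono) (auto simp: dist_norm norm_minus_commute)
    then show ?thesis using r by (simp add: bump_arg_def expinv_def)
  qed
  have sum: "(\<Sum>i\<in>Basis. ?D i x) = ?T x * laplace v x - ?P x" for x
  proof -
    have "(\<Sum>i\<in>Basis. (\<nu> \<bullet> i) * frechet_derivative v (at x) i) = (\<Sum>i\<in>Basis. (- 2 / r\<^sup>2 * expinv 2 (bump_arg z r x)) * ((\<nu> \<bullet> i) * ((x - z) \<bullet> i)))"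
      unfolding v_def abump_frechet_derivative by (intro sum.cong refl) simp
    also have "\<dots> = (- 2 / r\<^sup>2 * expinv 2 (bump_arg z r x)) * ?t x"
      by (simp only: sum_distrib_left[symmetric] euclidean_inner[symmetric])
    finally have "(\<Sum>i\<in>Basis. (\<nu> \<bullet> i) * frechet_derivative v (at x) i) = (- 2 / r\<^sup>2 * expinv 2 (bump_arg z r x)) * ?t x" .
    then show ?thesis
      by (simp add: sum.distrib laplace_def sum_distrib_left max_def)
  qed
  have [measurable]: "(\<lambda>x. expinv 2 (bump_arg z r x)) \<in> borel_measurable borel"
    using C_k_expinv_comp[OF C_k_bump_arg, of 0 2 z r] by (auto intro: borel_measurable_continuous_onI)
  show P: "integrable lborel ?P"
  proof -
    obtain R where R: "cball z r \<subseteq> ball 0 R"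
      using bounded_subset_ballD[OF bounded_cball] by metis
    have b: "\<bar>?P x\<bar> \<le> r * (2 / r\<^sup>2) * 2" for x
    proof (cases "x \<in> cball z r")
      case True
      have "\<bar>expinv 2 (bump_arg z r x)\<bar> \<le> 2"
        using expinv_le_fact[of 2 "bump_arg z r x"] expinv_nonneg[of 2 "bump_arg z r x"] by (simp add: fact_numeral)
      moreover have "\<bar>?T x\<bar> \<le> r" using tle[OF True] by auto
      ultimately show ?thesis unfolding abs_mult using r by (intro mult_mono) auto
    qed (use E0 r in auto)
    show ?thesis
    proof (rule integrable_bounded_support[OF _ b])
      show "?P x = 0" if "x \<notin> ball 0 R" for x
      proof -
        have "x \<notin> cball z r" using R that by blast
        then show ?thesis using E0 by simp
      qed
    qed measurable
  qed
  have s: "integrable lborel (\<lambda>x. \<Sum>i\<in>Basis. ?D i x)" "(LINT x|lborel. (\<Sum>i\<in>Basis. ?D i x)) = 0"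
    using Di by (auto simp: Bochner_Integration.integral_sum)
  have e: "(\<lambda>x. ?T x * laplace v x) = (\<lambda>x. (\<Sum>i\<in>Basis. ?D i x) + ?P x)"
    using sum by (simp add: fun_eq_iff)
  show "integrable lborel (\<lambda>x. ?T x * laplace v x)"
    unfolding e using s(1) P by (rule Bochner_Integration.integrable_add)
  show "(LINT x|lborel. ?T x * laplace v x) = (LINT x|lborel. ?P x)"
    unfolding e using Bochner_Integration.integral_add[OF s(1) P] s(2) by simp
qed

text \<open>The threshold 7/16 = 1 - (3/4)^2 is the value of \<open>bump_arg\<close> at distance
  3r/4 from the centre. There 1/t is at most 16/7 < 3, and dividing by t^m \<le> 1 only increases
  the value.\<close>

lemma expinv_ge_exp_minus_3:
  assumes "7 / 16 \<le> t" "t \<le> 1"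
  shows "exp (- 3) \<le> expinv m t"
proof -
  have "1 / t \<le> 3" using assms by (simp add: field_simps)
  then have "exp (- 3) \<le> exp (- (1 / t))" by simp
  also have "\<dots> \<le> exp (- (1 / t)) / t ^ m"
    using assms by (intro mult_imp_le_div_pos) (auto simp: mult_le_cancel_left1 power_le_one_iff intro!: power_le_one mult_left_le)
  finally show ?thesis using assms by (simp add: expinv_def)
qed

text \<open>A ball of radius r/4 whose centre is within r/2 of \<open>z\<close> stays within 3r/4 of
  \<open>z\<close>.\<close>

lemma bump_arg_ge:
  assumes r: "0 < r" and w: "norm (w - z) \<le> r / 2" and x: "x \<in> ball w (r / 4)"
  shows "7 / 16 \<le> bump_arg z r x" "bump_arg z r x \<le> 1"
proof -
  have "norm (x - z) \<le> norm (x - w) + norm (w - z)"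
    using norm_triangle_ineq[of "x - w" "w - z"] by simp
  then have "norm (x - z) \<le> 3 / 4 * r"
    using w x by (auto simp: dist_norm norm_minus_commute)
  then have "(norm (x - z))\<^sup>2 \<le> (3 / 4 * r)\<^sup>2" by (rule power_mono) simp
  then show "7 / 16 \<le> bump_arg z r x"
    using r by (simp add: bump_arg_def power_mult_distrib field_simps power2_eq_square)
  show "bump_arg z r x \<le> 1" by (simp add: bump_arg_def)
qed

lemma measure_ball: "0 \<le> r \<Longrightarrow> measure lborel (ball (z::'a::euclidean_space) r) = unit_ball_vol DIM('a) * r ^ DIM('a)"
  using content_ball[of r z] by simp

lemma integral_ge_on_ball:
  fixes f :: "'a::euclidean_space \<Rightarrow> real"
  assumes "integrable lborel f" "\<And>x. 0 \<le> f x" "\<And>x. x \<in> ball w s \<Longrightarrow> C \<le> f x" "0 \<le> s"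
  shows "C * (unit_ball_vol DIM('a) * s ^ DIM('a)) \<le> (LINT x|lborel. f x)"
proof -
  have "(LINT x|lborel. C * indicator (ball w s) x) \<le> (LINT x|lborel. f x)"
  proof (rule integral_mono)
    show "integrable lborel (\<lambda>x. C * indicator (ball w s) x)"
      by (intro integrable_mult_right integrable_real_indicator) (use emeasure_bounded_finite[OF bounded_ball] in auto)
    show "C * indicator (ball w s) x \<le> f x" for x
      using assms(2,3) by (auto split: split_indicator)
  qed (rule assms)
  then show ?thesis using assms(4) by (simp add: measure_ball)
qed

text \<open>Integration by parts has replaced the Laplacian, which changes sign, by a nonnegative
  integrand, so a small ball suffices. On the ball of radius r/4 around z + (r/2) \<nu> the positive
  part is at least r/4, and (r/4) (2/r^2) exp (-3) = exp (-3) / (2r).\<close>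

lemma integral_positive_part_laplace_bump_ge:
  fixes z \<nu> :: "'a::euclidean_space"
  assumes r: "0 < r" and \<nu>: "norm \<nu> = 1"
  shows "exp (- 3) / (2 * r) * (unit_ball_vol DIM('a) * (r / 4) ^ DIM('a)) \<le>
    (LINT x|lborel. max (\<nu> \<bullet> (x - z)) 0 * laplace (abump z r 0 1) x)"
  unfolding integral_positive_part_laplace_bump(1)[OF r \<nu>]
proof (rule integral_ge_on_ball[where w="z + (r / 2) *\<^sub>R \<nu>"])
  show "integrable lborel (\<lambda>x. max (\<nu> \<bullet> (x - z)) 0 * (2 / r\<^sup>2) * expinv 2 (bump_arg z r x))"
    by (rule integral_positive_part_laplace_bump(3)[OF r \<nu>])
  show "0 \<le> max (\<nu> \<bullet> (x - z)) 0 * (2 / r\<^sup>2) * expinv 2 (bump_arg z r x)" for x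
    by (simp add: expinv_nonneg)
  fix x assume x: "x \<in> ball (z + (r / 2) *\<^sub>R \<nu>) (r / 4)"
  have "x - z = (r / 2) *\<^sub>R \<nu> + (x - (z + (r / 2) *\<^sub>R \<nu>))" by simp
  then have "\<nu> \<bullet> (x - z) = r / 2 * (\<nu> \<bullet> \<nu>) + \<nu> \<bullet> (x - (z + (r / 2) *\<^sub>R \<nu>))"
    by (metis inner_add_right inner_scaleR_right)
  also have "\<nu> \<bullet> \<nu> = 1" using \<nu> by (simp add: norm_eq_1)
  finally have "\<nu> \<bullet> (x - z) = r / 2 + \<nu> \<bullet> (x - (z + (r / 2) *\<^sub>R \<nu>))" by simp
  moreover have "\<bar>\<nu> \<bullet> (x - (z + (r / 2) *\<^sub>R \<nu>))\<bar> \<le> r / 4"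
    using Cauchy_Schwarz_ineq2[of \<nu> "x - (z + (r / 2) *\<^sub>R \<nu>)"] x \<nu> by (simp add: dist_norm norm_minus_commute)
  ultimately have t: "r / 4 \<le> max (\<nu> \<bullet> (x - z)) 0" by linarith
  have "r / 4 * (2 / r\<^sup>2) * exp (- 3) \<le> max (\<nu> \<bullet> (x - z)) 0 * (2 / r\<^sup>2) * expinv 2 (bump_arg z r x)"
    by (intro mult_mono t expinv_ge_exp_minus_3 bump_arg_ge[OF r _ x]) (use r \<nu> in auto)
  then show "exp (- 3) / (2 * r) \<le> max (\<nu> \<bullet> (x - z)) 0 * (2 / r\<^sup>2) * expinv 2 (bump_arg z r x)"
    using r by (simp add: field_simps power2_eq_square)
qed (use r in simp)

text \<open>The small ball is shifted by r/2 from \<open>z\<close> along the gradient, in the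
  direction in which the linear part has the sign of \<open>c\<close>, so that the two cannot
  cancel. There the affine factor is at least (|g| r + |c|) / 4 in modulus; squaring gives the
  1/16.\<close>

lemma integral_affine_sq_bump_ge:
  fixes z g :: "'a::euclidean_space"
  assumes r: "0 < r"
  shows "exp (- 3) / 16 * (norm g * r + \<bar>c\<bar>)\<^sup>2 * (unit_ball_vol DIM('a) * (r / 4) ^ DIM('a)) \<le>
    (LINT x|lborel. (g \<bullet> (x - z) + c) * abump z r g c x)"
proof -
  obtain e :: 'a where e: "norm e = 1" "g \<bullet> e = norm g"
  proof (cases "g = 0")
    case True
    obtain e :: 'a where "e \<in> Basis" using nonempty_Basis by blast
    then show ?thesis using that[of e] True by simp
  next
    case False
    have "g \<bullet> g = norm g * norm g" by (simp add: power2_norm_eq_inner[symmetric] power2_eq_square)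
    then show ?thesis using that[of "g /\<^sub>R norm g"] False by simp
  qed
  define s :: real where "s = (if c < 0 then -1 else 1)"
  define w where "w = z + (s * r / 2) *\<^sub>R e"
  have sc: "s * c = \<bar>c\<bar>" "\<bar>s\<bar> = 1" "s * s = 1" by (auto simp: s_def)
  have nw: "norm (w - z) \<le> r / 2" using r e sc by (simp add: w_def abs_mult)
  let ?M = "norm g * r + \<bar>c\<bar>"
  have v: "abump z r g c \<in> test_functions (cball z r)"
    by (rule abump_test_function[OF r order_refl])
  have "C_k k (\<lambda>x. g \<bullet> (x - z) + c)" for k
    using C_k_affine[of k g "c - g \<bullet> z"] by (simp add: inner_diff_right algebra_simps)
  then have i: "integrable lborel (\<lambda>x. (g \<bullet> (x - z) + c) * abump z r g c x)"
    by (intro test_functions_integrable[of _ "cball z r"] test_functions_mult v)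
  show ?thesis
  proof (rule integral_ge_on_ball[where w=w, OF i])
    show "0 \<le> (g \<bullet> (x - z) + c) * abump z r g c x" for x
      by (simp add: abump_def bump_bounds flip: mult.assoc)
    fix x assume x: "x \<in> ball w (r / 4)"
    have "g \<bullet> (x - z) + c = g \<bullet> (x - w) + s * (r / 2 * norm g) + c"
      by (simp add: w_def inner_diff_right inner_add_right e algebra_simps)
    then have "s * (g \<bullet> (x - z) + c) = s * (g \<bullet> (x - w)) + (s * s) * (r / 2 * norm g) + s * c"
      by (simp add: algebra_simps)
    then have q: "s * (g \<bullet> (x - z) + c) = s * (g \<bullet> (x - w)) + r / 2 * norm g + \<bar>c\<bar>"
      using sc by simp
    have "\<bar>s * (g \<bullet> (x - w))\<bar> \<le> norm g * norm (x - w)"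
      using Cauchy_Schwarz_ineq2[of g "x - w"] sc by (simp add: abs_mult)
    also have "\<dots> \<le> norm g * (r / 4)"
      using x by (intro mult_left_mono) (auto simp: dist_norm norm_minus_commute)
    finally have "?M / 4 \<le> s * (g \<bullet> (x - z) + c)"
      unfolding q using r by (simp add: abs_le_iff) (smt (verit) mult.commute)
    then have "(?M / 4)\<^sup>2 \<le> (s * (g \<bullet> (x - z) + c))\<^sup>2"
      using r by (intro power_mono) auto
    then have a: "?M\<^sup>2 / 16 \<le> (g \<bullet> (x - z) + c)\<^sup>2"
      using sc by (simp add: power_mult_distrib power_divide power2_eq_square[of s])
    have "exp (- 3) \<le> bump z r x"
      unfolding bump_def by (intro expinv_ge_exp_minus_3 bump_arg_ge[OF r nw x])
    with a have "?M\<^sup>2 / 16 * exp (- 3) \<le> (g \<bullet> (x - z) + c)\<^sup>2 * bump z r x"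
      by (intro mult_mono) auto
    then show "exp (- 3) / 16 * ?M\<^sup>2 \<le> (g \<bullet> (x - z) + c) * abump z r g c x"
      by (simp add: abump_def power2_eq_square mult_ac)
  qed (use r in simp)
qed

section \<open>Geometry of the domain and of the meshes\<close>

text \<open>From a boundary point, moving in the direction - \<open>e\<close> leads strictly below
  the Lipschitz graph, to points with a neighbourhood disjoint from \<Omega>; hence no boundary
  point is interior to the closure. This later places balls covered by elements inside the
  domain.\<close>

lemma lipschitz_boundary_interior_closure:
  fixes \<Omega> :: "'a::euclidean_space set"
  assumes \<Omega>: "open \<Omega>" and L: "lipschitz_boundary \<Omega>"
  shows "interior (closure \<Omega>) = \<Omega>"
proof (rule antisym)
  show "\<Omega> \<subseteq> interior (closure \<Omega>)"
    using \<Omega> by (simp add: closure_subset interior_maximal)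
  show "interior (closure \<Omega>) \<subseteq> \<Omega>"
  proof (rule ccontr)
    assume "\<not> interior (closure \<Omega>) \<subseteq> \<Omega>"
    then obtain x0 where x0: "x0 \<in> interior (closure \<Omega>)" "x0 \<notin> \<Omega>" by blast
    then have "x0 \<in> frontier \<Omega>"
      using \<Omega> interior_subset by (auto simp: frontier_def interior_open)
    then obtain e r K \<phi> where e: "norm e = 1" and r: "0 < r" and \<phi>: "K-lipschitz_on {z. z \<bullet> e = 0} \<phi>"
      and eq: "\<Omega> \<inter> ball x0 r = {x \<in> ball x0 r. \<phi> (x - (x \<bullet> e) *\<^sub>R e) < x \<bullet> e}"
      using L unfolding lipschitz_boundary_def by blast
    let ?P = "\<lambda>x. x - (x \<bullet> e) *\<^sub>R e"
    have ee: "e \<bullet> e = 1" using e by (simp add: norm_eq_1)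
    obtain s where s: "0 < s" "ball x0 s \<subseteq> interior (closure \<Omega>)"
      using x0 open_interior open_contains_ball by blast
    define t where "t = min r s / 2"
    have t: "0 < t" "t < r" "t < s" using r s by (auto simp: t_def)
    define x1 where "x1 = x0 - t *\<^sub>R e"
    have x1: "x1 \<in> ball x0 r" "x1 \<in> ball x0 s" using t e by (auto simp: x1_def dist_norm)
    have "?P x1 = ?P x0" by (simp add: x1_def inner_diff_left ee algebra_simps)
    moreover have "x0 \<bullet> e \<le> \<phi> (?P x0)" using eq x0 r by force
    moreover have "x1 \<bullet> e = x0 \<bullet> e - t" by (simp add: x1_def inner_diff_left ee)
    ultimately have lt: "x1 \<bullet> e < \<phi> (?P x1)" using t by simp
    have c: "continuous_on UNIV (\<lambda>x. \<phi> (?P x))"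
      by (rule continuous_on_compose2[OF lipschitz_on_continuous_on[OF \<phi>]])
         (auto intro!: continuous_intros simp: inner_diff_left ee)
    let ?V = "ball x0 r \<inter> {x. x \<bullet> e < \<phi> (?P x)}"
    have "open ?V" by (intro open_Int open_Collect_less continuous_intros c open_ball)
    moreover have "?V \<inter> \<Omega> = {}" using eq by force
    ultimately have "?V \<inter> closure \<Omega> = {}" by (simp add: open_Int_closure_eq_empty)
    moreover have "x1 \<in> ?V" using x1 lt by blast
    moreover have "x1 \<in> closure \<Omega>" using x1 s interior_subset by blast
    ultimately show False by blast
  qed
qed

section \<open>Closed elements and the null boundary of the domain\<close>

lemma simplex_compact_convex:
  assumes "n simplex K" shows "compact K" "convex K"
  using assms convex_convex_hull finite_imp_compact_convex_hull[OF aff_independent_finite] by (auto simp: simplex_def)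

lemma
  fixes \<Omega> :: "'a::euclidean_space set"
  assumes \<T>: "conforming_mesh \<Omega> \<T>"
  shows mesh_finite: "finite \<T>"
    and mesh_simplex: "\<And>K. K \<in> \<T> \<Longrightarrow> int DIM('a) simplex K"
    and mesh_subset: "\<And>K. K \<in> \<T> \<Longrightarrow> K \<subseteq> closure \<Omega>"
    and mesh_compact: "\<And>K. K \<in> \<T> \<Longrightarrow> compact K"
    and mesh_convex: "\<And>K. K \<in> \<T> \<Longrightarrow> convex K"
proof -
  show "finite \<T>" and s: "\<And>K. K \<in> \<T> \<Longrightarrow> int DIM('a) simplex K"
    and "\<And>K. K \<in> \<T> \<Longrightarrow> K \<subseteq> closure \<Omega>"
    using \<T> by (auto simp: conforming_mesh_def triangulation_def)
  show "\<And>K. K \<in> \<T> \<Longrightarrow> compact K" "\<And>K. K \<in> \<T> \<Longrightarrow> convex K"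
    using s simplex_compact_convex by blast+
qed

text \<open>A boundary point lies in some element but not in its interior, which is an open part of
  the closure and hence of \<Omega>. So the boundary is covered by finitely many frontiers of convex
  sets, all of them null.\<close>

lemma negligible_closure_diff:
  fixes \<Omega> :: "'a::euclidean_space set"
  assumes i\<Omega>: "interior (closure \<Omega>) = \<Omega>" and \<T>: "conforming_mesh \<Omega> \<T>"
  shows "negligible (closure \<Omega> - \<Omega>)"
proof (rule negligible_subset)
  show "negligible (\<Union>(frontier ` \<T>))"
    using mesh_finite[OF \<T>] mesh_convex[OF \<T>] by (intro negligible_Union) (auto intro: negligible_convex_frontier)
  show "closure \<Omega> - \<Omega> \<subseteq> \<Union>(frontier ` \<T>)"
  proof
    fix x assume x: "x \<in> closure \<Omega> - \<Omega>"
    then obtain K where K: "K \<in> \<T>" "x \<in> K" using \<T> by (auto simp: conforming_mesh_def)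
    have "interior K \<subseteq> \<Omega>" using interior_mono[OF mesh_subset[OF \<T> K(1)]] i\<Omega> by simp
    then have "x \<in> frontier K"
      using x K closure_subset by (auto simp: frontier_def)
    then show "x \<in> \<Union>(frontier ` \<T>)" using K by blast
  qed
qed

text \<open>Data are given on the open domain, while elements are closed and may contain boundary
  points. Preimages inside the null set \<open>S - \<Omega>\<close> are arbitrary, but measurable
  because Lebesgue measure is complete.\<close>

lemma borel_measurable_lebesgue_on_subset_AE:
  fixes f :: "'a::euclidean_space \<Rightarrow> real"
  assumes f: "f \<in> borel_measurable (lebesgue_on \<Omega>)" and \<Omega>: "\<Omega> \<in> sets lebesgue"
    and S: "S \<in> sets lebesgue" and N: "negligible (S - \<Omega>)"
  shows "f \<in> borel_measurable (lebesgue_on S)"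
proof -
  have "f \<in> borel_measurable (lebesgue_on (S \<inter> \<Omega>))"
    using measurable_restrict_mono[OF f] by auto
  then have 1: "(\<lambda>x. if x \<in> S \<inter> \<Omega> then f x else 0) \<in> borel_measurable lebesgue"
    using borel_measurable_if[of "S \<inter> \<Omega>" f] \<Omega> S by simp
  have "(\<lambda>x. if x \<in> S then f x else 0) \<in> borel_measurable lebesgue"
  proof (rule measurableI)
    fix A :: "real set" assume A: "A \<in> sets borel"
    let ?f = "\<lambda>x. if x \<in> S then f x else 0" and ?g = "\<lambda>x. if x \<in> S \<inter> \<Omega> then f x else 0"
    have "?f -` A \<inter> space lebesgue = ((?g -` A \<inter> space lebesgue) - (S - \<Omega>)) \<union> (?f -` A \<inter> (S - \<Omega>))"
      by auto
    moreover have "?g -` A \<inter> space lebesgue \<in> sets lebesgue"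
      using measurable_sets[OF 1 A] .
    moreover have "?f -` A \<inter> (S - \<Omega>) \<in> sets lebesgue"
      by (rule negligible_imp_sets, rule negligible_subset[OF N]) auto
    ultimately show "?f -` A \<inter> space lebesgue \<in> sets lebesgue"
      using S \<Omega> by (simp only: sets.Diff sets.Un)
  qed simp
  then show ?thesis using borel_measurable_if[OF S, of f] by simp
qed

lemma L2_space_subset_AE:
  fixes f :: "'a::euclidean_space \<Rightarrow> real"
  assumes f: "f \<in> L2_space \<Omega>" and \<Omega>: "\<Omega> \<in> sets lebesgue"
    and S: "S \<in> sets lebesgue" and N: "negligible (S - \<Omega>)"
  shows "f \<in> L2_space S" "L2_norm S f \<le> L2_norm \<Omega> f"
proof -
  have m: "f \<in> borel_measurable (lebesgue_on S)"
    using borel_measurable_lebesgue_on_subset_AE[OF L2_spaceD(1)[OF f] \<Omega> S N] .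
  have i\<Omega>: "integrable lebesgue (\<lambda>x. indicator \<Omega> x *\<^sub>R (norm (f x))\<^sup>2)"
    using L2_spaceD(2)[OF f] \<Omega> by (simp add: integrable_restrict_space)
  have mS: "(\<lambda>x. indicator S x *\<^sub>R (norm (f x))\<^sup>2) \<in> borel_measurable lebesgue"
  proof -
    have "(\<lambda>x. (norm (f x))\<^sup>2) \<in> borel_measurable (lebesgue_on S)" using m by measurable
    then have "(\<lambda>x. if x \<in> S then (norm (f x))\<^sup>2 else 0) \<in> borel_measurable lebesgue"
      using borel_measurable_if[OF S, of "\<lambda>x. (norm (f x))\<^sup>2"] by simp
    then show ?thesis by (rule measurable_cong[THEN iffD1, rotated]) (auto split: split_indicator)
  qed
  have "AE x in lebesgue. x \<notin> S - \<Omega>"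
    using N by (intro AE_not_in) (simp add: negligible_iff_null_sets)
  then have le: "AE x in lebesgue. indicator S x *\<^sub>R (norm (f x))\<^sup>2 \<le> indicator \<Omega> x *\<^sub>R (norm (f x))\<^sup>2"
    by eventually_elim (auto split: split_indicator)
  have iS: "integrable lebesgue (\<lambda>x. indicator S x *\<^sub>R (norm (f x))\<^sup>2)"
    by (rule Bochner_Integration.integrable_bound[OF i\<Omega> mS]) (use le in \<open>auto\<close>)
  then show "f \<in> L2_space S"
    using m S by (simp add: L2_space_def integrable_restrict_space)
  show "L2_norm S f \<le> L2_norm \<Omega> f"
    unfolding L2_norm_def using S \<Omega> integral_mono_AE[OF iS i\<Omega> le]
    by (simp add: integral_restrict_space)
qed

lemma L2_norm_Un_le:
  fixes f :: "'a::euclidean_space \<Rightarrow> real"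
  assumes S: "S \<in> sets lebesgue" "f \<in> L2_space S" and T: "T \<in> sets lebesgue" "f \<in> L2_space T"
    and A: "A \<in> sets lebesgue" "A \<subseteq> S \<union> T" "f \<in> L2_space A"
  shows "L2_norm A f \<le> L2_norm S f + L2_norm T f"
proof (rule power2_le_imp_le)
  let ?i = "\<lambda>S x. indicator S x *\<^sub>R (norm (f x))\<^sup>2"
  have i: "integrable lebesgue (?i S)" "integrable lebesgue (?i T)" "integrable lebesgue (?i A)"
    using assms by (auto dest!: L2_spaceD(2) simp: integrable_restrict_space)
  have "(\<integral>x. ?i A x \<partial>lebesgue) \<le> (\<integral>x. ?i S x + ?i T x \<partial>lebesgue)"
    by (rule integral_mono) (use i A(2) in \<open>auto split: split_indicator\<close>)
  also have "\<dots> = (\<integral>x. ?i S x \<partial>lebesgue) + (\<integral>x. ?i T x \<partial>lebesgue)"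
    using i by simp
  finally have "(L2_norm A f)\<^sup>2 \<le> (L2_norm S f)\<^sup>2 + (L2_norm T f)\<^sup>2"
    using S T A by (simp add: L2_norm_power2 integral_restrict_space)
  also have "\<dots> \<le> (L2_norm S f + L2_norm T f)\<^sup>2"
    by (simp add: power2_sum L2_norm_nonneg)
  finally show "(L2_norm A f)\<^sup>2 \<le> (L2_norm S f + L2_norm T f)\<^sup>2" .
qed (simp add: L2_norm_nonneg)

lemma continuous_on_compact_L2:
  fixes f :: "'a::euclidean_space \<Rightarrow> real"
  assumes S: "compact S" and f: "continuous_on S f"
  shows "f \<in> L2_space S"
proof -
  have Sl: "S \<in> sets lebesgue" using S by (simp add: borel_compact)
  have m: "f \<in> borel_measurable (lebesgue_on S)"
    using continuous_imp_measurable_on_sets_lebesgue[OF f Sl] .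
  obtain B where B: "\<And>x. x \<in> S \<Longrightarrow> \<bar>f x\<bar> \<le> B"
    using compact_imp_bounded[OF compact_continuous_image[OF f S]] unfolding bounded_real by blast
  show ?thesis
  proof (rule L2_norm_bounded_le(1)[OF m lmeasurable_compact[OF S]])
    show "AE x in lebesgue_on S. \<bar>f x\<bar> \<le> \<bar>B\<bar>"
      by (rule AE_I2) (use B in \<open>force\<close>)
  qed simp
qed

lemma integral_lebesgue_on_subset:
  fixes f :: "'a::euclidean_space \<Rightarrow> real"
  assumes "A \<in> sets lebesgue" "S \<in> sets lebesgue" "A \<subseteq> S" "\<And>x. x \<in> S - A \<Longrightarrow> f x = 0"
  shows "(LINT x|lebesgue_on S. f x) = (LINT x|lebesgue_on A. f x)"
proof -
  have "(\<lambda>x. indicator S x *\<^sub>R f x) = (\<lambda>x. indicator A x *\<^sub>R f x)"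
    using assms(3,4) by (auto simp: fun_eq_iff indicator_def)
  then show ?thesis using assms(1,2) by (simp add: integral_restrict_space)
qed

text \<open>\<open>K\<close> is the cone with apex \<open>v\<close> over its facet \<open>\<gamma>\<close>, whose outer unit normal is \<open>\<nu>\<close>.\<close>

definition cone_facet :: "'a::euclidean_space set \<Rightarrow> 'a set \<Rightarrow> 'a \<Rightarrow> real \<Rightarrow> 'a \<Rightarrow> bool" where
  "cone_facet K \<gamma> \<nu> c v \<longleftrightarrow> norm \<nu> = 1 \<and> convex \<gamma> \<and> \<gamma> \<noteq> {} \<and> \<gamma> = K \<inter> {x. \<nu> \<bullet> x = c} \<and>
     K \<subseteq> {x. \<nu> \<bullet> x \<le> c} \<and> K = convex hull (insert v \<gamma>) \<and> \<nu> \<bullet> v < c"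

section \<open>Facets of simplices as bases of cones\<close>

text \<open>Faces of a simplex are hulls of subsets of its affinely independent vertices. A drop of
  the dimension by one means that exactly one vertex is omitted; it becomes the apex of the
  cone.\<close>

lemma simplex_facet_cases:
  assumes K: "int DIM('a) simplex (K :: 'a::euclidean_space set)"
  obtains C where "finite C" "card C = DIM('a) + 1" "\<not> affine_dependent C" "K = convex hull C"
    "\<And>\<gamma>. \<gamma> facet_of K \<Longrightarrow> \<exists>v\<in>C. \<gamma> = convex hull (C - {v})"
proof -
  obtain C where C: "\<not> affine_dependent C" "int (card C) = int DIM('a) + 1" "K = convex hull C"
    using K by (auto simp: simplex_def)
  have f: "finite C" using C aff_independent_finite by blast
  have "\<exists>v\<in>C. \<gamma> = convex hull (C - {v})" if \<gamma>: "\<gamma> facet_of K" for \<gamma>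
  proof -
    have fo: "\<gamma> face_of convex hull C" and ad: "aff_dim \<gamma> = aff_dim (convex hull C) - 1"
      using \<gamma> C by (auto simp: facet_of_def)
    obtain D where D: "D \<subseteq> C" "\<gamma> = convex hull D"
      using fo face_of_convex_hull_affine_independent[OF C(1)] by blast
    have "\<not> affine_dependent D" using C(1) D(1) affine_independent_subset by blast
    then have "int (card D) = int (card C) - 1"
      using ad C(1) D(2) by (simp add: aff_dim_convex_hull aff_dim_affine_independent)
    then have "card (C - D) = 1"
      using card_Diff_subset[OF finite_subset[OF D(1) f] D(1)] C(2) by linarith
    then obtain v where "C - D = {v}" using card_1_singletonE by blast
    then have "v \<in> C" "D = C - {v}" using D(1) by blast+
    then show ?thesis using D(2) by blast
  qed
  then show ?thesis using that[OF f _ C(1) C(3)] C(2) by simp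
qed

text \<open>Bounds the number of sides over which the jumps of one element are summed.\<close>

lemma card_facets_simplex:
  assumes K: "int DIM('a) simplex (K :: 'a::euclidean_space set)"
  shows "finite {\<gamma>. \<gamma> facet_of K}" "card {\<gamma>. \<gamma> facet_of K} \<le> DIM('a) + 1"
proof -
  obtain C where C: "finite C" "card C = DIM('a) + 1" "\<And>\<gamma>. \<gamma> facet_of K \<Longrightarrow> \<exists>v\<in>C. \<gamma> = convex hull (C - {v})"
    using simplex_facet_cases[OF K] by metis
  have sub: "{\<gamma>. \<gamma> facet_of K} \<subseteq> (\<lambda>v. convex hull (C - {v})) ` C" using C(3) by blast
  then show "finite {\<gamma>. \<gamma> facet_of K}" using C(1) finite_surj by blast
  show "card {\<gamma>. \<gamma> facet_of K} \<le> DIM('a) + 1"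
    using card_mono[OF finite_imageI[OF C(1)] sub] card_image_le[OF C(1)] C(2) by (metis le_trans)
qed

lemma simplex_facet_cone:
  assumes K: "int DIM('a) simplex (K :: 'a::euclidean_space set)" and \<gamma>: "\<gamma> facet_of K"
  obtains \<nu> c v where "cone_facet K \<gamma> \<nu> c v"
proof -
  obtain C where C: "finite C" "\<not> affine_dependent C" "K = convex hull C"
     "\<exists>v\<in>C. \<gamma> = convex hull (C - {v})"
    using simplex_facet_cases[OF K] \<gamma> by metis
  then obtain v where v: "v \<in> C" "\<gamma> = convex hull (C - {v})" by blast
  have Kv: "K = convex hull (insert v \<gamma>)"
    unfolding v(2) hull_insert[of convex v "C - {v}", symmetric] C(3) using v(1) by (simp add: insert_absorb)
  have "polyhedron K"
    unfolding C(3) using C(1) by (rule polyhedron_convex_hull)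
  then obtain a b where ab: "a \<noteq> 0" "K \<subseteq> {x. a \<bullet> x \<le> b}" "\<gamma> = K \<inter> {x. a \<bullet> x = b}"
    using facet_of_polyhedron[OF _ \<gamma>] by metis
  define \<nu> where "\<nu> = a /\<^sub>R norm a"
  define c where "c = b / norm a"
  have n: "norm \<nu> = 1" using ab by (simp add: \<nu>_def)
  have e: "\<nu> \<bullet> x = c \<longleftrightarrow> a \<bullet> x = b" "\<nu> \<bullet> x \<le> c \<longleftrightarrow> a \<bullet> x \<le> b" for x
  proof -
    have "\<nu> \<bullet> x = (a \<bullet> x) / norm a" by (simp add: \<nu>_def divide_inverse mult.commute)
    then show "\<nu> \<bullet> x = c \<longleftrightarrow> a \<bullet> x = b" "\<nu> \<bullet> x \<le> c \<longleftrightarrow> a \<bullet> x \<le> b"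
      using ab(1) by (simp_all add: c_def divide_right_mono divide_le_cancel)
  qed
  have \<gamma>eq: "\<gamma> = K \<inter> {x. \<nu> \<bullet> x = c}" and Kle: "K \<subseteq> {x. \<nu> \<bullet> x \<le> c}" using ab e by auto
  have vK: "v \<in> K" using C(3) v(1) by (simp add: hull_inc)
  have "\<nu> \<bullet> v \<noteq> c"
  proof
    assume "\<nu> \<bullet> v = c"
    then have "insert v \<gamma> \<subseteq> {x. \<nu> \<bullet> x = c}" using \<gamma>eq by auto
    then have "K \<subseteq> {x. \<nu> \<bullet> x = c}"
      unfolding Kv using convex_hyperplane hull_minimal by blast
    then have "\<gamma> = K" using \<gamma>eq by blast
    then show False using \<gamma> by (simp add: facet_of_def)
  qed
  then have "\<nu> \<bullet> v < c" using Kle vK by force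
  moreover have "convex \<gamma>" using v(2) by simp
  moreover have "\<gamma> \<noteq> {}" using \<gamma> by (auto simp: facet_of_def)
  ultimately have "cone_facet K \<gamma> \<nu> c v"
    unfolding cone_facet_def using n \<gamma>eq Kle Kv by blast
  then show ?thesis using that by blast
qed

lemma cone_facet_D:
  assumes "cone_facet K \<gamma> \<nu> c v"
  shows "norm \<nu> = 1" "convex \<gamma>" "\<gamma> \<noteq> {}" "\<gamma> \<subseteq> K" "v \<in> K" "\<And>x. x \<in> \<gamma> \<Longrightarrow> \<nu> \<bullet> x = c"
    "\<And>x. x \<in> K \<Longrightarrow> \<nu> \<bullet> x \<le> c" "\<nu> \<bullet> v < c" "\<nu> \<bullet> \<nu> = 1"
    "\<And>g \<theta>. g \<in> \<gamma> \<Longrightarrow> 0 \<le> \<theta> \<Longrightarrow> \<theta> \<le> 1 \<Longrightarrow> (1 - \<theta>) *\<^sub>R g + \<theta> *\<^sub>R v \<in> K"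
    "\<And>x. x \<in> K \<Longrightarrow> \<exists>g\<in>\<gamma>. \<exists>\<theta>\<ge>0. \<theta> \<le> 1 \<and> x = (1 - \<theta>) *\<^sub>R g + \<theta> *\<^sub>R v"
proof -
  have d: "norm \<nu> = 1" "convex \<gamma>" "\<gamma> \<noteq> {}" "\<nu> \<bullet> v < c" "\<gamma> = K \<inter> {x. \<nu> \<bullet> x = c}"
    "K \<subseteq> {x. \<nu> \<bullet> x \<le> c}" "K = convex hull (insert v \<gamma>)"
    using assms unfolding cone_facet_def by blast+
  show "norm \<nu> = 1" "convex \<gamma>" "\<gamma> \<noteq> {}" "\<nu> \<bullet> v < c" by (fact d)+
  show "\<nu> \<bullet> \<nu> = 1" using d(1) by (simp add: norm_eq_1)
  show "\<gamma> \<subseteq> K" using d(5) by blast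
  show "v \<in> K" using d(7) hull_inc[of v "insert v \<gamma>"] by blast
  show "\<nu> \<bullet> x = c" if "x \<in> \<gamma>" for x using d(5) that by blast
  show "\<nu> \<bullet> x \<le> c" if "x \<in> K" for x using d(6) that by blast
  have cK: "convex K" using d(7) convex_convex_hull by metis
  show "(1 - \<theta>) *\<^sub>R g + \<theta> *\<^sub>R v \<in> K" if "g \<in> \<gamma>" "0 \<le> \<theta>" "\<theta> \<le> 1" for g \<theta>
    using convexD_alt[OF cK] \<open>\<gamma> \<subseteq> K\<close> \<open>v \<in> K\<close> that by blast
  show "\<exists>g\<in>\<gamma>. \<exists>\<theta>\<ge>0. \<theta> \<le> 1 \<and> x = (1 - \<theta>) *\<^sub>R g + \<theta> *\<^sub>R v" if "x \<in> K" for x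
  proof -
    have "x \<in> convex hull (insert v \<gamma>)" using that d(7) by blast
    then obtain u w b where "0 \<le> u" "0 \<le> w" "u + w = 1" "b \<in> convex hull \<gamma>" "x = u *\<^sub>R v + w *\<^sub>R b"
      unfolding convex_hull_insert[OF \<open>\<gamma> \<noteq> {}\<close>] by blast
    moreover from this have "w = 1 - u" "b \<in> \<gamma>" using \<open>convex \<gamma>\<close> by (auto simp: hull_same)
    ultimately show ?thesis by (intro bexI[of _ b] exI[of _ u]) (auto simp: add.commute)
  qed
qed

text \<open>The central projection from the apex onto the facet maps a disc of the inscribed ball
  parallel to the facet to a disc that is at least as large.\<close>

lemma cone_facet_disc:
  assumes cf: "cone_facet K \<gamma> \<nu> c v" and \<rho>: "0 < \<rho>" "cball x0 \<rho> \<subseteq> K"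
  shows "\<exists>z\<in>\<gamma>. \<forall>x. \<nu> \<bullet> x = c \<and> dist x z \<le> \<rho> \<longrightarrow> x \<in> \<gamma>" "2 * \<rho> \<le> c - \<nu> \<bullet> v"
proof -
  note D = cone_facet_D[OF cf]
  let ?\<eta> = "c - \<nu> \<bullet> v"
  have height: "\<nu> \<bullet> ((1 - \<theta>) *\<^sub>R g + \<theta> *\<^sub>R v) = c - \<theta> * ?\<eta>" if "g \<in> \<gamma>" for g \<theta>
    using D(6)[OF that] by (simp add: inner_add_right algebra_simps)
  have up: "x0 + \<rho> *\<^sub>R \<nu> \<in> K" "x0 - \<rho> *\<^sub>R \<nu> \<in> K" "x0 \<in> K"
    using \<rho> D(1) by (auto intro!: subsetD[OF \<rho>(2)] simp: dist_norm)
  \<comment> \<open>The two points of the ball in the directions plus and minus \<nu> keep the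
    distance of its centre from the facet plane between \<rho> and the distance of the apex minus
    \<rho>.\<close>
  have h0: "\<rho> \<le> c - \<nu> \<bullet> x0"
    using D(7)[OF up(1)] D(9) by (simp add: inner_add_right)
  have h1: "c - \<nu> \<bullet> x0 + \<rho> \<le> ?\<eta>"
  proof -
    obtain g \<theta> where g: "g \<in> \<gamma>" "0 \<le> \<theta>" "\<theta> \<le> 1" "x0 - \<rho> *\<^sub>R \<nu> = (1 - \<theta>) *\<^sub>R g + \<theta> *\<^sub>R v"
      using D(11)[OF up(2)] by blast
    have "c - \<nu> \<bullet> (x0 - \<rho> *\<^sub>R \<nu>) = \<theta> * ?\<eta>" unfolding g(4) height[OF g(1)] by simp
    also have "\<dots> \<le> 1 * ?\<eta>" using g D(8) by (intro mult_right_mono) auto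
    finally show ?thesis using D(9) by (simp add: inner_diff_right)
  qed
  show "2 * \<rho> \<le> ?\<eta>" using h0 h1 by linarith
  obtain z \<theta> where z: "z \<in> \<gamma>" "0 \<le> \<theta>" "\<theta> \<le> 1" "x0 = (1 - \<theta>) *\<^sub>R z + \<theta> *\<^sub>R v"
    using D(11)[OF up(3)] by blast
  have hx0: "\<nu> \<bullet> x0 = c - \<theta> * ?\<eta>" unfolding z(4) by (rule height[OF z(1)])
  have "\<theta> * ?\<eta> < 1 * ?\<eta>" using h1 hx0 \<rho>(1) by (simp add: algebra_simps)
  then have \<theta>: "\<theta> < 1" using D(8) by (simp add: mult_less_cancel_right_disj)
  show "\<exists>z\<in>\<gamma>. \<forall>x. \<nu> \<bullet> x = c \<and> dist x z \<le> \<rho> \<longrightarrow> x \<in> \<gamma>"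
  proof (intro bexI[OF _ z(1)] allI impI, elim conjE)
    fix x assume x: "\<nu> \<bullet> x = c" "dist x z \<le> \<rho>"
    \<comment> \<open>\<open>y\<close> is the image of \<open>x\<close> under the homothety with
      centre \<open>v\<close> and ratio 1 - \<theta>, which maps \<open>z\<close> to
      \<open>x0\<close>; so it stays in the inscribed ball and at the height of
      \<open>x0\<close>.\<close>
    define y where "y = x0 + (1 - \<theta>) *\<^sub>R (x - z)"
    have "norm ((1 - \<theta>) *\<^sub>R (x - z)) \<le> 1 * norm (x - z)"
      unfolding norm_scaleR using z \<theta> by (intro mult_right_mono) auto
    then have "y \<in> K" using x(2) by (intro subsetD[OF \<rho>(2)]) (simp add: y_def dist_norm)
    then obtain g \<theta>' where g: "g \<in> \<gamma>" "0 \<le> \<theta>'" "\<theta>' \<le> 1" "y = (1 - \<theta>') *\<^sub>R g + \<theta>' *\<^sub>R v"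
      using D(11) by blast
    have "\<nu> \<bullet> y = \<nu> \<bullet> x0" using x(1) D(6)[OF z(1)] by (simp add: y_def inner_add_right inner_diff_right)
    moreover have "\<nu> \<bullet> y = c - \<theta>' * ?\<eta>" unfolding g(4) by (rule height[OF g(1)])
    ultimately have "\<theta>' = \<theta>" using hx0 D(8) by simp
    then have "(1 - \<theta>) *\<^sub>R g + \<theta> *\<^sub>R v = (1 - \<theta>) *\<^sub>R z + \<theta> *\<^sub>R v + (1 - \<theta>) *\<^sub>R (x - z)"
      using g(4) z(4) by (simp add: y_def)
    then have "(1 - \<theta>) *\<^sub>R g = (1 - \<theta>) *\<^sub>R x" by (simp add: algebra_simps)
    then show "x \<in> \<gamma>" using \<theta> g(1) by simp
  qed
qed

text \<open>The point x is projected from the apex onto the facet plane. As x is within r of the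
  plane and the apex at least 2 \<rho> away from it, \<theta> is at most r / (2 \<rho>) and at most
  1/2, so the image g satisfies |g - z| \<le> 2 (r + \<theta> M \<rho>) \<le> r (2 + M). Hence g
  lies in the disc, and x on the segment from g to the apex.\<close>

lemma cone_facet_half_ball:
  assumes cf: "cone_facet K \<gamma> \<nu> c v" and \<rho>: "0 < \<rho>" "2 * \<rho> \<le> c - \<nu> \<bullet> v"
    and z: "z \<in> \<gamma>" and disc: "\<And>x. \<nu> \<bullet> x = c \<Longrightarrow> dist x z \<le> \<delta> \<Longrightarrow> x \<in> \<gamma>"
    and M: "dist v z \<le> M * \<rho>" "0 \<le> M" and r: "r \<le> \<rho>" "r * (2 + M) \<le> \<delta>"
    and x: "\<nu> \<bullet> x \<le> c" "dist x z \<le> r"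
  shows "x \<in> K"
proof -
  note D = cone_facet_D[OF cf]
  let ?\<eta> = "c - \<nu> \<bullet> v"
  define \<theta> where "\<theta> = (c - \<nu> \<bullet> x) / ?\<eta>"
  have "c - \<nu> \<bullet> x = \<nu> \<bullet> (z - x)" using D(6)[OF z] by (simp add: inner_diff_right)
  also have "\<dots> \<le> r"
    using Cauchy_Schwarz_ineq2[of \<nu> "z - x"] D(1) x(2) by (simp add: dist_norm norm_minus_commute)
  finally have \<tau>: "c - \<nu> \<bullet> x \<le> r" .
  have r0: "0 \<le> r" using x(2) zero_le_dist[of x z] by linarith
  have \<theta>: "0 \<le> \<theta>" "\<theta> * (2 * \<rho>) \<le> r" "\<theta> * ?\<eta> = c - \<nu> \<bullet> x"
  proof -
    show "0 \<le> \<theta>" using x(1) D(8) by (simp add: \<theta>_def)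
    show e: "\<theta> * ?\<eta> = c - \<nu> \<bullet> x" using D(8) by (simp add: \<theta>_def)
    have "\<theta> * (2 * \<rho>) \<le> \<theta> * ?\<eta>" using \<open>0 \<le> \<theta>\<close> \<rho> by (intro mult_left_mono)
    then show "\<theta> * (2 * \<rho>) \<le> r" using e \<tau> by linarith
  qed
  have \<theta>2: "\<theta> \<le> 1 / 2"
  proof -
    have "\<theta> * (2 * \<rho>) \<le> 1 / 2 * (2 * \<rho>)" using \<theta> r \<rho> by linarith
    then show ?thesis using \<rho> by (simp add: mult_le_cancel_right)
  qed
  define g where "g = (1 / (1 - \<theta>)) *\<^sub>R (x - \<theta> *\<^sub>R v)"
  have xg: "(1 - \<theta>) *\<^sub>R g + \<theta> *\<^sub>R v = x" using \<theta>2 by (simp add: g_def)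
  have "\<nu> \<bullet> g = (\<nu> \<bullet> x - \<theta> * (\<nu> \<bullet> v)) / (1 - \<theta>)" by (simp add: g_def inner_diff_right)
  also have "\<nu> \<bullet> x - \<theta> * (\<nu> \<bullet> v) = c * (1 - \<theta>)" using \<theta>(3) by (simp add: algebra_simps)
  finally have gc: "\<nu> \<bullet> g = c" using \<theta>2 by simp
  have "(1 - \<theta>) *\<^sub>R (g - z) = (x - z) - \<theta> *\<^sub>R (v - z)"
    using xg by (simp add: algebra_simps)
  then have "(1 - \<theta>) * norm (g - z) = norm ((x - z) - \<theta> *\<^sub>R (v - z))"
    using norm_scaleR[of "1 - \<theta>" "g - z"] \<theta>2 by simp
  also have "\<dots> \<le> norm (x - z) + \<theta> * norm (v - z)"
    using norm_triangle_ineq4[of "x - z" "\<theta> *\<^sub>R (v - z)"] \<theta> by simp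
  also have "\<dots> \<le> r + \<theta> * (M * \<rho>)"
    using x(2) M \<theta> by (intro add_mono mult_left_mono) (auto simp: dist_norm)
  also have "\<theta> * (M * \<rho>) = M / 2 * (\<theta> * (2 * \<rho>))" by simp
  also have "\<dots> \<le> M / 2 * r" using \<theta> M by (intro mult_left_mono) auto
  finally have a: "(1 - \<theta>) * norm (g - z) \<le> r * (2 + M) / 2" by (simp add: algebra_simps)
  have "1 / 2 * norm (g - z) \<le> (1 - \<theta>) * norm (g - z)" using \<theta>2 by (intro mult_right_mono) auto
  with a r(2) have "dist g z \<le> \<delta>" by (simp add: dist_norm)
  then have "g \<in> \<gamma>" using disc gc by blast
  then show ?thesis using D(10)[of g \<theta>] \<theta> \<theta>2 xg by simp
qed

text \<open>Because \<gamma> contains a disc around \<open>z\<close>, the functional \<mu> is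
  constant along every direction tangential to the hyperplane; its tangential part \<open>u\<close>
  therefore vanishes.\<close>

lemma cone_facet_normal_unique:
  assumes disc: "\<And>x. \<nu> \<bullet> x = c \<Longrightarrow> dist x z \<le> \<delta> \<Longrightarrow> x \<in> \<gamma>" and z: "\<nu> \<bullet> z = c" and \<delta>: "0 < \<delta>"
    and \<nu>: "norm \<nu> = 1" and \<mu>: "norm \<mu> = 1" and H: "\<And>x. x \<in> \<gamma> \<Longrightarrow> \<mu> \<bullet> x = c'"
  shows "(\<mu> = \<nu> \<and> c' = c) \<or> (\<mu> = - \<nu> \<and> c' = - c)"
proof -
  have zz: "z \<in> \<gamma>" using disc z \<delta> by simp
  define u where "u = \<mu> - (\<mu> \<bullet> \<nu>) *\<^sub>R \<nu>"
  have nn: "\<nu> \<bullet> \<nu> = 1" "\<mu> \<bullet> \<mu> = 1" using \<nu> \<mu> by (auto simp: norm_eq_1)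
  have u: "\<nu> \<bullet> u = 0" by (simp add: u_def inner_diff_right nn inner_commute)
  \<comment> \<open>The summand 1 in the denominator covers the case u = 0.\<close>
  define t where "t = \<delta> / (norm u + 1)"
  have t: "0 < t" using \<delta> by (simp add: t_def add_nonneg_pos)
  have "t * norm u \<le> \<delta>" using \<delta> by (simp add: t_def divide_le_eq mult_le_cancel_left add_nonneg_pos)
  then have "z + t *\<^sub>R u \<in> \<gamma>" using t by (intro disc) (auto simp: inner_add_right u z dist_norm)
  then have "t * (\<mu> \<bullet> u) = 0" using H[OF zz] H[of "z + t *\<^sub>R u"] by (simp add: inner_add_right)
  then have "\<mu> \<bullet> u = 0" using t by simp
  then have "u \<bullet> u = 0" using u by (simp add: u_def inner_diff_left)
  then have e: "\<mu> = (\<mu> \<bullet> \<nu>) *\<^sub>R \<nu>" by (simp add: u_def)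
  then have "\<bar>\<mu> \<bullet> \<nu>\<bar> = 1" using \<mu> \<nu> by (metis mult.right_neutral norm_scaleR)
  then have "\<mu> \<bullet> \<nu> = 1 \<or> \<mu> \<bullet> \<nu> = - 1" by linarith
  then show ?thesis
  proof
    assume "\<mu> \<bullet> \<nu> = 1"
    then have "\<mu> = \<nu>" using e by simp
    then show ?thesis using H[OF zz] z by simp
  next
    assume "\<mu> \<bullet> \<nu> = - 1"
    then have "\<mu> = - \<nu>" using e by simp
    then show ?thesis using H[OF zz] z by simp
  qed
qed

lemma simplex_interior_nonempty:
  assumes K: "int DIM('a) simplex (K :: 'a::euclidean_space set)"
  shows "interior K \<noteq> {}"
proof -
  obtain C where C: "finite C" "card C = DIM('a) + 1" "\<not> affine_dependent C" "K = convex hull C"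
    using simplex_facet_cases[OF K] by metis
  then show ?thesis using interior_convex_hull_eq_empty[of C] by simp
qed

lemma simplex_cball:
  assumes K: "int DIM('a) simplex (K :: 'a::euclidean_space set)"
  obtains x0 \<rho> where "0 < \<rho>" "cball x0 \<rho> \<subseteq> K"
  using simplex_interior_nonempty[OF K] by (metis ex_in_conv mem_interior_cball)

lemma diameter_ge_radius:
  fixes K :: "'a::euclidean_space set"
  assumes "bounded K" "cball x \<rho> \<subseteq> K" "0 \<le> \<rho>"
  shows "\<rho> \<le> diameter K"
proof -
  obtain e :: 'a where e: "e \<in> Basis" using nonempty_Basis by blast
  have "x \<in> K" "x + \<rho> *\<^sub>R e \<in> K" using assms e by (auto intro!: subsetD[OF assms(2)] simp: dist_norm)
  from diameter_bounded_bound[OF assms(1) this] show ?thesis using e assms by (simp add: dist_norm)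
qed

text \<open>\<open>inball_diameter\<close> is a supremum; taking a ball that exceeds half of it
  costs one factor 2, and passing from diameter to radius costs another. Hence 4 \<sigma>.\<close>

lemma shape_regular_cball:
  assumes K: "int DIM('a) simplex (K :: 'a::euclidean_space set)" and \<sigma>: "0 < \<sigma>" "diameter K \<le> \<sigma> * inball_diameter K"
  obtains x0 \<rho> where "0 < \<rho>" "cball x0 \<rho> \<subseteq> K" "diameter K \<le> (4 * \<sigma>) * \<rho>"
proof -
  let ?A = "{2 * r | x r. 0 \<le> r \<and> cball x r \<subseteq> K}"
  obtain y s where y: "0 < s" "cball y s \<subseteq> K" using simplex_cball[OF K] .
  have "0 < diameter K"
    using diameter_ge_radius[of K y s] y compact_imp_bounded[OF simplex_compact_convex(1)[OF K]] by simp
  then have I: "0 < inball_diameter K" using \<sigma> by (smt (verit) mult_nonneg_nonpos)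
  then have lt: "inball_diameter K / 2 < Sup ?A" by (simp add: inball_diameter_def)
  have "2 * s \<in> ?A" using y by force
  then have "?A \<noteq> {}" by (metis empty_iff)
  from less_cSupD[OF this lt] obtain a where "a \<in> ?A" "inball_diameter K / 2 < a" by (elim bexE)
  then obtain x r where r: "0 \<le> r" "cball x r \<subseteq> K" "inball_diameter K / 2 < 2 * r" by auto
  have "diameter K \<le> \<sigma> * (4 * r)" using \<sigma> r by (intro order_trans[OF \<sigma>(2)] mult_left_mono) auto
  then show ?thesis using r I by (intro that[of r x]) auto
qed

text \<open>A qualitative form, with a radius depending on the simplex, for deciding on which side
  of a facet an element lies; \<open>M\<close> is whatever ratio the simplex happens to
  have.\<close>

lemma cone_facet_some_half_ball:
  assumes cf: "cone_facet K \<gamma> \<nu> c v" and K: "int DIM('a) simplex (K :: 'a::euclidean_space set)"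
    and z: "z \<in> \<gamma>" and \<delta>: "0 < \<delta>" and disc: "\<And>x. \<nu> \<bullet> x = c \<Longrightarrow> dist x z \<le> \<delta> \<Longrightarrow> x \<in> \<gamma>"
  obtains r where "0 < r" "\<And>x. \<nu> \<bullet> x \<le> c \<Longrightarrow> dist x z \<le> r \<Longrightarrow> x \<in> K"
proof -
  obtain x0 \<rho> where \<rho>: "0 < \<rho>" "cball x0 \<rho> \<subseteq> K" using simplex_cball[OF K] .
  define M where "M = dist v z / \<rho>"
  have M: "0 \<le> M" "dist v z \<le> M * \<rho>" using \<rho> by (auto simp: M_def)
  show ?thesis
  proof (rule that[of "min \<rho> (\<delta> / (2 + M))"])
    show "0 < min \<rho> (\<delta> / (2 + M))" using \<rho> \<delta> M by (simp add: add_pos_nonneg)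
    fix x assume x: "\<nu> \<bullet> x \<le> c" "dist x z \<le> min \<rho> (\<delta> / (2 + M))"
    have "min \<rho> (\<delta> / (2 + M)) * (2 + M) \<le> \<delta> / (2 + M) * (2 + M)"
      using M by (intro mult_right_mono) auto
    then have "min \<rho> (\<delta> / (2 + M)) * (2 + M) \<le> \<delta>" using M by simp
    then show "x \<in> K"
      by (intro cone_facet_half_ball[OF cf \<rho>(1) cone_facet_disc(2)[OF cf \<rho>] z disc M(2) M(1) _ _ x]) auto
  qed
qed

section \<open>Conformity: the two elements at a side\<close>

text \<open>Both elements contain the half ball at a point of the facet, so their interiors meet.
  Their intersection is a face of each, and a face that meets the interior is the whole
  simplex.\<close>

lemma triangulation_same_side:
  assumes T: "triangulation \<T>" "K \<in> \<T>" "K' \<in> \<T>"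
    and S: "int DIM('a) simplex (K :: 'a::euclidean_space set)" "int DIM('a) simplex K'"
    and cf: "cone_facet K \<gamma> \<nu> c v" "cone_facet K' \<gamma> \<nu> c v'"
  shows "K = K'"
proof -
  obtain x0 \<rho> where \<rho>: "0 < \<rho>" "cball x0 \<rho> \<subseteq> K" using simplex_cball[OF S(1)] .
  obtain z where z: "z \<in> \<gamma>" and disc: "\<And>x. \<nu> \<bullet> x = c \<Longrightarrow> dist x z \<le> \<rho> \<Longrightarrow> x \<in> \<gamma>"
    using cone_facet_disc(1)[OF cf(1) \<rho>] by blast
  obtain r1 where r1: "0 < r1" "\<And>x. \<nu> \<bullet> x \<le> c \<Longrightarrow> dist x z \<le> r1 \<Longrightarrow> x \<in> K"
    using cone_facet_some_half_ball[OF cf(1) S(1) z \<rho>(1) disc] by blast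
  obtain r2 where r2: "0 < r2" "\<And>x. \<nu> \<bullet> x \<le> c \<Longrightarrow> dist x z \<le> r2 \<Longrightarrow> x \<in> K'"
    using cone_facet_some_half_ball[OF cf(2) S(2) z \<rho>(1) disc] by blast
  define s where "s = min r1 r2 / 2"
  have s: "0 < s" "2 * s \<le> r1" "2 * s \<le> r2" using r1 r2 by (auto simp: s_def)
  note D = cone_facet_D[OF cf(1)]
  have *: "\<nu> \<bullet> x \<le> c \<and> dist x z \<le> 2 * s" if "x \<in> ball (z - s *\<^sub>R \<nu>) s" for x
  proof
    have n: "norm (x - (z - s *\<^sub>R \<nu>)) \<le> s" using that by (simp add: dist_norm norm_minus_commute)
    have "\<nu> \<bullet> x = \<nu> \<bullet> (x - (z - s *\<^sub>R \<nu>)) + c - s"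
      using D(6)[OF z] D(9) by (simp add: inner_diff_right inner_add_right)
    moreover have "\<nu> \<bullet> (x - (z - s *\<^sub>R \<nu>)) \<le> s"
      using norm_cauchy_schwarz[of \<nu> "x - (z - s *\<^sub>R \<nu>)"] n D(1) by simp
    ultimately show "\<nu> \<bullet> x \<le> c" by simp
    have "x - z = (x - (z - s *\<^sub>R \<nu>)) - s *\<^sub>R \<nu>" by simp
    then have "norm (x - z) \<le> norm (x - (z - s *\<^sub>R \<nu>)) + norm (s *\<^sub>R \<nu>)"
      by (metis norm_triangle_ineq4)
    then show "dist x z \<le> 2 * s" using n D(1) s by (simp add: dist_norm)
  qed
  then have sub: "ball (z - s *\<^sub>R \<nu>) s \<subseteq> K" "ball (z - s *\<^sub>R \<nu>) s \<subseteq> K'"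
    using r1(2) r2(2) s by (meson order_trans subsetI)+
  have c: "z - s *\<^sub>R \<nu> \<in> interior K" "z - s *\<^sub>R \<nu> \<in> interior K'" "z - s *\<^sub>R \<nu> \<in> K \<inter> K'"
    using interior_maximal[OF sub(1)] interior_maximal[OF sub(2)] sub s centre_in_ball[of "z - s *\<^sub>R \<nu>" s] by blast+
  have "(K' \<inter> K) face_of K'" using T by (auto simp: triangulation_def)
  then have f: "(K \<inter> K') face_of K" "(K \<inter> K') face_of K'"
    using T by (auto simp: triangulation_def Int_commute)
  have "K \<inter> K' = K" using face_of_disjoint_interior[OF f(1)] c by blast
  moreover have "K \<inter> K' = K'" using face_of_disjoint_interior[OF f(2)] c by blast
  ultimately show ?thesis by blast
qed

lemma triangulation_opposite_sides:
  assumes T: "triangulation \<T>" "K \<in> \<T>" "K' \<in> \<T>" "K \<noteq> K'"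
    and S: "int DIM('a) simplex (K :: 'a::euclidean_space set)" "int DIM('a) simplex K'"
    and cf: "cone_facet K \<gamma> \<nu> c v" "cone_facet K' \<gamma> \<nu>' c' v'"
  shows "\<nu>' = - \<nu>" "c' = - c"
proof -
  obtain x0 \<rho> where \<rho>: "0 < \<rho>" "cball x0 \<rho> \<subseteq> K" using simplex_cball[OF S(1)] .
  obtain z where z: "z \<in> \<gamma>" and disc: "\<And>x. \<nu> \<bullet> x = c \<Longrightarrow> dist x z \<le> \<rho> \<Longrightarrow> x \<in> \<gamma>"
    using cone_facet_disc(1)[OF cf(1) \<rho>] by blast
  have "(\<nu>' = \<nu> \<and> c' = c) \<or> (\<nu>' = - \<nu> \<and> c' = - c)"
    by (rule cone_facet_normal_unique[OF disc _ \<rho>(1) cone_facet_D(1)[OF cf(1)] cone_facet_D(1)[OF cf(2)] cone_facet_D(6)[OF cf(2)]])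
       (use cone_facet_D(6)[OF cf(1) z] in auto)
  then show "\<nu>' = - \<nu>" "c' = - c"
    using triangulation_same_side[OF T(1-3) S cf(1)] cf(2) T(4) by blast+
qed

text \<open>Every element at \<gamma> other than \<open>K1\<close> has the normal opposite to that
  of \<open>K1\<close>; two such elements lie on the same side and therefore coincide.\<close>

lemma facet_elements:
  assumes T: "triangulation \<T>" "\<And>K. K \<in> \<T> \<Longrightarrow> int DIM('a) simplex (K :: 'a::euclidean_space set)"
    and K: "K1 \<in> \<T>" "K2 \<in> \<T>" "K1 \<noteq> K2" "\<gamma> facet_of K1" "\<gamma> facet_of K2"
  shows "{K. K \<in> \<T> \<and> \<gamma> facet_of K} = {K1, K2}"
proof -
  have "K3 = K2" if K3: "K3 \<in> \<T>" "\<gamma> facet_of K3" "K3 \<noteq> K1" for K3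
  proof -
    obtain \<nu> c v where c1: "cone_facet K1 \<gamma> \<nu> c v" using simplex_facet_cone[OF T(2)[OF K(1)] K(4)] .
    obtain \<nu>2 c2 v2 where c2: "cone_facet K2 \<gamma> \<nu>2 c2 v2" using simplex_facet_cone[OF T(2)[OF K(2)] K(5)] .
    obtain \<nu>3 c3 v3 where c3: "cone_facet K3 \<gamma> \<nu>3 c3 v3" using simplex_facet_cone[OF T(2)[OF K3(1)] K3(2)] .
    have "\<nu>2 = - \<nu>" "c2 = - c"
      using triangulation_opposite_sides[OF T(1) K(1-3) T(2)[OF K(1)] T(2)[OF K(2)] c1 c2] .
    moreover have "\<nu>3 = - \<nu>" "c3 = - c"
      using triangulation_opposite_sides[OF T(1) K(1) K3(1) _ T(2)[OF K(1)] T(2)[OF K3(1)] c1 c3] K3(3) by auto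
    ultimately show ?thesis
      using triangulation_same_side[OF T(1) K3(1) K(2) T(2)[OF K3(1)] T(2)[OF K(2)] c3] c2 by simp
  qed
  then show ?thesis using K by blast
qed

lemma outer_normal_eq:
  assumes cf: "cone_facet K \<gamma> \<nu> c v" and K: "int DIM('a) simplex (K :: 'a::euclidean_space set)"
  shows "outer_normal K \<gamma> = \<nu>"
  unfolding outer_normal_def
proof (rule the_equality)
  note D = cone_facet_D[OF cf]
  show "norm \<nu> = 1 \<and> (\<exists>c. \<gamma> \<subseteq> {x. \<nu> \<bullet> x = c} \<and> K \<subseteq> {x. \<nu> \<bullet> x \<le> c})"
    using D(1,6,7) by blast
  fix \<mu> assume "norm \<mu> = 1 \<and> (\<exists>c. \<gamma> \<subseteq> {x. \<mu> \<bullet> x = c} \<and> K \<subseteq> {x. \<mu> \<bullet> x \<le> c})"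
  then obtain c' where \<mu>: "norm \<mu> = 1" "\<gamma> \<subseteq> {x. \<mu> \<bullet> x = c'}" "K \<subseteq> {x. \<mu> \<bullet> x \<le> c'}" by blast
  obtain x0 \<rho> where \<rho>: "0 < \<rho>" "cball x0 \<rho> \<subseteq> K" using simplex_cball[OF K] .
  obtain z where z: "z \<in> \<gamma>" and disc: "\<And>x. \<nu> \<bullet> x = c \<Longrightarrow> dist x z \<le> \<rho> \<Longrightarrow> x \<in> \<gamma>"
    using cone_facet_disc(1)[OF cf \<rho>] by blast
  have "(\<mu> = \<nu> \<and> c' = c) \<or> (\<mu> = - \<nu> \<and> c' = - c)"
    by (rule cone_facet_normal_unique[OF disc _ \<rho>(1) D(1) \<mu>(1)]) (use D(6)[OF z] \<mu> in auto)
  moreover have "\<not> (\<mu> = - \<nu> \<and> c' = - c)" using \<mu>(3) D(5,8) by auto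
  ultimately show "\<mu> = \<nu>" by blast
qed

text \<open>\<open>cone_facet_half_ball\<close> is applied on both sides with the disc of radius
  \<rho>1 obtained from \<open>K1\<close>, which leads to r = \<rho>1 / (2 + M). For
  \<open>K2\<close> this also needs r \<le> \<rho>2, hence a comparison of the two elements through
  their common facet.\<close>

lemma shared_side_ball:
  fixes K1 K2 :: "'a::euclidean_space set"
  assumes dim: "2 \<le> DIM('a)"
    and T: "triangulation \<T>" "K1 \<in> \<T>" "K2 \<in> \<T>" "K1 \<noteq> K2"
    and S: "int DIM('a) simplex K1" "int DIM('a) simplex K2"
    and f: "\<gamma> facet_of K1" "\<gamma> facet_of K2"
    and b1: "0 < \<rho>1" "cball x1 \<rho>1 \<subseteq> K1" "diameter K1 \<le> M * \<rho>1"
    and b2: "0 < \<rho>2" "cball x2 \<rho>2 \<subseteq> K2" "diameter K2 \<le> M * \<rho>2" and M: "0 < M"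
  obtains \<nu> c z r v1 v2 where "cone_facet K1 \<gamma> \<nu> c v1" "cone_facet K2 \<gamma> (- \<nu>) (- c) v2" "z \<in> \<gamma>" "0 < r"
    "r \<le> diameter K1" "diameter K1 \<le> M * (2 + M) * r" "diameter K1 \<le> M * diameter K2"
    "\<And>x. dist x z \<le> r \<Longrightarrow> \<nu> \<bullet> x \<le> c \<Longrightarrow> x \<in> K1" "\<And>x. dist x z \<le> r \<Longrightarrow> c \<le> \<nu> \<bullet> x \<Longrightarrow> x \<in> K2"
proof -
  obtain \<nu> c v1 where c1: "cone_facet K1 \<gamma> \<nu> c v1" using simplex_facet_cone[OF S(1) f(1)] .
  obtain \<nu>2 c2 v2 where "cone_facet K2 \<gamma> \<nu>2 c2 v2" using simplex_facet_cone[OF S(2) f(2)] .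
  then have c2: "cone_facet K2 \<gamma> (- \<nu>) (- c) v2"
    using triangulation_opposite_sides[OF T S c1] by blast
  note D1 = cone_facet_D[OF c1] and D2 = cone_facet_D[OF c2]
  obtain z where z: "z \<in> \<gamma>" and disc: "\<And>x. \<nu> \<bullet> x = c \<Longrightarrow> dist x z \<le> \<rho>1 \<Longrightarrow> x \<in> \<gamma>"
    using cone_facet_disc(1)[OF c1 b1(1,2)] by blast
  have bd: "bounded K1" "bounded K2"
    using S simplex_compact_convex compact_imp_bounded by blast+
  \<comment> \<open>In dimension at least 2 the disc contains a point z + w with |w| = \<rho>1 along
    the facet, so the neighbour has diameter at least \<rho>1.\<close>
  obtain u where u: "u \<noteq> 0" "orthogonal \<nu> u" using orthogonal_to_vector_exists[OF dim] by blast
  define w where "w = (\<rho>1 / norm u) *\<^sub>R u"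
  have w: "norm w = \<rho>1" "\<nu> \<bullet> w = 0" using u b1(1) by (auto simp: w_def orthogonal_def)
  have "z + w \<in> \<gamma>" using w D1(6)[OF z] by (intro disc) (auto simp: inner_add_right dist_norm)
  then have "z + w \<in> K2" "z \<in> K2" using D2(4) z by auto
  from diameter_bounded_bound[OF bd(2) this] have h2: "\<rho>1 \<le> diameter K2" using w by (simp add: dist_norm)
  define r where "r = \<rho>1 / (2 + M)"
  have r: "0 < r" "r * (2 + M) = \<rho>1" using b1(1) M by (auto simp: r_def)
  have "r * 1 \<le> r * (2 + M)" using r(1) M by (intro mult_left_mono) auto
  then have r1: "r \<le> \<rho>1" using r by simp
  have r2: "r \<le> \<rho>2"
  proof -
    have "\<rho>1 \<le> M * \<rho>2" using h2 b2(3) by linarith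
    also have "\<dots> \<le> \<rho>2 * (2 + M)" using b2(1) by (simp add: algebra_simps)
    finally show ?thesis using M by (simp add: r_def divide_le_eq)
  qed
  have dv1: "dist v1 z \<le> M * \<rho>1"
    using diameter_bounded_bound[OF bd(1) D1(5), of z] D1(4) z b1(3) by force
  have dv2: "dist v2 z \<le> M * \<rho>2"
    using diameter_bounded_bound[OF bd(2) D2(5), of z] D2(4) z b2(3) by force
  show ?thesis
  proof (rule that[OF c1 c2 z r(1)])
    show "r \<le> diameter K1" using r1 diameter_ge_radius[OF bd(1) b1(2)] b1(1) by linarith
    show "diameter K1 \<le> M * (2 + M) * r" using b1(3) r by (simp add: mult.assoc mult.commute[of "2 + M"])
    have "M * \<rho>1 \<le> M * diameter K2" using M h2 by simp
    then show "diameter K1 \<le> M * diameter K2" using b1(3) by linarith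
    show "x \<in> K1" if "dist x z \<le> r" "\<nu> \<bullet> x \<le> c" for x
      by (rule cone_facet_half_ball[OF c1 b1(1) cone_facet_disc(2)[OF c1 b1(1,2)] z disc dv1 _ r1 _ that(2,1)])
         (use M r in auto)
    show "x \<in> K2" if "dist x z \<le> r" "c \<le> \<nu> \<bullet> x" for x
      by (rule cone_facet_half_ball[OF c2 b2(1) cone_facet_disc(2)[OF c2 b2(1,2)] z _ dv2 _ r2 _ _ that(1)])
         (use M r disc that in auto)
  qed
qed

section \<open>Gradients, jumps and the surface measure of sides\<close>

lemma affine_eq_on_ball:
  fixes g :: "'a::euclidean_space"
  assumes r: "0 < r" and 0: "\<And>x. x \<in> cball z r \<Longrightarrow> g \<bullet> x + c = g' \<bullet> x + c'"
  shows "g = g'" "c = c'"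
proof -
  define u where "u = (r / (norm (g - g') + 1)) *\<^sub>R (g - g')"
  have "norm u \<le> r" using r by (simp add: u_def divide_le_eq mult_le_cancel_left add_nonneg_pos abs_mult)
  then have "g \<bullet> (z + u) + c = g' \<bullet> (z + u) + c'" "g \<bullet> z + c = g' \<bullet> z + c'"
    using r by (auto intro!: 0 simp: dist_norm)
  then have "(g - g') \<bullet> u = 0" by (simp add: inner_add_right inner_diff_left)
  then have "r / (norm (g - g') + 1) = 0 \<or> (g - g') \<bullet> (g - g') = 0" unfolding u_def by auto
  moreover have "norm (g - g') + 1 > 0" using norm_ge_zero[of "g - g'"] by linarith
  ultimately show "g = g'" using r by auto
  then show "c = c'" using 0[of z] r by simp
qed

lemma grad_on_eq:
  assumes K: "int DIM('a) simplex (K :: 'a::euclidean_space set)" and g: "\<And>x. x \<in> K \<Longrightarrow> z x = g \<bullet> x + c"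
  shows "grad_on K z = g"
  unfolding grad_on_def
proof (rule the_equality)
  show "\<exists>c. \<forall>x\<in>K. z x = g \<bullet> x + c" using g by blast
  fix g' assume "\<exists>c. \<forall>x\<in>K. z x = g' \<bullet> x + c"
  then obtain c' where g': "\<forall>x\<in>K. z x = g' \<bullet> x + c'" by blast
  obtain x0 \<rho> where \<rho>: "0 < \<rho>" "cball x0 \<rho> \<subseteq> K" using simplex_cball[OF K] .
  have "g' \<bullet> x + c' = g \<bullet> x + c" if "x \<in> cball x0 \<rho>" for x
  proof -
    have "x \<in> K" using \<rho> that by blast
    then show ?thesis using g[of x] g' by auto
  qed
  then show "g' = g" using affine_eq_on_ball(1)[OF \<rho>(1)] by blast
qed

lemma normal_jump_eq:
  assumes T: "triangulation \<T>" "\<And>K. K \<in> \<T> \<Longrightarrow> int DIM('a) simplex (K :: 'a::euclidean_space set)"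
    and K: "K1 \<in> \<T>" "K2 \<in> \<T>" "K1 \<noteq> K2" "\<gamma> facet_of K1" "\<gamma> facet_of K2"
    and cf: "cone_facet K1 \<gamma> \<nu> c v1" "cone_facet K2 \<gamma> (- \<nu>) (- c) v2"
    and g: "\<And>x. x \<in> K1 \<Longrightarrow> z x = g1 \<bullet> x + d1" "\<And>x. x \<in> K2 \<Longrightarrow> z x = g2 \<bullet> x + d2"
  shows "normal_jump \<T> z \<gamma> = \<nu> \<bullet> (g1 - g2)"
proof -
  have "{K. K \<in> \<T> \<and> \<gamma> facet_of K} = {K1, K2}" by (rule facet_elements[OF T K])
  then show ?thesis
    unfolding normal_jump_def
    using K(3) outer_normal_eq[OF cf(1) T(2)[OF K(1)]] outer_normal_eq[OF cf(2) T(2)[OF K(2)]]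
      grad_on_eq[OF T(2)[OF K(1)] g(1)] grad_on_eq[OF T(2)[OF K(2)] g(2)]
    by (simp add: inner_diff_right)
qed

text \<open>Identifies the hyperplane that carries the surface measure in \<open>jump_norm\<close>;
  the disc inside the facet already spans it.\<close>

lemma affine_hull_cone_facet:
  assumes cf: "cone_facet K \<gamma> \<nu> c v" and K: "int DIM('a) simplex (K :: 'a::euclidean_space set)"
  shows "affine hull \<gamma> = {x. \<nu> \<bullet> x = c}"
proof
  note D = cone_facet_D[OF cf]
  show "affine hull \<gamma> \<subseteq> {x. \<nu> \<bullet> x = c}"
    by (rule hull_minimal) (use D(6) affine_hyperplane in auto)
  obtain x0 \<rho> where \<rho>: "0 < \<rho>" "cball x0 \<rho> \<subseteq> K" using simplex_cball[OF K] .
  obtain z where z: "z \<in> \<gamma>" and disc: "\<And>x. \<nu> \<bullet> x = c \<Longrightarrow> dist x z \<le> \<rho> \<Longrightarrow> x \<in> \<gamma>"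
    using cone_facet_disc(1)[OF cf \<rho>] by blast
  show "{x. \<nu> \<bullet> x = c} \<subseteq> affine hull \<gamma>"
  proof
    fix x assume x: "x \<in> {x. \<nu> \<bullet> x = c}"
    define s where "s = \<rho> / (norm (x - z) + 1)"
    have s: "0 < s" using \<rho> by (simp add: s_def add_nonneg_pos)
    have "s * norm (x - z) \<le> \<rho>" using \<rho> by (simp add: s_def divide_le_eq mult_le_cancel_left add_nonneg_pos)
    then have y: "z + s *\<^sub>R (x - z) \<in> \<gamma>"
      using x D(6)[OF z] s by (intro disc) (auto simp: inner_add_right inner_diff_right dist_norm)
    have "(1 - 1 / s) *\<^sub>R z + (1 / s) *\<^sub>R (z + s *\<^sub>R (x - z)) \<in> affine hull \<gamma>"
      by (rule mem_affine[OF affine_affine_hull]) (use z y hull_inc in auto)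
    moreover have "(1 - 1 / s) *\<^sub>R z + (1 / s) *\<^sub>R (z + s *\<^sub>R (x - z)) = x"
      using s by (simp add: algebra_simps)
    ultimately show "x \<in> affine hull \<gamma>" by simp
  qed
qed

text \<open>The surface measure of \<gamma> is the volume of the cylinder of thickness 1 over it.
  Cut into layers of thickness h, each layer fits into a ball of radius 2h, and at most 1/h + 1
  layers occur. For bounded h the result is of order h^(d-1).\<close>

lemma hyperplane_measure_le:
  fixes \<gamma> :: "'a::euclidean_space set"
  assumes \<nu>: "norm \<nu> = 1" and \<gamma>: "closed \<gamma>" "\<gamma> \<subseteq> {x. \<nu> \<bullet> x = c}" and z: "z \<in> \<gamma>" and h: "0 < h" "\<And>x. x \<in> \<gamma> \<Longrightarrow> dist x z \<le> h"
  shows "measure (hyperplane_measure {x. \<nu> \<bullet> x = c}) \<gamma> \<le> (1 / h + 1) * (unit_ball_vol DIM('a) * (2 * h) ^ DIM('a))"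
proof -
  let ?H = "{x. \<nu> \<bullet> x = c}"
  let ?S = "{x. infdist x ?H \<le> 1 / 2}"
  have nn: "\<nu> \<bullet> \<nu> = 1" using \<nu> by (simp add: norm_eq_1)
  have H: "closed ?H" "convex ?H" "?H \<noteq> {}"
    using closed_hyperplane convex_hyperplane z \<gamma>(2) by auto
  have Sb: "?S \<in> sets borel"
    by (intro borel_closed closed_Collect_le continuous_intros)
  have cp: "closest_point ?H \<in> borel_measurable borel"
    by (intro borel_measurable_continuous_onI continuous_on_closest_point H)
  then have cpm: "closest_point ?H \<in> measurable (restrict_space lborel ?S) borel"
    by (intro measurable_restrict_space1) simp
  have proj: "x = closest_point ?H x + (\<nu> \<bullet> x - c) *\<^sub>R \<nu> \<and> infdist x ?H = \<bar>\<nu> \<bullet> x - c\<bar>" for x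
  proof -
    let ?p = "closest_point ?H x" and ?t = "\<nu> \<bullet> x - c"
    have p: "?p \<in> ?H" using closest_point_in_set[OF H(1,3)] .
    have q: "x - ?t *\<^sub>R \<nu> \<in> ?H" using nn by (simp add: inner_diff_right)
    \<comment> \<open>Minimality bounds |x - p| by |t|, while the component of x - p along \<nu> is
      exactly t; so x - p has no tangential part.\<close>
    have "dist x ?p \<le> dist x (x - ?t *\<^sub>R \<nu>)" by (rule closest_point_le[OF H(1) q])
    then have "norm (x - ?p) \<le> \<bar>?t\<bar>" using \<nu> by (simp add: dist_norm)
    then have "(norm (x - ?p))\<^sup>2 \<le> ?t\<^sup>2" by (metis abs_ge_zero norm_ge_zero power2_abs power_mono)
    moreover have "\<nu> \<bullet> (x - ?p) = ?t" using p by (simp add: inner_diff_right)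
    moreover have "(norm (w - t *\<^sub>R \<nu>))\<^sup>2 = (norm w)\<^sup>2 - 2 * t * (\<nu> \<bullet> w) + t\<^sup>2" for w t
      unfolding power2_norm_eq_inner using nn
      by (simp add: inner_diff_left inner_diff_right inner_commute[of w \<nu>] power2_eq_square right_diff_distrib)
    ultimately have "(norm (x - ?p - ?t *\<^sub>R \<nu>))\<^sup>2 \<le> ?t\<^sup>2 - 2 * ?t * ?t + ?t\<^sup>2"
      by (metis add_right_mono diff_right_mono)
    then have "(norm (x - ?p - ?t *\<^sub>R \<nu>))\<^sup>2 \<le> 0"
      unfolding power2_eq_square[of ?t] by linarith
    then have e: "x = ?p + ?t *\<^sub>R \<nu>" by (simp add: algebra_simps)
    have "infdist x ?H = dist x ?p"
      using infdist_le[OF p, of x] closest_point_le[OF H(1), of _ x]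
      by (intro antisym) (auto simp: infdist_notempty[OF H(3)] intro!: cINF_greatest H(3))
    also have "\<dots> = \<bar>?t\<bar>" using e \<nu> by (metis add_diff_cancel_left' dist_norm mult.right_neutral norm_scaleR)
    finally show ?thesis using e by blast
  qed
  define N where "N = nat \<lfloor>1 / h\<rfloor>"
  define B where "B k = cball (z + (real k * h - 1 / 2) *\<^sub>R \<nu>) (2 * h)" for k
  have sub: "closest_point ?H -` \<gamma> \<inter> ?S \<subseteq> (\<Union>k\<in>{..N}. B k)"
  proof
    fix x assume x: "x \<in> closest_point ?H -` \<gamma> \<inter> ?S"
    let ?p = "closest_point ?H x" and ?t = "\<nu> \<bullet> x - c"
    \<comment> \<open>Heights range over [-1/2, 1/2]; the shift by 1/2 numbers the layers from
      0.\<close>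
    define k where "k = nat \<lfloor>(?t + 1 / 2) / h\<rfloor>"
    have "\<bar>?t\<bar> \<le> 1 / 2" using x proj[of x] by simp
    then have t: "- 1 / 2 \<le> ?t" "?t \<le> 1 / 2" by linarith+
    have nn: "0 \<le> (?t + 1 / 2) / h" using t h by simp
    have kk: "real k \<le> (?t + 1 / 2) / h" "(?t + 1 / 2) / h < real k + 1"
      using nn by (auto simp: k_def of_nat_nat)
    have "(?t + 1 / 2) / h \<le> 1 / h" using t h by (intro divide_right_mono) auto
    then have kN: "k \<le> N" unfolding k_def N_def by (intro nat_mono floor_mono)
    have "\<bar>?t - (real k * h - 1 / 2)\<bar> \<le> h"
      using kk h by (simp add: field_simps abs_le_iff)
    moreover have "dist (z + (real k * h - 1 / 2) *\<^sub>R \<nu>) x \<le> dist ?p z + \<bar>?t - (real k * h - 1 / 2)\<bar>"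
    proof -
      have e: "x - (z + (real k * h - 1 / 2) *\<^sub>R \<nu>) = (?p - z) + (?t - (real k * h - 1 / 2)) *\<^sub>R \<nu>"
        using proj[of x] by (simp add: algebra_simps)
      have "dist (z + (real k * h - 1 / 2) *\<^sub>R \<nu>) x = norm (x - (z + (real k * h - 1 / 2) *\<^sub>R \<nu>))"
        by (simp only: dist_norm norm_minus_commute)
      also have "\<dots> \<le> norm (?p - z) + norm ((?t - (real k * h - 1 / 2)) *\<^sub>R \<nu>)"
        unfolding e by (rule norm_triangle_ineq)
      finally show ?thesis using \<nu> by (simp add: dist_norm)
    qed
    moreover have "dist ?p z \<le> h" using h x by auto
    ultimately have "x \<in> B k" unfolding B_def by simp
    then show "x \<in> (\<Union>k\<in>{..N}. B k)" using kN by blast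
  qed
  have Bm: "B k \<in> fmeasurable lborel" "measure lborel (B k) = unit_ball_vol DIM('a) * (2 * h) ^ DIM('a)" for k
    using h emeasure_bounded_finite[OF bounded_cball] by (auto simp: B_def content_cball fmeasurable_def)
  have "measure (hyperplane_measure ?H) \<gamma> = measure lborel (closest_point ?H -` \<gamma> \<inter> ?S)"
  proof -
    have sp: "space (restrict_space lborel ?S) = ?S" by (simp add: space_restrict_space)
    show ?thesis
      unfolding hyperplane_measure_def measure_distr[OF cpm borel_closed[OF \<gamma>(1)]] sp
      by (rule measure_restrict_space) (use Sb in auto)
  qed
  also have "\<dots> \<le> measure lborel (\<Union>k\<in>{..N}. B k)"
  proof (rule measure_mono_fmeasurable[OF sub])
    show "closest_point ?H -` \<gamma> \<inter> ?S \<in> sets lborel"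
      using measurable_sets[OF cp borel_closed[OF \<gamma>(1)]] Sb by auto
    show "(\<Union>k\<in>{..N}. B k) \<in> fmeasurable lborel" using Bm by (intro fmeasurable.finite_UN) auto
  qed
  also have "\<dots> \<le> (\<Sum>k\<in>{..N}. measure lborel (B k))"
    using Bm by (intro measure_UNION_le) (auto simp: fmeasurable_def)
  also have "\<dots> = (real N + 1) * (unit_ball_vol DIM('a) * (2 * h) ^ DIM('a))"
    by (simp add: Bm)
  also have "\<dots> \<le> (1 / h + 1) * (unit_ball_vol DIM('a) * (2 * h) ^ DIM('a))"
  proof (rule mult_right_mono)
    show "real N + 1 \<le> 1 / h + 1" using h by (simp add: N_def of_nat_nat)
  qed (use h in simp)
  finally show ?thesis .
qed

section \<open>Residuals tested on a ball\<close>

lemma measure_lebesgue_cball: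
  "0 \<le> r \<Longrightarrow> measure lebesgue (cball (z::'a::euclidean_space) r) = unit_ball_vol DIM('a) * r ^ DIM('a)"
  using content_cball[of r z] by (simp add: measure_completion)

lemma AE_lebesgue_onI: "(\<And>x. x \<in> S \<Longrightarrow> P x) \<Longrightarrow> AE x in lebesgue_on S. P x"
  by (rule AE_I2) simp

text \<open>Only the tested form of the equation is kept, with an arbitrary right-hand side
  \<open>F\<close>, so one argument serves balls in elements and balls at sides, for the state and
  for the adjoint state.\<close>

locale residual_ball =
  fixes \<Omega> :: "'a::euclidean_space set" and z :: 'a and r :: real
    and y F :: "'a \<Rightarrow> real"
  assumes \<Omega>: "open \<Omega>" and r: "0 < r" and B: "cball z r \<subseteq> \<Omega>"
    and y: "y \<in> L2_space \<Omega>" and F: "F \<in> L2_space \<Omega>"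
    and eq: "\<And>v. v \<in> test_functions \<Omega> \<Longrightarrow>
      (LINT x|lebesgue_on \<Omega>. y x * laplace v x) = - (LINT x|lebesgue_on \<Omega>. F x * v x)"
begin

abbreviation "X \<equiv> sqrt (measure lebesgue (cball z r))"

lemma X_pos: "0 < X"
  using r content_cball[of r z] by simp

text \<open>The lower bounds carry the volume of a ball of radius r/4, the Cauchy-Schwarz bounds one
  factor \<open>X\<close>. Written with X * X, the volume lets one factor cancel.\<close>

lemma X_mult: "unit_ball_vol DIM('a) * (r / 4) ^ DIM('a) = X * X / 4 ^ DIM('a)"
  using r content_cball[of r z] by (simp add: power_divide)

lemma sets_ball: "cball z r \<in> sets lebesgue" "\<Omega> \<in> sets lebesgue"
  using \<Omega> by (auto simp: borel_open)

lemma L2_ball: "(w :: 'a \<Rightarrow> real) \<in> L2_space \<Omega> \<Longrightarrow> w \<in> L2_space (cball z r)"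
  using L2_space_subset_AE(1)[of w \<Omega> "cball z r"] sets_ball B by (metis Diff_eq_empty_iff negligible_empty)

lemma abump_test: "abump z r g c \<in> test_functions (cball z r)"
  by (rule abump_test_function[OF r order_refl])

lemma abump_test_\<Omega>: "abump z r g c \<in> test_functions \<Omega>"
  by (rule abump_test_function[OF r B])

lemma eq_ball:
  "(LINT x|lebesgue_on (cball z r). y x * laplace (abump z r g c) x) =
     - (LINT x|lebesgue_on (cball z r). F x * abump z r g c x)"
  using eq[OF abump_test_\<Omega>, of g c]
    integral_lebesgue_on_subset[OF sets_ball B, of "\<lambda>x. y x * laplace (abump z r g c) x"]
    integral_lebesgue_on_subset[OF sets_ball B, of "\<lambda>x. F x * abump z r g c x"]
    test_functions_laplace(3)[OF abump_test] test_functions_outside[OF abump_test] by simp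

lemma laplace_abump_L2:
  "laplace (abump z r g c) \<in> L2_space (cball z r)"
  "L2_norm (cball z r) (laplace (abump z r g c)) \<le> (152 + 4 * real DIM('a)) * (norm g * r + \<bar>c\<bar>) / r\<^sup>2 * X"
proof -
  let ?C = "(152 + 4 * real DIM('a)) * (norm g * r + \<bar>c\<bar>) / r\<^sup>2"
  have C: "0 \<le> ?C" using r by simp
  have b: "AE x in lebesgue_on (cball z r). \<bar>laplace (abump z r g c) x\<bar> \<le> ?C"
  proof (rule AE_lebesgue_onI)
    fix x
    show "\<bar>laplace (abump z r g c) x\<bar> \<le> ?C"
      using laplace_abump_bound[OF r, of z g c x] C by (cases "x \<in> ball z r") auto
  qed
  note L = L2_norm_bounded_le[OF borel_measurable_lebesgue_on[OF test_functions_laplace(1)[OF abump_test]] lmeasurable_cball b C]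
  show "laplace (abump z r g c) \<in> L2_space (cball z r)" by (rule L)
  show "L2_norm (cball z r) (laplace (abump z r g c)) \<le> ?C * X"
    using L(2) by simp
qed

lemma abump_L2:
  "abump z r g c \<in> L2_space (cball z r)"
  "L2_norm (cball z r) (abump z r g c) \<le> (norm g * r + \<bar>c\<bar>) * X"
proof -
  have N: "0 \<le> norm g * r + \<bar>c\<bar>" using r by simp
  have b: "AE x in lebesgue_on (cball z r). \<bar>abump z r g c x\<bar> \<le> norm g * r + \<bar>c\<bar>"
  proof (rule AE_lebesgue_onI)
    fix x assume "x \<in> cball z r"
    then have "norm (x - z) \<le> r" by (simp add: dist_norm norm_minus_commute)
    then have "\<bar>g \<bullet> (x - z)\<bar> \<le> norm g * r"
      using Cauchy_Schwarz_ineq2[of g "x - z"] mult_left_mono[of "norm (x - z)" r "norm g"] by simp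
    then have "\<bar>g \<bullet> (x - z) + c\<bar> * bump z r x \<le> (norm g * r + \<bar>c\<bar>) * 1"
      using bump_bounds[of z r x] N by (intro mult_mono) auto
    then show "\<bar>abump z r g c x\<bar> \<le> norm g * r + \<bar>c\<bar>"
      using bump_bounds[of z r x] by (simp add: abump_def abs_mult)
  qed
  note L = L2_norm_bounded_le[OF borel_measurable_lebesgue_on[OF test_functions_measurable[OF abump_test]] lmeasurable_cball b N]
  show "abump z r g c \<in> L2_space (cball z r)" by (rule L)
  show "L2_norm (cball z r) (abump z r g c) \<le> (norm g * r + \<bar>c\<bar>) * X"
    using L(2) by simp
qed

lemma integral_mult_laplace_le:
  assumes w: "w \<in> L2_space (cball z r)"
  shows "\<bar>LINT x|lebesgue_on (cball z r). w x * laplace (abump z r g c) x\<bar> \<le>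
    L2_norm (cball z r) w * ((152 + 4 * real DIM('a)) * (norm g * r + \<bar>c\<bar>) / r\<^sup>2 * X)"
  by (rule order_trans[OF L2_Cauchy_Schwarz[OF w laplace_abump_L2(1)]])
     (intro mult_left_mono laplace_abump_L2(2) L2_norm_nonneg)

lemma integral_mult_abump_le:
  assumes w: "w \<in> L2_space (cball z r)"
  shows "\<bar>LINT x|lebesgue_on (cball z r). w x * abump z r g c x\<bar> \<le>
    L2_norm (cball z r) w * ((norm g * r + \<bar>c\<bar>) * X)"
  by (rule order_trans[OF L2_Cauchy_Schwarz[OF w abump_L2(1)]])
     (intro mult_left_mono abump_L2(2) L2_norm_nonneg)

lemma integral_ball_eq_lborel:
  fixes f :: "'a \<Rightarrow> real"
  assumes f: "f \<in> borel_measurable borel" "\<And>x. x \<notin> cball z r \<Longrightarrow> f x = 0"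
  shows "(LINT x|lebesgue_on (cball z r). f x) = (LINT x|lborel. f x)"
  using integral_lebesgue_on_eq_lborel(1)[OF sets_ball(1) f] .

lemma laplace_measurable [measurable]: "laplace (abump z r g c) \<in> borel_measurable borel"
  by (rule test_functions_laplace(1)[OF abump_test])

lemma abump_measurable [measurable]: "abump z r g c \<in> borel_measurable borel"
  by (rule test_functions_measurable[OF abump_test])

lemma affine_laplace_ball:
  "(LINT x|lebesgue_on (cball z r). (g' \<bullet> x + c') * laplace (abump z r g c) x) = 0"
  using integral_affine_laplace_eq_0[OF abump_test, of g' c' g c]
    test_functions_laplace(3)[OF abump_test] by (subst integral_ball_eq_lborel) auto

lemma affine_L2_ball: "(\<lambda>x. g \<bullet> x + c) \<in> L2_space (cball z r)"
  by (rule continuous_on_compact_L2) (auto intro!: continuous_intros)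

text \<open>Testing with \<open>(G \<bullet> (x - z) + C) * bump\<close>, where the affine factor approximates the
  element residual \<open>F\<close>; \<open>zT\<close> is affine on the ball, hence has no Laplacian there.\<close>

lemma element_residual_ball:
  assumes zT: "\<And>x. x \<in> cball z r \<Longrightarrow> zT x = gz \<bullet> x + cz"
  shows "exp (- 3) / (16 * 4 ^ DIM('a)) * X * (norm G * r + \<bar>C\<bar>) \<le>
    (152 + 4 * real DIM('a)) / r\<^sup>2 * L2_norm (cball z r) (\<lambda>x. y x - zT x) +
    L2_norm (cball z r) (\<lambda>x. (G \<bullet> (x - z) + C) - F x)"
proof -
  let ?B = "cball z r" and ?v = "abump z r G C" and ?N = "norm G * r + \<bar>C\<bar>"
  let ?Q = "\<lambda>x. G \<bullet> (x - z) + C"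
  have Q: "?Q \<in> L2_space ?B"
    using affine_L2_ball[of G "C - G \<bullet> z"] by (simp add: inner_diff_right algebra_simps)
  have FB: "F \<in> L2_space ?B" and yB: "y \<in> L2_space ?B" using F y by (auto intro: L2_ball)
  have zL: "zT \<in> L2_space ?B"
  proof (rule continuous_on_compact_L2[OF compact_cball continuous_on_eq])
    show "continuous_on ?B (\<lambda>x. gz \<bullet> x + cz)" by (intro continuous_intros)
  qed (simp add: zT)
  have N: "0 \<le> ?N" using r by simp
  have 1: "exp (- 3) / 16 * ?N\<^sup>2 * (unit_ball_vol DIM('a) * (r / 4) ^ DIM('a)) \<le> (LINT x|lebesgue_on ?B. ?Q x * ?v x)"
    using integral_affine_sq_bump_ge[OF r, of G C z]
    by (subst integral_ball_eq_lborel) (auto simp: test_functions_outside[OF abump_test])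
  \<comment> \<open>The discrete function can be subtracted without changing the tested integral,
    which turns y into the error y - zT.\<close>
  have y0: "(LINT x|lebesgue_on ?B. zT x * laplace ?v x) = 0"
    using affine_laplace_ball[of gz cz G C] zT by (subst Bochner_Integration.integral_cong[OF refl, of _ _ "\<lambda>x. (gz \<bullet> x + cz) * laplace ?v x"]) auto
  have "(LINT x|lebesgue_on ?B. F x * ?v x) = - (LINT x|lebesgue_on ?B. y x * laplace ?v x)"
    using eq_ball[of G C] by simp
  also have "(LINT x|lebesgue_on ?B. y x * laplace ?v x) = (LINT x|lebesgue_on ?B. (y x - zT x) * laplace ?v x)"
    using y0 L2_space_integrable_mult[OF yB laplace_abump_L2(1)] L2_space_integrable_mult[OF zL laplace_abump_L2(1)]
    by (simp add: left_diff_distrib)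
  finally have F1: "\<bar>LINT x|lebesgue_on ?B. F x * ?v x\<bar> \<le> L2_norm ?B (\<lambda>x. y x - zT x) * ((152 + 4 * real DIM('a)) * ?N / r\<^sup>2 * X)"
    using integral_mult_laplace_le[OF L2_space_diff[OF yB zL], of G C] by simp
  have F2: "(LINT x|lebesgue_on ?B. ?Q x * ?v x) = (LINT x|lebesgue_on ?B. F x * ?v x) + (LINT x|lebesgue_on ?B. (?Q x - F x) * ?v x)"
    using L2_space_integrable_mult[OF Q abump_L2(1)] L2_space_integrable_mult[OF FB abump_L2(1)]
    by (simp add: left_diff_distrib)
  have F3: "\<bar>LINT x|lebesgue_on ?B. (?Q x - F x) * ?v x\<bar> \<le> L2_norm ?B (\<lambda>x. ?Q x - F x) * (?N * X)"
    by (rule integral_mult_abump_le[OF L2_space_diff[OF Q FB]])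
  let ?S = "(152 + 4 * real DIM('a)) / r\<^sup>2 * L2_norm ?B (\<lambda>x. y x - zT x) + L2_norm ?B (\<lambda>x. ?Q x - F x)"
  have S: "0 \<le> ?S" by (simp add: L2_norm_nonneg)
  have "exp (- 3) / 16 * ?N\<^sup>2 * (X * X / 4 ^ DIM('a)) \<le>
     L2_norm ?B (\<lambda>x. y x - zT x) * ((152 + 4 * real DIM('a)) * ?N / r\<^sup>2 * X) + L2_norm ?B (\<lambda>x. ?Q x - F x) * (?N * X)"
    using 1 F1 F2 F3 unfolding X_mult by linarith
  also have "\<dots> = ?N * X * ?S" by (simp add: algebra_simps)
  finally have m: "exp (- 3) / 16 * ?N\<^sup>2 * (X * X / 4 ^ DIM('a)) \<le> ?N * X * ?S" .
  have "k / 16 * n\<^sup>2 * (w * w / p) = (n * w) * (k / (16 * p) * w * n)" for k n w p :: real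
    by (simp add: power2_eq_square)
  note * = m[unfolded this]
  show ?thesis
  \<comment> \<open>The common factor N X can be cancelled unless N = 0, and then the left side of
    the claim is 0.\<close>
  proof (cases "?N = 0")
    case False
    then have "0 < ?N" using N by linarith
    then have "0 < ?N * X" using X_pos by (intro mult_pos_pos)
    then show ?thesis using * by (rule mult_le_cancel_left_pos[THEN iffD1])
  qed (use S in simp)
qed

text \<open>On the ball, \<open>zT\<close> is affine up to \<open>a\<close> times the positive part of the signed distance to the
  side, and testing with the bump detects the kink \<open>a\<close>.\<close>

lemma side_residual_ball:
  assumes \<nu>: "norm \<nu> = 1"
    and zT: "\<And>x. x \<in> cball z r \<Longrightarrow> zT x = gz \<bullet> x + cz + a * max (\<nu> \<bullet> (x - z)) 0"
  shows "exp (- 3) / (2 * 4 ^ DIM('a)) * X * \<bar>a\<bar> \<le>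
    r * ((152 + 4 * real DIM('a)) / r\<^sup>2 * L2_norm (cball z r) (\<lambda>x. y x - zT x) + L2_norm (cball z r) F)"
proof -
  let ?B = "cball z r" and ?v = "abump z r 0 1" and ?T = "\<lambda>x. max (\<nu> \<bullet> (x - z)) 0"
  have FB: "F \<in> L2_space ?B" and yB: "y \<in> L2_space ?B" using F y by (auto intro: L2_ball)
  have TL: "?T \<in> L2_space ?B" by (rule continuous_on_compact_L2) (auto intro!: continuous_intros)
  have "continuous_on ?B (\<lambda>x. gz \<bullet> x + cz + a * ?T x)" by (intro continuous_intros)
  then have zL: "zT \<in> L2_space ?B"
    by (rule continuous_on_compact_L2[OF compact_cball continuous_on_eq]) (simp add: zT)
  define I where "I = (LINT x|lborel. ?T x * laplace ?v x)"
  have I: "exp (- 3) / (2 * r) * (unit_ball_vol DIM('a) * (r / 4) ^ DIM('a)) \<le> I"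
    unfolding I_def by (rule integral_positive_part_laplace_bump_ge[OF r \<nu>])
  have [measurable]: "?T \<in> borel_measurable borel"
    by (intro borel_measurable_continuous_onI continuous_intros)
  have IB: "(LINT x|lebesgue_on ?B. ?T x * laplace ?v x) = I"
    unfolding I_def by (subst integral_ball_eq_lborel) (auto simp: test_functions_laplace(3)[OF abump_test])
  note i = L2_space_integrable_mult[OF TL laplace_abump_L2(1)] L2_space_integrable_mult[OF affine_L2_ball laplace_abump_L2(1)]
    L2_space_integrable_mult[OF yB laplace_abump_L2(1)] L2_space_integrable_mult[OF zL laplace_abump_L2(1)]
  have "(LINT x|lebesgue_on ?B. zT x * laplace ?v x) =
     (LINT x|lebesgue_on ?B. (gz \<bullet> x + cz) * laplace ?v x + a * (?T x * laplace ?v x))"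
    by (rule Bochner_Integration.integral_cong[OF refl]) (simp add: zT algebra_simps)
  also have "\<dots> = a * I"
    using i(1,2) affine_laplace_ball IB by simp
  finally have aI: "a * I = (LINT x|lebesgue_on ?B. zT x * laplace ?v x)" by simp
  have "(LINT x|lebesgue_on ?B. (y x - zT x) * laplace ?v x) = - (LINT x|lebesgue_on ?B. F x * ?v x) - a * I"
    using aI i(3,4) eq_ball[of 0 1] by (simp add: left_diff_distrib)
  then have "\<bar>a * I\<bar> \<le> \<bar>LINT x|lebesgue_on ?B. (y x - zT x) * laplace ?v x\<bar> + \<bar>LINT x|lebesgue_on ?B. F x * ?v x\<bar>"
    by linarith
  also have "\<dots> \<le> L2_norm ?B (\<lambda>x. y x - zT x) * ((152 + 4 * real DIM('a)) / r\<^sup>2 * X) + L2_norm ?B F * X"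
    using integral_mult_laplace_le[OF L2_space_diff[OF yB zL], of 0 1] integral_mult_abump_le[OF FB, of 0 1] by simp
  finally have 1: "\<bar>a\<bar> * \<bar>I\<bar> \<le> X * ((152 + 4 * real DIM('a)) / r\<^sup>2 * L2_norm ?B (\<lambda>x. y x - zT x) + L2_norm ?B F)"
    by (simp add: abs_mult algebra_simps)
  have "\<bar>a\<bar> * (exp (- 3) / (2 * r) * (X * X / 4 ^ DIM('a))) \<le> \<bar>a\<bar> * \<bar>I\<bar>"
    using I unfolding X_mult by (intro mult_left_mono) auto
  then have "X * (\<bar>a\<bar> * (exp (- 3) / (2 * r) * (X / 4 ^ DIM('a)))) \<le> X * ((152 + 4 * real DIM('a)) / r\<^sup>2 * L2_norm ?B (\<lambda>x. y x - zT x) + L2_norm ?B F)"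
  proof -
    have "t * (k / (2 * r) * (w * w / p)) = w * (t * (k / (2 * r) * (w / p)))" for t k w p :: real
      by simp
    from this[of "\<bar>a\<bar>" "exp (- 3)" X "4 ^ DIM('a)"] show ?thesis
      using 1 \<open>\<bar>a\<bar> * (exp (- 3) / (2 * r) * (X * X / 4 ^ DIM('a))) \<le> \<bar>a\<bar> * \<bar>I\<bar>\<close> by linarith
  qed
  then have "\<bar>a\<bar> * (exp (- 3) / (2 * r) * (X / 4 ^ DIM('a))) \<le> (152 + 4 * real DIM('a)) / r\<^sup>2 * L2_norm ?B (\<lambda>x. y x - zT x) + L2_norm ?B F"
    using mult_le_cancel_left_pos[OF X_pos] by blast
  then have "r * (\<bar>a\<bar> * (exp (- 3) / (2 * r) * (X / 4 ^ DIM('a)))) \<le> r * ((152 + 4 * real DIM('a)) / r\<^sup>2 * L2_norm ?B (\<lambda>x. y x - zT x) + L2_norm ?B F)"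
    using r by (intro mult_left_mono) auto
  moreover have "r * (\<bar>a\<bar> * (exp (- 3) / (2 * r) * (X / 4 ^ DIM('a)))) = exp (- 3) / (2 * 4 ^ DIM('a)) * X * \<bar>a\<bar>"
    using r by (simp add: field_simps)
  ultimately show ?thesis by simp
qed

end

section \<open>Projections onto affine functions and onto intervals\<close>

lemma affine_L2_compact: "compact S \<Longrightarrow> (\<lambda>x. g \<bullet> x + c) \<in> L2_space S"
  by (rule continuous_on_compact_L2) (auto intro!: continuous_intros)

text \<open>As the bump is at most 1, the integral of the squared affine function dominates the one
  weighted with the bump, which is bounded below by the coefficients. This definiteness serves both
  existence and uniqueness of the projections.\<close>

lemma affine_integral_sq_eq_0:
  fixes G :: "'a::euclidean_space"
  assumes K: "compact K" "cball z r \<subseteq> K" "0 < r"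
    and 0: "(LINT x|lebesgue_on K. (G \<bullet> x + C) * (G \<bullet> x + C)) = 0"
  shows "G = 0" "C = 0"
proof -
  define C' where "C' = C + G \<bullet> z"
  have q: "G \<bullet> x + C = G \<bullet> (x - z) + C'" for x by (simp add: C'_def inner_diff_right)
  have v: "abump z r G C' \<in> test_functions (cball z r)" by (rule abump_test_function[OF K(3) order_refl])
  have Kl: "K \<in> sets lebesgue" using K by (simp add: borel_compact)
  note Q = affine_L2_compact[OF K(1), of G C]
  have [measurable]: "abump z r G C' \<in> borel_measurable borel" by (rule test_functions_measurable[OF v])
  have out: "(G \<bullet> x + C) * abump z r G C' x = 0" if "x \<notin> K" for x
  proof -
    have "x \<notin> cball z r" using K(2) that by blast
    then show ?thesis using test_functions_outside[OF v] by simp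
  qed
  have "exp (- 3) / 16 * (norm G * r + \<bar>C'\<bar>)\<^sup>2 * (unit_ball_vol DIM('a) * (r / 4) ^ DIM('a)) \<le>
      (LINT x|lborel. (G \<bullet> x + C) * abump z r G C' x)"
    using integral_affine_sq_bump_ge[OF K(3), of G C' z] by (simp only: q)
  also have "\<dots> = (LINT x|lebesgue_on K. (G \<bullet> x + C) * abump z r G C' x)"
    by (rule integral_lebesgue_on_eq_lborel(1)[symmetric, OF Kl _ out]) measurable
  also have "\<dots> \<le> (LINT x|lebesgue_on K. (G \<bullet> x + C) * (G \<bullet> x + C))"
  proof (rule integral_mono)
    show "integrable (lebesgue_on K) (\<lambda>x. (G \<bullet> x + C) * (G \<bullet> x + C))"
      by (rule L2_space_integrable_mult[OF Q Q])
    show "integrable (lebesgue_on K) (\<lambda>x. (G \<bullet> x + C) * abump z r G C' x)"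
      by (rule L2_space_integrable_mult[OF Q test_functions_L2[OF v Kl K(2)]])
    show "(G \<bullet> x + C) * abump z r G C' x \<le> (G \<bullet> x + C) * (G \<bullet> x + C)" for x
      using bump_bounds[of z r x] mult_left_mono[of "bump z r x" 1 "(G \<bullet> x + C) * (G \<bullet> x + C)"]
      by (simp add: abump_def q mult.assoc)
  qed
  finally have "exp (- 3) / 16 * (norm G * r + \<bar>C'\<bar>)\<^sup>2 * (unit_ball_vol DIM('a) * (r / 4) ^ DIM('a)) \<le> 0"
    using 0 by simp
  then have "(norm G * r + \<bar>C'\<bar>)\<^sup>2 * (exp (- 3) / 16 * (unit_ball_vol DIM('a) * (r / 4) ^ DIM('a))) \<le> 0"
    by (simp only: mult_ac)
  moreover have k: "0 < exp (- 3) / 16 * (unit_ball_vol DIM('a) * (r / 4) ^ DIM('a))"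
    using K(3) by simp
  ultimately have "(norm G * r + \<bar>C'\<bar>)\<^sup>2 \<le> 0 / (exp (- 3) / 16 * (unit_ball_vol DIM('a) * (r / 4) ^ DIM('a)))"
    by (subst pos_le_divide_eq[OF k])
  then have "(norm G * r + \<bar>C'\<bar>)\<^sup>2 \<le> 0" by simp
  then have "norm G * r + \<bar>C'\<bar> = 0" by simp
  moreover have "0 \<le> norm G * r" using K(3) by simp
  ultimately have "norm G * r = 0" "\<bar>C'\<bar> = 0" by linarith+
  then show "G = 0" "C = 0" using K(3) by (auto simp: C'_def)
qed

text \<open>The moment map on affine functions is injective and therefore onto.\<close>

lemma L2_projection_exists:
  fixes g :: "'a::euclidean_space \<Rightarrow> real"
  assumes K: "compact K" "cball z r \<subseteq> K" "0 < r" and g: "g \<in> L2_space K"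
  shows "\<exists>G C. \<forall>H D. (LINT x|lebesgue_on K. (g x - (G \<bullet> x + C)) * (H \<bullet> x + D)) = 0"
proof -
  let ?I = "\<lambda>f. LINT x|lebesgue_on K. f x"
  note A = affine_L2_compact[OF K(1)]
  have A1: "(\<lambda>x. x \<bullet> i) \<in> L2_space K" for i :: 'a using A[of i 0] by (simp add: inner_commute)
  have A2: "(\<lambda>x. 1 :: real) \<in> L2_space K" using A[of 0 1] by simp
  have mom: "?I (\<lambda>x. w x * (H \<bullet> x + D)) = (\<Sum>i\<in>Basis. (H \<bullet> i) * ?I (\<lambda>x. w x * (x \<bullet> i))) + D * ?I w"
    "integrable (lebesgue_on K) w"
    if w: "w \<in> L2_space K" for w H D
  proof -
    show iw: "integrable (lebesgue_on K) w" using L2_space_integrable_mult[OF w A2] by simp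
    have iwi: "integrable (lebesgue_on K) (\<lambda>x. w x * (x \<bullet> i))" for i
      by (rule L2_space_integrable_mult[OF w A1])
    have "w x * (H \<bullet> x + D) = (\<Sum>i\<in>Basis. (H \<bullet> i) * (w x * (x \<bullet> i))) + D * w x" for x
      by (subst euclidean_inner[of H x]) (simp add: distrib_left sum_distrib_left mult_ac)
    then show "?I (\<lambda>x. w x * (H \<bullet> x + D)) = (\<Sum>i\<in>Basis. (H \<bullet> i) * ?I (\<lambda>x. w x * (x \<bullet> i))) + D * ?I w"
      using iw iwi by simp
  qed
  \<comment> \<open>Orthogonality to all affine functions amounts to matching the d first-order
    moments and the integral; source and target of \<open>T\<close> both have dimension d +
    1.\<close>
  define T :: "'a \<times> real \<Rightarrow> 'a \<times> real" where
    "T P = ((\<Sum>i\<in>Basis. ?I (\<lambda>x. (fst P \<bullet> x + snd P) * (x \<bullet> i)) *\<^sub>R i), ?I (\<lambda>x. fst P \<bullet> x + snd P))" for P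
  have lin: "linear T"
  proof (rule linearI)
    fix P Q :: "'a \<times> real" and c :: real
    have 1: "integrable (lebesgue_on K) (\<lambda>x. (fst P \<bullet> x + snd P) * (x \<bullet> i))" for P :: "'a \<times> real" and i
      by (rule L2_space_integrable_mult[OF A A1])
    have 2: "integrable (lebesgue_on K) (\<lambda>x. fst P \<bullet> x + snd P)" for P :: "'a \<times> real"
      by (rule mom(2)[OF A])
    have "?I (\<lambda>x. (fst (P + Q) \<bullet> x + snd (P + Q)) * (x \<bullet> i)) = ?I (\<lambda>x. (fst P \<bullet> x + snd P) * (x \<bullet> i)) + ?I (\<lambda>x. (fst Q \<bullet> x + snd Q) * (x \<bullet> i))" for i
      by (subst Bochner_Integration.integral_add[OF 1 1, symmetric]) (simp add: inner_add_left algebra_simps)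
    moreover have "?I (\<lambda>x. fst (P + Q) \<bullet> x + snd (P + Q)) = ?I (\<lambda>x. fst P \<bullet> x + snd P) + ?I (\<lambda>x. fst Q \<bullet> x + snd Q)"
      by (subst Bochner_Integration.integral_add[OF 2 2, symmetric]) (simp add: inner_add_left algebra_simps)
    ultimately show "T (P + Q) = T P + T Q"
      unfolding T_def by (simp only: scaleR_add_left sum.distrib plus_prod_def fst_conv snd_conv)
    have "?I (\<lambda>x. (fst (c *\<^sub>R P) \<bullet> x + snd (c *\<^sub>R P)) * (x \<bullet> i)) = c * ?I (\<lambda>x. (fst P \<bullet> x + snd P) * (x \<bullet> i))" for i
      by (subst integral_mult_right_zero[symmetric]) (simp add: algebra_simps)
    moreover have "?I (\<lambda>x. fst (c *\<^sub>R P) \<bullet> x + snd (c *\<^sub>R P)) = c * ?I (\<lambda>x. fst P \<bullet> x + snd P)"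
      by (subst integral_mult_right_zero[symmetric]) (simp add: algebra_simps)
    ultimately show "T (c *\<^sub>R P) = c *\<^sub>R T P"
      unfolding T_def by (simp only: scaleR_scaleR[symmetric] scaleR_sum_right scaleR_prod_def fst_conv snd_conv real_scaleR_def)
  qed
  have "inj T"
    unfolding linear_injective_0[OF lin]
  proof (intro allI impI)
    fix P assume T0: "T P = 0"
    have 0: "?I (\<lambda>x. fst P \<bullet> x + snd P) = 0" "(\<Sum>i\<in>Basis. ?I (\<lambda>x. (fst P \<bullet> x + snd P) * (x \<bullet> i)) *\<^sub>R i) = 0"
      using T0 by (auto simp: T_def zero_prod_def)
    have "?I (\<lambda>x. (fst P \<bullet> x + snd P) * (x \<bullet> i)) = 0" if "i \<in> Basis" for i
      using arg_cong[OF 0(2), of "\<lambda>v. v \<bullet> i"] that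
      by (simp add: inner_sum_left inner_Basis if_distrib cong: if_cong)
    then have "?I (\<lambda>x. (fst P \<bullet> x + snd P) * (fst P \<bullet> x + snd P)) = 0"
      unfolding mom(1)[OF A] using 0(1) by simp
    from affine_integral_sq_eq_0[OF K this] show "P = 0" by (simp add: prod_eq_iff)
  qed
  then have "surj T" using lin linear_injective_imp_surjective by blast
  from surjD[OF this] obtain P where P: "((\<Sum>i\<in>Basis. ?I (\<lambda>x. g x * (x \<bullet> i)) *\<^sub>R i), ?I g) = T P"
    by (rule exE)
  have P2: "?I (\<lambda>x. fst P \<bullet> x + snd P) = ?I g"
    and P1: "(\<Sum>i\<in>Basis. ?I (\<lambda>x. (fst P \<bullet> x + snd P) * (x \<bullet> i)) *\<^sub>R i) = (\<Sum>i\<in>Basis. ?I (\<lambda>x. g x * (x \<bullet> i)) *\<^sub>R i)"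
    using P unfolding T_def by auto
  have P3: "?I (\<lambda>x. (fst P \<bullet> x + snd P) * (x \<bullet> i)) = ?I (\<lambda>x. g x * (x \<bullet> i))" if "i \<in> Basis" for i
    using arg_cong[OF P1, of "\<lambda>v. v \<bullet> i"] that
    by (simp add: inner_sum_left inner_Basis if_distrib cong: if_cong)
  have "?I (\<lambda>x. (g x - (fst P \<bullet> x + snd P)) * (H \<bullet> x + D)) = 0" for H D
  proof -
    have "?I (\<lambda>x. (g x - (fst P \<bullet> x + snd P)) * (H \<bullet> x + D)) =
       ?I (\<lambda>x. g x * (H \<bullet> x + D)) - ?I (\<lambda>x. (fst P \<bullet> x + snd P) * (H \<bullet> x + D))"
      by (subst Bochner_Integration.integral_diff[OF L2_space_integrable_mult[OF g A] L2_space_integrable_mult[OF A A], symmetric])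
         (simp add: left_diff_distrib)
    also have "\<dots> = 0" unfolding mom(1)[OF A] mom(1)[OF g] using P2 P3 by simp
    finally show ?thesis .
  qed
  then show ?thesis by blast
qed

text \<open>\<open>L2_proj\<close> is a definite description, so existence and uniqueness come
  before any use of it. For l = 0 the projection is the mean, for l = 1 it comes from the moment
  map; the residual estimates only ask that it be affine.\<close>

lemma L2_proj_affine:
  fixes g :: "'a::euclidean_space \<Rightarrow> real"
  assumes K: "compact K" "cball z r \<subseteq> K" "0 < r" and g: "g \<in> L2_space K" and l: "l \<in> {0, 1}"
  obtains G C where "L2_proj l K g = (\<lambda>x. G \<bullet> x + C)"
proof -
  note A = affine_L2_compact[OF K(1)]
  have "\<exists>q. q \<in> Poly_le l \<and> (\<forall>s\<in>Poly_le l. L2_inner K (\<lambda>x. g x - q x) s = 0)"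
  proof (cases "l = 0")
    case True
    have A2: "(\<lambda>x. 1 :: real) \<in> L2_space K" using A[of 0 1] by simp
    let ?m = "LINT x|lebesgue_on K. (1::real)"
    have m: "?m \<noteq> 0"
      using affine_integral_sq_eq_0(2)[OF K, of 0 1] by auto
    define c where "c = (LINT x|lebesgue_on K. g x) / ?m"
    have i: "integrable (lebesgue_on K) g" "integrable (lebesgue_on K) (\<lambda>x. c)"
      using L2_space_integrable_mult[OF g A2] L2_space_integrable_mult[OF A[of 0 c] A2] by auto
    have "(LINT x|lebesgue_on K. c) = c * ?m" by (subst integral_mult_right_zero[symmetric]) simp
    then have "(LINT x|lebesgue_on K. g x - c) = 0"
      using i m by (simp add: c_def)
    then have "(LINT x|lebesgue_on K. (g x - c) * d) = 0" for d by simp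
    then have "L2_inner K (\<lambda>x. g x - c) s = 0" if "s \<in> Poly_le l" for s
      using that True by (auto simp: Poly_le_def L2_inner_def)
    moreover have "(\<lambda>x. c) \<in> Poly_le l" using True by (auto simp: Poly_le_def)
    ultimately show ?thesis by blast
  next
    case False
    obtain G C where GC: "\<forall>H D. (LINT x|lebesgue_on K. (g x - (G \<bullet> x + C)) * (H \<bullet> x + D)) = 0"
      using L2_projection_exists[OF K g] by blast
    have "(\<lambda>x. G \<bullet> x + C) \<in> Poly_le l" using False by (auto simp: Poly_le_def)
    moreover have "L2_inner K (\<lambda>x. g x - (G \<bullet> x + C)) s = 0" if "s \<in> Poly_le l" for s
      using that GC by (auto simp: Poly_le_def L2_inner_def)
    ultimately show ?thesis by blast
  qed
  then obtain q where q: "q \<in> Poly_le l" "\<And>s. s \<in> Poly_le l \<Longrightarrow> L2_inner K (\<lambda>x. g x - q x) s = 0" by blast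
  have "L2_proj l K g = q"
    unfolding L2_proj_def
  proof (rule the_equality)
    show "q \<in> Poly_le l \<and> (\<forall>s\<in>Poly_le l. L2_inner K (\<lambda>x. g x - q x) s = 0)" using q by blast
    fix q' assume q': "q' \<in> Poly_le l \<and> (\<forall>s\<in>Poly_le l. L2_inner K (\<lambda>x. g x - q' x) s = 0)"
    obtain G C where e: "q = (\<lambda>x. G \<bullet> x + C)" "l = 0 \<longrightarrow> G = 0" using q(1) by (auto simp: Poly_le_def)
    obtain G' C' where e': "q' = (\<lambda>x. G' \<bullet> x + C')" "l = 0 \<longrightarrow> G' = 0" using q' by (auto simp: Poly_le_def)
    \<comment> \<open>The difference of two candidates is itself an admissible test function, so the
      integral of its square vanishes.\<close>
    let ?s = "\<lambda>x. (G - G') \<bullet> x + (C - C')"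
    have s: "?s \<in> Poly_le l" using e(2) e'(2) by (auto simp: Poly_le_def intro!: exI[of _ "G - G'"] exI[of _ "C - C'"])
    have i: "integrable (lebesgue_on K) (\<lambda>x. (g x - (H \<bullet> x + D)) * ?s x)" for H D
      by (rule L2_space_integrable_mult[OF L2_space_diff[OF g A] A])
    have "(LINT x|lebesgue_on K. ?s x * ?s x) =
       (LINT x|lebesgue_on K. (g x - (G' \<bullet> x + C')) * ?s x - (g x - (G \<bullet> x + C)) * ?s x)"
      by (intro Bochner_Integration.integral_cong refl) (simp add: inner_diff_left algebra_simps)
    also have "\<dots> = (LINT x|lebesgue_on K. (g x - (G' \<bullet> x + C')) * ?s x) - (LINT x|lebesgue_on K. (g x - (G \<bullet> x + C)) * ?s x)"
      by (rule Bochner_Integration.integral_diff[OF i i])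
    also have "\<dots> = 0"
      using q(2)[OF s] q' s unfolding e(1) e'(1) L2_inner_def by simp
    finally have "(LINT x|lebesgue_on K. ?s x * ?s x) = 0" .
    from affine_integral_sq_eq_0[OF K this] show "q' = q" unfolding e(1) e'(1) by simp
  qed
  then show ?thesis using q(1) that by (auto simp: Poly_le_def)
qed

section \<open>Pointwise projection formulas for the control and the subgradient\<close>

text \<open>Localises an integral inequality: a variation that is switched on only where \<phi> is
  negative produces exactly the integral in the hypothesis, and its nonnegativity leaves no room for
  negative values.\<close>

lemma AE_nonneg_of_negative_part:
  fixes \<phi> :: "'a \<Rightarrow> real"
  assumes i: "integrable M \<phi>" and n: "0 \<le> (LINT x|M. (if \<phi> x < 0 then \<phi> x else 0))"
  shows "AE x in M. 0 \<le> \<phi> x"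
proof -
  let ?\<psi> = "\<lambda>x. - (if \<phi> x < 0 then \<phi> x else 0)"
  have [measurable]: "\<phi> \<in> borel_measurable M" using i by auto
  have j: "integrable M ?\<psi>"
    by (rule Bochner_Integration.integrable_bound[OF i]) auto
  have "(LINT x|M. ?\<psi> x) = - (LINT x|M. (if \<phi> x < 0 then \<phi> x else 0))" by (rule integral_minus)
  then have "(LINT x|M. ?\<psi> x) \<le> 0" using n by linarith
  moreover have "0 \<le> (LINT x|M. ?\<psi> x)" by (rule Bochner_Integration.integral_nonneg) auto
  ultimately have "(LINT x|M. ?\<psi> x) = 0" by linarith
  moreover have "AE x in M. 0 \<le> ?\<psi> x" by auto
  ultimately have "AE x in M. ?\<psi> x = 0" using integral_nonneg_eq_0_iff_AE[OF j] by blast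
  then show ?thesis by eventually_elim (auto split: if_splits)
qed

text \<open>The conditions on \<open>l\<close> are the subgradient inequality for the variations 1,
  - 1 and - u; those on q = p + \<alpha> u + \<beta> l come from the constant controls a and b. If u
  > 0, then l = 1 and q \<le> 0 because a < u, which forces p \<le> - \<beta>; u < 0 is symmetric.
  If u = 0, then u lies strictly between a and b, so q = 0.\<close>

lemma projection_formulas_pointwise:
  fixes u l p \<alpha> \<beta> a b :: real
  assumes l: "l \<le> \<bar>u + 1\<bar> - \<bar>u\<bar>" "- l \<le> \<bar>u - 1\<bar> - \<bar>u\<bar>" "\<bar>u\<bar> \<le> l * u"
    and q: "0 \<le> (p + \<alpha> * u + \<beta> * l) * (a - u)" "0 \<le> (p + \<alpha> * u + \<beta> * l) * (b - u)"
    and u: "a \<le> u" "u \<le> b" and c: "0 < \<alpha>" "0 < \<beta>" "a < 0" "0 < b"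
  shows "l = min 1 (max (- 1) (- (1 / \<beta>) * p))" "u = min b (max a (- (1 / \<alpha>) * (p + \<beta> * l)))"
proof -
  let ?q = "p + \<alpha> * u + \<beta> * l"
  have l1: "l \<le> 1" "- 1 \<le> l" using l by linarith+
  consider "0 < u" | "u < 0" | "u = 0" by linarith
  then show "l = min 1 (max (- 1) (- (1 / \<beta>) * p))"
  proof cases
    case 1
    then have "1 * u \<le> l * u" using l by simp
    then have le: "l = 1" using 1 l1 by (simp add: mult_le_cancel_right)
    have "?q \<le> 0" using q(1) 1 c by (simp add: zero_le_mult_iff)
    moreover have "0 < \<alpha> * u" using 1 c by simp
    ultimately have "p \<le> - \<beta>" using le by simp
    then have "1 \<le> - (1 / \<beta>) * p" using c by (simp add: field_simps)
    then show ?thesis using le by simp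
  next
    case 2
    then have "0 \<le> (l + 1) * u" using l by (simp add: algebra_simps)
    then have "l + 1 \<le> 0" using 2 by (simp add: zero_le_mult_iff)
    then have le: "l = - 1" using l1 by simp
    have "0 \<le> ?q" using q(2) 2 c by (simp add: zero_le_mult_iff)
    moreover have "\<alpha> * u < 0" using 2 c by (simp add: mult_less_0_iff)
    ultimately have "\<beta> \<le> p" using le by simp
    then have "- (1 / \<beta>) * p \<le> - 1" using c by (simp add: field_simps)
    then show ?thesis using le by simp
  next
    case 3
    have "?q \<le> 0" "0 \<le> ?q" using q 3 c by (auto simp: zero_le_mult_iff)
    then have "p = - (\<beta> * l)" using 3 by simp
    then have "- (1 / \<beta>) * p = l" using c by simp
    then show ?thesis using l1 by simp
  qed
  \<comment> \<open>In this form the projection formula is read off the variational inequality: the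
    sign of q decides which bound u attains.\<close>
  have t: "- (1 / \<alpha>) * (p + \<beta> * l) = u - ?q / \<alpha>" using c by (simp add: field_simps)
  consider "0 < ?q" | "?q < 0" | "?q = 0" by linarith
  then show "u = min b (max a (- (1 / \<alpha>) * (p + \<beta> * l)))"
  proof cases
    case 1
    then have "u = a" using q(1) u by (simp add: zero_le_mult_iff)
    moreover have "0 < ?q / \<alpha>" using 1 c by simp
    ultimately show ?thesis unfolding t using c by simp
  next
    case 2
    then have "u = b" using q(2) u by (simp add: zero_le_mult_iff)
    moreover have "?q / \<alpha> < 0" using 2 c by (simp add: divide_neg_pos)
    ultimately show ?thesis unfolding t using c by simp
  next
    case 3
    then show ?thesis unfolding t using u by simp
  qed
qed

lemma continuous_solution_projection_formulas:
  assumes \<Omega>: "open \<Omega>" "bounded \<Omega>"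
    and sol: "continuous_solution \<Omega> f y\<^sub>\<Omega> \<alpha> \<beta> a b y p u lam"
    and c: "0 < \<alpha>" "0 < \<beta>" "a < 0" "0 < b"
  shows "AE x in lebesgue_on \<Omega>. lam x = lambda_tilde \<beta> p x \<and> u x = u_tilde \<alpha> \<beta> a b p x"
proof -
  let ?M = "lebesgue_on \<Omega>"
  have L: "p \<in> L2_space \<Omega>" "u \<in> L2_space \<Omega>" "lam \<in> L2_space \<Omega>" and uab: "AE x in ?M. a \<le> u x \<and> u x \<le> b"
    and sub: "\<And>v. v \<in> L2_space \<Omega> \<Longrightarrow> L1_norm \<Omega> u + L2_inner \<Omega> lam (\<lambda>x. v x - u x) \<le> L1_norm \<Omega> v"
    and vi: "\<And>v. v \<in> U_ad \<Omega> a b \<Longrightarrow> 0 \<le> L2_inner \<Omega> (\<lambda>x. p x + \<alpha> * u x + \<beta> * lam x) (\<lambda>x. v x - u x)"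
    using sol by (auto simp: continuous_solution_def H1_0_def H1_def U_ad_def subdifferential_def)
  have \<Omega>l: "\<Omega> \<in> lmeasurable" using \<Omega> by (simp add: lmeasurable_open)
  have const: "(\<lambda>x. k :: real) \<in> L2_space \<Omega>" for k
    by (rule L2_norm_bounded_le(1)[OF _ \<Omega>l, of _ "\<bar>k\<bar>"]) auto
  have int: "integrable ?M w" if "w \<in> L2_space \<Omega>" for w :: "_ \<Rightarrow> real"
    using L2_space_integrable_mult[OF that const[of 1]] by simp
  note [measurable] = L2_spaceD(1)[OF L(1)] L2_spaceD(1)[OF L(2)] L2_spaceD(1)[OF L(3)]
  \<comment> \<open>The competitors use a variation \<open>w\<close> only on the set where \<phi> is
    negative, as the localisation requires.\<close>
  have switch: "(\<lambda>x. if \<phi> x < (0::real) then u x + w x else u x) \<in> L2_space \<Omega>"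
    if w: "w \<in> L2_space \<Omega>" and \<phi>: "\<phi> \<in> borel_measurable ?M" for w \<phi>
  proof (rule L2_space_dominated)
    note [measurable] = L2_spaceD(1)[OF w] \<phi>
    show "(\<lambda>x. \<bar>u x\<bar> + \<bar>w x\<bar>) \<in> L2_space \<Omega>"
      by (rule L2_space_add) (use L w in \<open>auto simp: L2_space_def\<close>)
    show "(\<lambda>x. if \<phi> x < 0 then u x + w x else u x) \<in> borel_measurable ?M" by measurable
  qed auto
  have s1: "AE x in ?M. 0 \<le> \<bar>u x + w x\<bar> - \<bar>u x\<bar> - lam x * w x" if w: "w \<in> L2_space \<Omega>" for w
  proof (rule AE_nonneg_of_negative_part)
    let ?\<phi> = "\<lambda>x. \<bar>u x + w x\<bar> - \<bar>u x\<bar> - lam x * w x"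
    note [measurable] = L2_spaceD(1)[OF w]
    have \<phi>m: "?\<phi> \<in> borel_measurable ?M" by measurable
    let ?v = "\<lambda>x. if ?\<phi> x < 0 then u x + w x else u x"
    have v: "?v \<in> L2_space \<Omega>" by (rule switch[OF w \<phi>m])
    show "integrable ?M ?\<phi>"
      using int[OF L2_space_add[OF L(2) w]] int[OF L(2)] L2_space_integrable_mult[OF L(3) w] by simp
    have i: "integrable ?M (\<lambda>x. \<bar>?v x\<bar>)" "integrable ?M (\<lambda>x. \<bar>u x\<bar>)" "integrable ?M (\<lambda>x. lam x * (?v x - u x))"
      using int[OF v] int[OF L(2)] L2_space_integrable_mult[OF L(3) L2_space_diff[OF v L(2)]] by simp_all
    have "0 \<le> L1_norm \<Omega> ?v - L1_norm \<Omega> u - L2_inner \<Omega> lam (\<lambda>x. ?v x - u x)"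
      using sub[OF v] by linarith
    also have "\<dots> = (LINT x|?M. \<bar>?v x\<bar> - \<bar>u x\<bar> - lam x * (?v x - u x))"
      unfolding L1_norm_def L2_inner_def using i by simp
    also have "\<dots> = (LINT x|?M. (if ?\<phi> x < 0 then ?\<phi> x else 0))"
      by (rule Bochner_Integration.integral_cong) auto
    finally show "0 \<le> (LINT x|?M. (if ?\<phi> x < 0 then ?\<phi> x else 0))" .
  qed
  have s2: "AE x in ?M. 0 \<le> (p x + \<alpha> * u x + \<beta> * lam x) * (t - u x)" if t: "a \<le> t" "t \<le> b" for t
  proof (rule AE_nonneg_of_negative_part)
    let ?\<phi> = "\<lambda>x. (p x + \<alpha> * u x + \<beta> * lam x) * (t - u x)"
    have w: "(\<lambda>x. t - u x) \<in> L2_space \<Omega>" by (rule L2_space_diff[OF const L(2)])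
    have q: "(\<lambda>x. p x + \<alpha> * u x + \<beta> * lam x) \<in> L2_space \<Omega>"
      by (intro L2_space_add L2_space_cmult L)
    have \<phi>m: "?\<phi> \<in> borel_measurable ?M" by measurable
    let ?v = "\<lambda>x. if ?\<phi> x < 0 then u x + (t - u x) else u x"
    have v: "?v \<in> L2_space \<Omega>" by (rule switch[OF w \<phi>m])
    have "AE x in ?M. a \<le> ?v x \<and> ?v x \<le> b" using uab by eventually_elim (use t in auto)
    then have vU: "?v \<in> U_ad \<Omega> a b" using v by (simp add: U_ad_def)
    show "integrable ?M ?\<phi>" by (rule L2_space_integrable_mult[OF q w])
    have "(LINT x|?M. (p x + \<alpha> * u x + \<beta> * lam x) * (?v x - u x)) = (LINT x|?M. (if ?\<phi> x < 0 then ?\<phi> x else 0))"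
      by (rule Bochner_Integration.integral_cong) auto
    then show "0 \<le> (LINT x|?M. (if ?\<phi> x < 0 then ?\<phi> x else 0))"
      using vi[OF vU] by (simp add: L2_inner_def)
  qed
  \<comment> \<open>Finitely many variations suffice, so their exceptional null sets can be
    united.\<close>
  have "AE x in ?M. 0 \<le> \<bar>u x + (- 1 * u x)\<bar> - \<bar>u x\<bar> - lam x * (- 1 * u x)"
    by (rule s1[OF L2_space_cmult[OF L(2)]])
  moreover note s1[OF const[of 1]] s1[OF const[of "- 1"]]
  moreover have "AE x in ?M. 0 \<le> (p x + \<alpha> * u x + \<beta> * lam x) * (a - u x)"
    "AE x in ?M. 0 \<le> (p x + \<alpha> * u x + \<beta> * lam x) * (b - u x)"
    using c by (auto intro!: s2)
  moreover note uab
  ultimately show ?thesis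
  proof eventually_elim
    case (elim x)
    have "lam x \<le> \<bar>u x + 1\<bar> - \<bar>u x\<bar>" "- lam x \<le> \<bar>u x - 1\<bar> - \<bar>u x\<bar>" "\<bar>u x\<bar> \<le> lam x * u x"
      using elim(1-3) by simp_all
    note P = projection_formulas_pointwise[OF this elim(4,5) conjunct1[OF elim(6)] conjunct2[OF elim(6)] c]
    have lam: "lam x = lambda_tilde \<beta> p x" using P(1) by (simp only: lambda_tilde_def clip_def)
    have "u x = u_tilde \<alpha> \<beta> a b p x"
      using P(2) unfolding u_tilde_def clip_def lam[symmetric] .
    with lam show ?case by blast
  qed
qed

section \<open>Local lower bounds\<close>

text \<open>Here m bounds the ratio h / r of element diameter to ball radius. The factor m * sqrt
  (m^n) extends an affine function from the ball to the element, the quotient inverts the lower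
  bound of \<open>element_residual_ball\<close>, m^2 replaces h^2 / r^2, and the last 1 accounts for
  returning from the projected datum to the datum.\<close>

definition element_const :: "nat \<Rightarrow> real \<Rightarrow> real" where
  "element_const n m = m * sqrt (m ^ n) / (exp (- 3) / (16 * 4 ^ n)) * ((152 + 4 * real n) * m\<^sup>2 + 1) + 1"

lemma element_const_ge_1: "0 \<le> m \<Longrightarrow> 1 \<le> element_const n m"
  by (simp add: element_const_def)

text \<open>For the state equation \<open>y\<close>, \<open>s\<close>, \<open>g\<close> are the
  state, the control and \<open>f\<close>; for the adjoint equation they are the adjoint state, the
  state and the negated target. \<open>zT\<close> and \<open>sT\<close> approximate \<open>y\<close>
  and \<open>s\<close>, and \<open>q\<close> approximates \<open>g\<close> elementwise.
  \<open>M\<close> compares diameters with inscribed radii and \<open>D\<close> bounds all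
  diameters.\<close>

locale mesh_residual =
  fixes \<Omega> :: "'a::euclidean_space set" and \<T> :: "'a set set" and M D :: real
    and y s g zT sT :: "'a \<Rightarrow> real" and q :: "'a set \<Rightarrow> 'a \<Rightarrow> real"
  assumes dim: "2 \<le> DIM('a)"
    and \<Omega>: "open \<Omega>" "interior (closure \<Omega>) = \<Omega>"
    and mesh: "conforming_mesh \<Omega> \<T>"
    and M: "0 < M" and inball: "\<And>K. K \<in> \<T> \<Longrightarrow> \<exists>x \<rho>. 0 < \<rho> \<and> cball x \<rho> \<subseteq> K \<and> diameter K \<le> M * \<rho>"
    and D: "\<And>K. K \<in> \<T> \<Longrightarrow> diameter K \<le> D"
    and L2: "y \<in> L2_space \<Omega>" "s \<in> L2_space \<Omega>" "g \<in> L2_space \<Omega>"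
    and P1: "zT \<in> P1_functions \<Omega> \<T>" "sT \<in> P1_functions \<Omega> \<T>"
    and q: "\<And>K. K \<in> \<T> \<Longrightarrow> \<exists>G C. q K = (\<lambda>x. G \<bullet> x + C)"
    and eq: "\<And>v. v \<in> test_functions \<Omega> \<Longrightarrow>
      (LINT x|lebesgue_on \<Omega>. y x * laplace v x) = - (LINT x|lebesgue_on \<Omega>. (s x + g x) * v x)"
begin

lemmas mesh_facts = mesh_finite[OF mesh] mesh_simplex[OF mesh]
  mesh_subset[OF mesh] mesh_compact[OF mesh] mesh_convex[OF mesh]

lemma triang: "triangulation \<T>"
  using mesh by (simp add: conforming_mesh_def)

lemma L2_sub:
  assumes "w \<in> L2_space \<Omega>" "A \<in> sets lebesgue" "A \<subseteq> closure \<Omega>"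
  shows "(w :: 'a \<Rightarrow> real) \<in> L2_space A"
proof (rule L2_space_subset_AE(1)[OF assms(1) _ assms(2)])
  show "\<Omega> \<in> sets lebesgue" using \<Omega> by (simp add: borel_open)
  show "negligible (A - \<Omega>)"
    by (rule negligible_subset[OF negligible_closure_diff[OF \<Omega>(2) mesh]]) (use assms(3) in blast)
qed

lemma P1_L2:
  assumes "w \<in> P1_functions \<Omega> \<T>" "compact A" "A \<subseteq> closure \<Omega>"
  shows "w \<in> L2_space A"
  using assms by (intro continuous_on_compact_L2) (auto simp: P1_functions_def intro: continuous_on_subset)

lemma compact_sets: "compact (A :: 'a set) \<Longrightarrow> A \<in> sets lebesgue"
  by (simp add: borel_compact)

lemma data_L2:
  assumes "compact A" "A \<subseteq> closure \<Omega>"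
  shows "y \<in> L2_space A" "s \<in> L2_space A" "g \<in> L2_space A" "zT \<in> L2_space A" "sT \<in> L2_space A"
    "(\<lambda>x. y x - zT x) \<in> L2_space A" "(\<lambda>x. s x - sT x) \<in> L2_space A" "(\<lambda>x. sT x + g x) \<in> L2_space A"
proof -
  show *: "y \<in> L2_space A" "s \<in> L2_space A" "g \<in> L2_space A"
    using assms by (auto intro!: L2_sub L2 compact_sets)
  show **: "zT \<in> L2_space A" "sT \<in> L2_space A"
    using assms by (auto intro!: P1_L2 P1)
  show "(\<lambda>x. y x - zT x) \<in> L2_space A" "(\<lambda>x. s x - sT x) \<in> L2_space A" "(\<lambda>x. sT x + g x) \<in> L2_space A"
    by (intro L2_space_diff L2_space_add * **)+
qed

lemma q_L2: "K \<in> \<T> \<Longrightarrow> compact A \<Longrightarrow> q K \<in> L2_space A"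
  using q affine_L2_compact by metis

lemma L2_norm_subset:
  assumes "w \<in> L2_space A" "compact A" "compact B" "B \<subseteq> A"
  shows "L2_norm B w \<le> L2_norm A (w :: 'a \<Rightarrow> real)"
  using L2_space_subset_AE(2)[OF assms(1) compact_sets[OF assms(2)] compact_sets[OF assms(3)]] assms(4)
  by (metis Diff_eq_empty_iff negligible_empty)

text \<open>An open ball inside the closure lies in its interior, which is \<Omega>; halving the
  radius yields a closed ball, as the test functions require.\<close>

lemma cball_half_subset:
  assumes "ball z r \<subseteq> closure \<Omega>" "0 < r"
  shows "cball z (r / 2) \<subseteq> \<Omega>"
proof -
  have "ball z r \<subseteq> \<Omega>" using assms(1) \<Omega>(2) interior_maximal[OF _ open_ball] by blast
  moreover have "cball z (r / 2) \<subseteq> ball z r" using assms(2) by auto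
  ultimately show ?thesis by blast
qed

lemma residual_ball:
  assumes "cball z r \<subseteq> \<Omega>" "0 < r"
  shows "residual_ball \<Omega> z r y (\<lambda>x. s x + g x)"
  by unfold_locales (use assms \<Omega> L2 eq in \<open>auto intro: L2_space_add\<close>)

lemma P1_affine:
  assumes "w \<in> P1_functions \<Omega> \<T>" "K \<in> \<T>"
  obtains G C where "\<And>x. x \<in> K \<Longrightarrow> w x = G \<bullet> x + C"
  using assms by (fastforce simp: P1_functions_def Poly_le_def)

lemma diameter_pos: "K \<in> \<T> \<Longrightarrow> 0 < diameter K"
proof -
  assume K: "K \<in> \<T>"
  obtain x \<rho> where "0 < \<rho>" "cball x \<rho> \<subseteq> K" using inball[OF K] by blast
  then show ?thesis
    using diameter_ge_radius[OF compact_imp_bounded[OF mesh_facts(4)[OF K]], of x \<rho>] by simp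
qed

text \<open>The ball estimate controls the coefficients of the affine function sT + q K. These bound
  the function on all of K, since K lies within m r of the centre, and the volume of K is at most
  m^d times that of the ball. Returning from q K to g costs one oscillation term.\<close>

lemma element_estimate:
  assumes K: "K \<in> \<T>"
  shows "(diameter K)\<^sup>2 * L2_norm K (\<lambda>x. sT x + g x) \<le> element_const DIM('a) (2 * M) *
    (L2_norm K (\<lambda>x. y x - zT x) + (diameter K)\<^sup>2 * L2_norm K (\<lambda>x. s x - sT x) +
     (diameter K)\<^sup>2 * L2_norm K (\<lambda>x. g x - q K x))"
proof -
  let ?h = "diameter K"
  obtain z \<rho> where \<rho>: "0 < \<rho>" "cball z \<rho> \<subseteq> K" "?h \<le> M * \<rho>" using inball[OF K] by blast
  define r where "r = \<rho> / 2"
  define m where "m = 2 * M"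
  have r: "0 < r" "?h \<le> m * r" using \<rho> by (auto simp: r_def m_def)
  note Kc = mesh_facts(4)[OF K] and Ks = mesh_facts(3)[OF K]
  have BK: "cball z r \<subseteq> K" using \<rho> by (auto simp: r_def)
  have B\<Omega>: "cball z r \<subseteq> \<Omega>"
    unfolding r_def by (rule cball_half_subset) (use \<rho> Ks ball_subset_cball in blast)+
  interpret B: residual_ball \<Omega> z r y "\<lambda>x. s x + g x"
    by (rule residual_ball[OF B\<Omega> r(1)])
  have rh: "r \<le> ?h"
    using diameter_ge_radius[OF compact_imp_bounded[OF Kc] BK] r by simp
  have m1: "1 \<le> m"
  proof -
    have "1 * r \<le> m * r" using rh r(2) by linarith
    then show ?thesis using r(1) by (simp add: mult_le_cancel_right)
  qed
  obtain gz cz where zT: "\<And>x. x \<in> K \<Longrightarrow> zT x = gz \<bullet> x + cz" using P1_affine[OF P1(1) K] by metis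
  obtain gs cs where sT: "\<And>x. x \<in> K \<Longrightarrow> sT x = gs \<bullet> x + cs" using P1_affine[OF P1(2) K] by metis
  obtain gq cq where qK: "q K = (\<lambda>x. gq \<bullet> x + cq)" using q[OF K] by blast
  define G where "G = gs + gq"
  define C where "C = cs + cq + G \<bullet> z"
  have Q: "sT x + q K x = G \<bullet> (x - z) + C" if "x \<in> K" for x
    using sT[OF that] qK by (simp add: G_def C_def inner_add_left inner_diff_right)
  let ?N = "norm G * r + \<bar>C\<bar>" and ?X = "sqrt (measure lebesgue (cball z r))"
  let ?a = "L2_norm K (\<lambda>x. y x - zT x)" and ?b = "L2_norm K (\<lambda>x. s x - sT x)" and ?o = "L2_norm K (\<lambda>x. g x - q K x)"
  define k :: real where "k = exp (- 3) / (16 * 4 ^ DIM('a))"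
  have k: "0 < k" by (simp add: k_def)
  define c0 where "c0 = 152 + 4 * real DIM('a)"
  have c0: "0 \<le> c0" by (simp add: c0_def)
  note dK = data_L2[OF Kc Ks] and qL = q_L2[OF K Kc]
  have Bc: "cball z r \<subseteq> closure \<Omega>" using B\<Omega> closure_subset by blast
  note dB = data_L2[OF compact_cball Bc] and qB = q_L2[OF K compact_cball]
  have gqK: "(\<lambda>x. g x - q K x) \<in> L2_space K" by (rule L2_space_diff[OF dK(3) qL])
  have "k * ?X * ?N \<le> c0 / r\<^sup>2 * L2_norm (cball z r) (\<lambda>x. y x - zT x) +
      L2_norm (cball z r) (\<lambda>x. (G \<bullet> (x - z) + C) - (s x + g x))"
    unfolding k_def c0_def by (rule B.element_residual_ball[of zT gz cz G C]) (use zT BK in blast)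
  also have "\<dots> \<le> c0 / r\<^sup>2 * ?a + (?b + 1 * ?o)"
  proof (intro add_mono mult_left_mono)
    show "L2_norm (cball z r) (\<lambda>x. y x - zT x) \<le> ?a"
      by (rule L2_norm_subset[OF dK(6) Kc compact_cball BK])
    have "L2_norm (cball z r) (\<lambda>x. (G \<bullet> (x - z) + C) - (s x + g x)) \<le>
        L2_norm (cball z r) (\<lambda>x. s x - sT x) + 1 * L2_norm (cball z r) (\<lambda>x. g x - q K x)"
    proof (rule L2_norm_dominated_add[OF dB(7) L2_space_diff[OF dB(3) qB]])
      show "AE x in lebesgue_on (cball z r). \<bar>G \<bullet> (x - z) + C - (s x + g x)\<bar> \<le> \<bar>s x - sT x\<bar> + 1 * \<bar>g x - q K x\<bar>"
      proof (rule AE_lebesgue_onI)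
        fix x assume "x \<in> cball z r"
        then have "x \<in> K" using BK by blast
        then show "\<bar>G \<bullet> (x - z) + C - (s x + g x)\<bar> \<le> \<bar>s x - sT x\<bar> + 1 * \<bar>g x - q K x\<bar>"
          unfolding Q[OF \<open>x \<in> K\<close>, symmetric] by (simp add: abs_if)
      qed
      have "(\<lambda>x. G \<bullet> (x - z) + C) \<in> borel_measurable borel"
        by (intro borel_measurable_continuous_onI continuous_intros)
      then show "(\<lambda>x. G \<bullet> (x - z) + C - (s x + g x)) \<in> borel_measurable (lebesgue_on (cball z r))"
        by (rule borel_measurable_diff[OF borel_measurable_lebesgue_on
              borel_measurable_add[OF L2_spaceD(1)[OF dB(2)] L2_spaceD(1)[OF dB(3)]]])
    qed simp
    also have "\<dots> \<le> ?b + 1 * ?o"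
      by (intro add_mono mult_left_mono L2_norm_subset[OF _ Kc compact_cball BK] dK(7) gqK) simp
    finally show "L2_norm (cball z r) (\<lambda>x. (G \<bullet> (x - z) + C) - (s x + g x)) \<le> ?b + 1 * ?o" .
  qed (use c0 in simp)
  finally have main: "k * ?X * ?N \<le> c0 / r\<^sup>2 * ?a + (?b + ?o)" by simp
  have QK: "L2_norm K (\<lambda>x. sT x + q K x) \<le> m * sqrt (m ^ DIM('a)) * (?X * ?N)"
  proof -
    have zK: "z \<in> K" using BK r by auto
    have K': "K \<subseteq> cball z ?h"
    proof
      fix x assume "x \<in> K"
      then show "x \<in> cball z ?h"
        using diameter_bounded_bound[OF compact_imp_bounded[OF Kc] zK] by auto
    qed
    have bnd: "AE x in lebesgue_on K. \<bar>sT x + q K x\<bar> \<le> m * ?N"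
    proof (rule AE_lebesgue_onI)
      fix x assume x: "x \<in> K"
      then have "norm (x - z) \<le> m * r" using K' r(2) by (auto simp: dist_norm norm_minus_commute subset_iff)
      then have "\<bar>G \<bullet> (x - z)\<bar> \<le> norm G * (m * r)"
        using Cauchy_Schwarz_ineq2[of G "x - z"] mult_left_mono[of "norm (x - z)" "m * r" "norm G"] by simp
      moreover have "\<bar>C\<bar> \<le> m * \<bar>C\<bar>" using m1 by (simp add: mult_le_cancel_right1)
      ultimately show "\<bar>sT x + q K x\<bar> \<le> m * ?N"
        unfolding Q[OF x] by (simp add: algebra_simps)
    qed
    have "L2_norm K (\<lambda>x. sT x + q K x) \<le> m * ?N * sqrt (measure lebesgue K)"
      by (rule L2_norm_bounded_le(2)[OF L2_spaceD(1)[OF L2_space_add[OF dK(5) qL]] lmeasurable_compact[OF Kc] bnd])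
         (use m1 r in simp)
    also have "sqrt (measure lebesgue K) \<le> sqrt (m ^ DIM('a)) * ?X"
    proof -
      have "measure lebesgue K \<le> measure lebesgue (cball z ?h)"
        by (rule measure_mono_fmeasurable[OF K']) (use compact_sets[OF Kc] in auto)
      also have "\<dots> = unit_ball_vol DIM('a) * ?h ^ DIM('a)"
        using rh r by (intro measure_lebesgue_cball) simp
      also have "\<dots> \<le> unit_ball_vol DIM('a) * (m * r) ^ DIM('a)"
        using rh r by (intro mult_left_mono power_mono) auto
      also have "\<dots> = m ^ DIM('a) * measure lebesgue (cball z r)"
        using r by (simp add: measure_lebesgue_cball power_mult_distrib del: measure_completion)
      finally show ?thesis by (metis real_sqrt_le_mono real_sqrt_mult)
    qed
    then have "m * ?N * sqrt (measure lebesgue K) \<le> m * ?N * (sqrt (m ^ DIM('a)) * ?X)"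
      using m1 r by (intro mult_left_mono) auto
    finally show ?thesis by (simp only: mult_ac)
  qed
  let ?A = "m * sqrt (m ^ DIM('a)) / k"
  have A: "0 \<le> ?A" using m1 k by simp
  have "m * sqrt (m ^ DIM('a)) * (?X * ?N) = ?A * (k * ?X * ?N)" using k by simp
  also have "\<dots> \<le> ?A * (c0 / r\<^sup>2 * ?a + (?b + ?o))" by (rule mult_left_mono[OF main A])
  finally have Q2: "L2_norm K (\<lambda>x. sT x + q K x) \<le> ?A * (c0 / r\<^sup>2 * ?a + (?b + ?o))"
    using QK by linarith
  have "L2_norm K (\<lambda>x. sT x + g x) \<le> L2_norm K (\<lambda>x. sT x + q K x) + 1 * ?o"
    by (rule L2_norm_dominated_add[OF L2_space_add[OF dK(5) qL] gqK L2_spaceD(1)[OF dK(8)]]) auto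
  also have "\<dots> \<le> ?A * (c0 / r\<^sup>2 * ?a + (?b + ?o)) + ?o" using Q2 by simp
  finally have "?h\<^sup>2 * L2_norm K (\<lambda>x. sT x + g x) \<le> ?h\<^sup>2 * (?A * (c0 / r\<^sup>2 * ?a + (?b + ?o)) + ?o)"
    by (rule mult_left_mono) simp
  also have "\<dots> = ?A * (c0 * (?h\<^sup>2 / r\<^sup>2) * ?a) + ?A * (?h\<^sup>2 * ?b) + ?A * (?h\<^sup>2 * ?o) + ?h\<^sup>2 * ?o"
    by (simp add: algebra_simps)
  also have "\<dots> \<le> ?A * (c0 * m\<^sup>2 * ?a) + ?A * (?h\<^sup>2 * ?b) + ?A * (?h\<^sup>2 * ?o) + ?h\<^sup>2 * ?o"
  proof -
    have "?h\<^sup>2 \<le> (m * r)\<^sup>2" using rh r by (intro power_mono) auto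
    then have "?h\<^sup>2 / r\<^sup>2 \<le> m\<^sup>2" using r by (simp add: divide_le_eq power_mult_distrib)
    then show ?thesis using A c0
      by (intro add_mono order_refl mult_left_mono mult_right_mono) (auto simp: L2_norm_nonneg)
  qed
  also have "\<dots> \<le> (?A * (c0 * m\<^sup>2 + 1) + 1) * (?a + ?h\<^sup>2 * ?b + ?h\<^sup>2 * ?o)"
  proof -
    have "A * (w * a) + A * b + A * t + t \<le> (A * (w + 1) + 1) * (a + b + t)"
      if "0 \<le> A" "0 \<le> w" "0 \<le> a" "0 \<le> b" "0 \<le> t" for A w a b t :: real
    proof -
      have "(A * (w + 1) + 1) * (a + b + t) - (A * (w * a) + A * b + A * t + t) = A * w * (b + t) + A * a + a + b"
        by (simp add: algebra_simps)
      moreover have "0 \<le> \<dots>" using that by simp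
      ultimately show ?thesis by linarith
    qed
    then show ?thesis by this (use A c0 in \<open>simp_all add: L2_norm_nonneg\<close>)
  qed
  finally show ?thesis
    unfolding element_const_def c0_def k_def m_def .
qed


text \<open>The bracket shared by the first two bounds; the fourth power is the exponent 2 (\<kappa>
  + 1) of the oscillation with \<kappa> = 1.\<close>

definition patch_error :: "'a set \<Rightarrow> real" where
  "patch_error K = L2_norm (\<Union>(patch \<T> K)) (\<lambda>x. y x - zT x)
     + (diameter K)\<^sup>2 * L2_norm (\<Union>(patch \<T> K)) (\<lambda>x. s x - sT x)
     + sqrt (\<Sum>K'\<in>patch \<T> K. diameter K' ^ 4 * (L2_norm K' (\<lambda>x. g x - q K' x))\<^sup>2)"

lemma patch_subset: "patch \<T> K \<subseteq> \<T>"
  by (auto simp: patch_def)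

lemma patch_compact: "compact (\<Union>(patch \<T> K))" "\<Union>(patch \<T> K) \<subseteq> closure \<Omega>"
proof -
  have "finite (patch \<T> K)" by (rule finite_subset[OF patch_subset mesh_facts(1)])
  then show "compact (\<Union>(patch \<T> K))"
    using patch_subset[of K] mesh_facts(4) by (intro compact_Union) blast+
  show "\<Union>(patch \<T> K) \<subseteq> closure \<Omega>" using patch_subset[of K] mesh_facts(3) by blast
qed

lemma patch_error_nonneg: "0 \<le> patch_error K"
  by (simp add: patch_error_def L2_norm_nonneg sum_nonneg)

text \<open>A jump is weighted with the diameter of K, but its estimate involves the residual on the
  neighbour; the ratio of the two diameters enters squared. With 1 \<le> M' the same factor also
  covers the term that already carries the weight of K.\<close>

lemma element_estimate_patch:
  assumes K: "K \<in> \<T>" and K': "K' \<in> patch \<T> K" and h: "diameter K \<le> M' * diameter K'" "1 \<le> M'"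
  shows "(diameter K)\<^sup>2 * L2_norm K' (\<lambda>x. sT x + g x) \<le> element_const DIM('a) (2 * M) * M'\<^sup>2 * patch_error K"
proof -
  let ?h = "diameter K" and ?h' = "diameter K'" and ?C = "element_const DIM('a) (2 * M)" and ?S = "\<Union>(patch \<T> K)"
  have K'T: "K' \<in> \<T>" using K' patch_subset by blast
  have K's: "K' \<subseteq> ?S" using K' by blast
  note c = patch_compact[of K] mesh_facts(4)[OF K'T]
  note d = data_L2[OF c(1,2)]
  have C: "0 \<le> ?C" using element_const_ge_1[of "2 * M" "DIM('a)"] M by linarith
  have hp: "0 < ?h" "0 < ?h'" using diameter_pos K K'T by blast+
  define t where "t = (?h / ?h')\<^sup>2"
  have "?h / ?h' \<le> M'" using h hp by (simp add: divide_le_eq)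
  then have t: "0 \<le> t" "t \<le> M'\<^sup>2" using hp unfolding t_def by (auto intro!: power_mono)
  have th: "t * ?h'\<^sup>2 = ?h\<^sup>2" using hp by (simp add: t_def power_divide)
  have M1: "1 \<le> M'\<^sup>2" using h(2) by (simp add: one_le_power)
  let ?a = "L2_norm K' (\<lambda>x. y x - zT x)" and ?b = "L2_norm K' (\<lambda>x. s x - sT x)" and ?o = "L2_norm K' (\<lambda>x. g x - q K' x)"
  let ?A = "L2_norm ?S (\<lambda>x. y x - zT x)" and ?B = "L2_norm ?S (\<lambda>x. s x - sT x)"
    and ?O = "sqrt (\<Sum>K'\<in>patch \<T> K. diameter K' ^ 4 * (L2_norm K' (\<lambda>x. g x - q K' x))\<^sup>2)"
  have o: "?h'\<^sup>2 * ?o \<le> ?O"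
  proof (rule real_le_rsqrt)
    have "(?h'\<^sup>2 * ?o)\<^sup>2 = ?h' ^ 4 * ?o\<^sup>2" by (simp add: power_mult_distrib flip: power_mult)
    also have "\<dots> \<le> (\<Sum>K'\<in>patch \<T> K. diameter K' ^ 4 * (L2_norm K' (\<lambda>x. g x - q K' x))\<^sup>2)"
      using member_le_sum[OF K', of "\<lambda>K'. diameter K' ^ 4 * (L2_norm K' (\<lambda>x. g x - q K' x))\<^sup>2"]
        finite_subset[OF patch_subset mesh_facts(1)] by simp
    finally show "(?h'\<^sup>2 * ?o)\<^sup>2 \<le> (\<Sum>K'\<in>patch \<T> K. diameter K' ^ 4 * (L2_norm K' (\<lambda>x. g x - q K' x))\<^sup>2)" .
  qed
  have a: "?a \<le> ?A" by (rule L2_norm_subset[OF d(6) c(1) c(3) K's])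
  have b: "?b \<le> ?B" by (rule L2_norm_subset[OF d(7) c(1) c(3) K's])
  have "?h\<^sup>2 * L2_norm K' (\<lambda>x. sT x + g x) = t * (?h'\<^sup>2 * L2_norm K' (\<lambda>x. sT x + g x))"
    using th by (simp add: mult.assoc[symmetric])
  also have "\<dots> \<le> t * (?C * (?a + ?h'\<^sup>2 * ?b + ?h'\<^sup>2 * ?o))"
    by (rule mult_left_mono[OF element_estimate[OF K'T] t(1)])
  also have "\<dots> = ?C * (t * ?a + (t * ?h'\<^sup>2) * ?b + t * (?h'\<^sup>2 * ?o))" by (simp add: algebra_simps)
  also have "\<dots> \<le> ?C * (M'\<^sup>2 * ?A + M'\<^sup>2 * (?h\<^sup>2 * ?B) + M'\<^sup>2 * ?O)"
  proof (intro mult_left_mono add_mono C)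
    show "t * ?a \<le> M'\<^sup>2 * ?A" using t a by (intro mult_mono) (auto simp: L2_norm_nonneg)
    show "t * (?h'\<^sup>2 * ?o) \<le> M'\<^sup>2 * ?O" using t o by (intro mult_mono) (auto simp: L2_norm_nonneg)
    have "1 * (?h\<^sup>2 * ?b) \<le> M'\<^sup>2 * (?h\<^sup>2 * ?B)"
      using M1 b by (intro mult_mono mult_left_mono) (auto simp: L2_norm_nonneg)
    then show "t * ?h'\<^sup>2 * ?b \<le> M'\<^sup>2 * (?h\<^sup>2 * ?B)" using th by simp
  qed
  also have "\<dots> = ?C * M'\<^sup>2 * patch_error K" by (simp add: patch_error_def algebra_simps)
  finally show ?thesis .
qed

text \<open>Testing bounds h X |a| by the patch error, where a is the jump up to sign and X^2 the
  volume of the ball. As h^d is at most a multiple of X^2 and the measure of the side is at most of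
  order (1 + h) h^(d-1), the quantity h^3 a^2 times this measure is bounded by (h X a)^2 up to
  constants.\<close>

lemma side_estimate:
  assumes K: "K \<in> \<T>" and \<gamma>: "\<gamma> \<in> sides_of \<T> K"
  defines "m \<equiv> 2 * (M * (2 + M))"
  shows "diameter K ^ 3 * ((normal_jump \<T> zT \<gamma>)\<^sup>2 * measure (hyperplane_measure (affine hull \<gamma>)) \<gamma>) \<le>
    (1 + D) * (2 * m) ^ DIM('a) *
    (((152 + 4 * real DIM('a)) * m\<^sup>2 + 1 + element_const DIM('a) (2 * M) * (1 + (1 + M)\<^sup>2)) /
      (exp (- 3) / (2 * 4 ^ DIM('a))) * patch_error K)\<^sup>2"
proof -
  let ?h = "diameter K" and ?S = "\<Union>(patch \<T> K)" and ?C = "element_const DIM('a) (2 * M)"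
  obtain K1 K2 where 12: "K1 \<in> \<T>" "K2 \<in> \<T>" "K1 \<noteq> K2" "\<gamma> facet_of K1" "\<gamma> facet_of K2" and \<gamma>K: "\<gamma> facet_of K"
    and \<gamma>i: "\<gamma> \<in> internal_sides \<T>"
    using \<gamma> by (auto simp: sides_of_def internal_sides_def)
  have "K \<in> {K1, K2}"
    using facet_elements[OF triang mesh_facts(2) 12] K \<gamma>K by blast
  then obtain K' where K': "K' \<in> \<T>" "K \<noteq> K'" "\<gamma> facet_of K'" using 12 by blast
  have K'p: "K' \<in> patch \<T> K" "K \<in> patch \<T> K"
    using K K' \<gamma> \<gamma>i by (auto simp: patch_def sides_of_def)
  obtain x1 \<rho>1 where b1: "0 < \<rho>1" "cball x1 \<rho>1 \<subseteq> K" "?h \<le> M * \<rho>1" using inball[OF K] by blast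
  obtain x2 \<rho>2 where b2: "0 < \<rho>2" "cball x2 \<rho>2 \<subseteq> K'" "diameter K' \<le> M * \<rho>2" using inball[OF K'(1)] by blast
  obtain \<nu> c z r0 v1 v2 where cf: "cone_facet K \<gamma> \<nu> c v1" "cone_facet K' \<gamma> (- \<nu>) (- c) v2" and z: "z \<in> \<gamma>" and r0: "0 < r0"
    "r0 \<le> ?h" "?h \<le> M * (2 + M) * r0" and hh: "?h \<le> M * diameter K'"
    and half: "\<And>x. dist x z \<le> r0 \<Longrightarrow> \<nu> \<bullet> x \<le> c \<Longrightarrow> x \<in> K" "\<And>x. dist x z \<le> r0 \<Longrightarrow> c \<le> \<nu> \<bullet> x \<Longrightarrow> x \<in> K'"
    by (rule shared_side_ball[OF dim triang K K'(1,2) mesh_facts(2)[OF K] mesh_facts(2)[OF K'(1)] \<gamma>K K'(3) b1 b2 M]) (rule that)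
  note cD = cone_facet_D[OF cf(1)]
  have \<nu>z: "\<nu> \<bullet> z = c" using cD(6)[OF z] .
  define r where "r = r0 / 2"
  have r: "0 < r" "r \<le> ?h" "?h \<le> m * r" using r0 by (auto simp: r_def m_def)
  have m0: "0 \<le> m" using M by (simp add: m_def)
  have Bsub: "cball z r \<subseteq> K \<union> K'"
  proof
    fix x assume "x \<in> cball z r"
    then have "dist x z \<le> r0" using r0 by (auto simp: r_def dist_commute)
    then show "x \<in> K \<union> K'" using half[of x] by (cases "\<nu> \<bullet> x \<le> c") auto
  qed
  have B\<Omega>: "cball z r \<subseteq> \<Omega>"
    unfolding r_def
  proof (rule cball_half_subset[OF _ r0(1)])
    have "x \<in> K \<union> K'" if "x \<in> ball z r0" for x
      using half[of x] that by (cases "\<nu> \<bullet> x \<le> c") (auto simp: dist_commute)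
    then show "ball z r0 \<subseteq> closure \<Omega>" using mesh_facts(3)[OF K] mesh_facts(3)[OF K'(1)] by blast
  qed
  interpret B: residual_ball \<Omega> z r y "\<lambda>x. s x + g x"
    by (rule residual_ball[OF B\<Omega> r(1)])
  obtain g1 d1 where zT1: "\<And>x. x \<in> K \<Longrightarrow> zT x = g1 \<bullet> x + d1" using P1_affine[OF P1(1) K] by metis
  obtain g2 d2 where zT2: "\<And>x. x \<in> K' \<Longrightarrow> zT x = g2 \<bullet> x + d2" using P1_affine[OF P1(1) K'(1)] by metis
  have jump: "normal_jump \<T> zT \<gamma> = \<nu> \<bullet> (g1 - g2)"
    by (rule normal_jump_eq[OF triang mesh_facts(2) K K'(1,2) \<gamma>K K'(3) cf zT1 zT2])
  \<comment> \<open>The two affine pieces agree on a disc in the side, so the difference of their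
    gradients has no tangential part. This is what gives \<open>zT\<close> the form expected by
    \<open>side_residual_ball\<close>.\<close>
  define w where "w = g2 - g1"
  define a where "a = w \<bullet> \<nu>"
  have on: "w \<bullet> (x - z) = 0" if "\<nu> \<bullet> x = c" "dist x z \<le> r0" for x
  proof -
    have "x \<in> K" "x \<in> K'" "z \<in> K" "z \<in> K'" using half that \<nu>z r0(1) by auto
    then show ?thesis using zT1[of x] zT2[of x] zT1[of z] zT2[of z] by (simp add: w_def inner_diff_left inner_diff_right)
  qed
  define u where "u = w - a *\<^sub>R \<nu>"
  have u\<nu>: "\<nu> \<bullet> u = 0" using cD(9) by (simp add: u_def a_def inner_diff_right inner_commute)
  define \<epsilon> where "\<epsilon> = r0 / (norm u + 1)"
  have \<epsilon>: "0 < \<epsilon>" using r0 by (simp add: \<epsilon>_def add_nonneg_pos)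
  have "\<epsilon> * norm u \<le> r0" using r0 by (simp add: \<epsilon>_def divide_le_eq mult_le_cancel_left add_nonneg_pos)
  then have "w \<bullet> ((z + \<epsilon> *\<^sub>R u) - z) = 0"
    using \<epsilon> by (intro on) (auto simp: inner_add_right u\<nu> \<nu>z dist_norm)
  then have "w \<bullet> u = 0" using \<epsilon> by simp
  then have "u \<bullet> u = 0" using u\<nu> by (simp add: u_def inner_diff_left)
  then have w: "w = a *\<^sub>R \<nu>" by (simp add: u_def)
  have "z \<in> K" "z \<in> K'" using half \<nu>z r0(1) by auto
  then have wz: "w \<bullet> z + (d2 - d1) = 0" using zT1[of z] zT2[of z] by (simp add: w_def inner_diff_left)
  have zT: "zT x = g1 \<bullet> x + d1 + a * max (\<nu> \<bullet> (x - z)) 0" if x: "x \<in> cball z r" for x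
  proof -
    have d: "dist x z \<le> r0" using x r0 by (auto simp: r_def dist_commute)
    show ?thesis
    proof (cases "\<nu> \<bullet> x \<le> c")
      case True
      then have "\<nu> \<bullet> (x - z) \<le> 0" using \<nu>z by (simp add: inner_diff_right)
      then show ?thesis using zT1[OF half(1)[OF d True]] by (simp add: max_absorb2)
    next
      case False
      then have p: "0 \<le> \<nu> \<bullet> (x - z)" using \<nu>z by (simp add: inner_diff_right)
      have "zT x = g1 \<bullet> x + d1 + (w \<bullet> x + (d2 - d1))"
        using zT2[OF half(2)[OF d]] False by (simp add: w_def inner_diff_left)
      also have "w \<bullet> x + (d2 - d1) = w \<bullet> (x - z)" using wz by (simp add: inner_diff_right)
      also have "\<dots> = a * (\<nu> \<bullet> (x - z))" by (simp add: w)
      finally show ?thesis using p by (simp add: max_absorb1)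
    qed
  qed
  have J: "(normal_jump \<T> zT \<gamma>)\<^sup>2 = a\<^sup>2"
    by (simp add: jump a_def w_def inner_commute[of \<nu>] inner_diff_left power2_commute)
  define k :: real where "k = exp (- 3) / (2 * 4 ^ DIM('a))"
  have k: "0 < k" by (simp add: k_def)
  define c0 where "c0 = 152 + 4 * real DIM('a)"
  have c0: "0 \<le> c0" by (simp add: c0_def)
  let ?X = "sqrt (measure lebesgue (cball z r))"
  let ?yB = "L2_norm (cball z r) (\<lambda>x. y x - zT x)" and ?FB = "L2_norm (cball z r) (\<lambda>x. s x + g x)" and ?R = "patch_error K"
  have main: "k * ?X * \<bar>a\<bar> \<le> r * (c0 / r\<^sup>2 * ?yB + ?FB)"
    unfolding k_def c0_def by (rule B.side_residual_ball[OF cD(1) zT])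
  note pc = patch_compact[of K]
  note dS = data_L2[OF pc]
  have BS: "cball z r \<subseteq> ?S" using Bsub K'p by blast
  have Bc: "cball z r \<subseteq> closure \<Omega>" using BS pc(2) by blast
  note dB = data_L2[OF compact_cball Bc]
  have K_\<Omega>: "K \<subseteq> closure \<Omega>" "K' \<subseteq> closure \<Omega>" using mesh_facts(3) K K'(1) by blast+
  have Kc: "compact K" "compact K'" using mesh_facts(4) K K'(1) by blast+
  have R1: "?yB + ?h\<^sup>2 * L2_norm (cball z r) (\<lambda>x. s x - sT x) \<le> ?R"
  proof -
    have "?yB \<le> L2_norm ?S (\<lambda>x. y x - zT x)" by (rule L2_norm_subset[OF dS(6) pc(1) compact_cball BS])
    moreover have "?h\<^sup>2 * L2_norm (cball z r) (\<lambda>x. s x - sT x) \<le> ?h\<^sup>2 * L2_norm ?S (\<lambda>x. s x - sT x)"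
      by (intro mult_left_mono L2_norm_subset[OF dS(7) pc(1) compact_cball BS]) simp
    ultimately show ?thesis by (simp add: patch_error_def sum_nonneg add_increasing2)
  qed
  \<comment> \<open>The ratio is enlarged from M to 1 + M because
    \<open>element_estimate_patch\<close> asks for a factor of at least 1.\<close>
  have M1: "?h \<le> (1 + M) * diameter K'" "?h \<le> 1 * ?h"
    using hh diameter_pos[OF K'(1)] by (auto simp: distrib_right)
  have "?FB \<le> L2_norm (cball z r) (\<lambda>x. s x - sT x) + 1 * L2_norm (cball z r) (\<lambda>x. sT x + g x)"
    by (rule L2_norm_dominated_add[OF dB(7,8) L2_spaceD(1)[OF L2_space_add[OF dB(2,3)]]]) auto
  also have "L2_norm (cball z r) (\<lambda>x. sT x + g x) \<le> L2_norm K (\<lambda>x. sT x + g x) + L2_norm K' (\<lambda>x. sT x + g x)"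
    by (rule L2_norm_Un_le[OF compact_sets[OF Kc(1)] data_L2(8)[OF Kc(1) K_\<Omega>(1)] compact_sets[OF Kc(2)] data_L2(8)[OF Kc(2) K_\<Omega>(2)]
          compact_sets[OF compact_cball] Bsub dB(8)])
  finally have "?h\<^sup>2 * ?FB \<le> ?h\<^sup>2 * (L2_norm (cball z r) (\<lambda>x. s x - sT x) + (L2_norm K (\<lambda>x. sT x + g x) + L2_norm K' (\<lambda>x. sT x + g x)))"
    by (intro mult_left_mono) auto
  also have "\<dots> \<le> ?R + (?C * 1\<^sup>2 * ?R + ?C * (1 + M)\<^sup>2 * ?R)"
    unfolding distrib_left
  proof (intro add_mono)
    show "?h\<^sup>2 * L2_norm (cball z r) (\<lambda>x. s x - sT x) \<le> ?R"
      using R1 L2_norm_nonneg[of "cball z r" "\<lambda>x. y x - zT x"] by linarith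
    show "?h\<^sup>2 * L2_norm K (\<lambda>x. sT x + g x) \<le> ?C * 1\<^sup>2 * ?R"
      by (rule element_estimate_patch[OF K K'p(2) M1(2)]) simp
    show "?h\<^sup>2 * L2_norm K' (\<lambda>x. sT x + g x) \<le> ?C * (1 + M)\<^sup>2 * ?R"
      by (rule element_estimate_patch[OF K K'p(1) M1(1)]) (use M in simp)
  qed
  finally have F: "?h\<^sup>2 * ?FB \<le> (1 + ?C * (1 + (1 + M)\<^sup>2)) * ?R" by (simp add: algebra_simps)
  have Y: "?h\<^sup>2 * (c0 / r\<^sup>2 * ?yB) \<le> c0 * m\<^sup>2 * ?R"
  proof -
    have "?h\<^sup>2 \<le> (m * r)\<^sup>2" using r by (intro power_mono) auto
    then have "?h\<^sup>2 / r\<^sup>2 \<le> m\<^sup>2" using r by (simp add: divide_le_eq power_mult_distrib)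
    moreover have "0 \<le> ?h\<^sup>2 * L2_norm (cball z r) (\<lambda>x. s x - sT x)" by (simp add: L2_norm_nonneg)
    then have "?yB \<le> ?R" using R1 by linarith
    ultimately have "c0 * (?h\<^sup>2 / r\<^sup>2) * ?yB \<le> c0 * m\<^sup>2 * ?R"
      using c0 by (intro mult_mono mult_left_mono) (auto simp: L2_norm_nonneg)
    then show ?thesis by (simp add: mult_ac)
  qed
  let ?Q = "c0 * m\<^sup>2 + 1 + ?C * (1 + (1 + M)\<^sup>2)"
  have hp: "0 < ?h" using diameter_pos[OF K] .
  have "?h\<^sup>2 * (k * ?X * \<bar>a\<bar>) \<le> ?h\<^sup>2 * (r * (c0 / r\<^sup>2 * ?yB + ?FB))"
    by (rule mult_left_mono[OF main]) simp
  also have "\<dots> = r * (?h\<^sup>2 * (c0 / r\<^sup>2 * ?yB) + ?h\<^sup>2 * ?FB)" by (simp add: algebra_simps)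
  also have "\<dots> \<le> r * (c0 * m\<^sup>2 * ?R + (1 + ?C * (1 + (1 + M)\<^sup>2)) * ?R)"
    using r Y F by (intro mult_left_mono add_mono) auto
  also have "\<dots> = r * (?Q * ?R)" by (simp add: algebra_simps)
  also have "\<dots> \<le> ?h * (?Q * ?R)"
  proof (rule mult_right_mono[OF r(2)])
    have "0 \<le> ?C" using element_const_ge_1[of "2 * M" "DIM('a)"] M by linarith
    then show "0 \<le> ?Q * ?R" using c0 by (intro mult_nonneg_nonneg patch_error_nonneg add_nonneg_nonneg) auto
  qed
  finally have "?h * (?h * (k * ?X * \<bar>a\<bar>)) \<le> ?h * (?Q * ?R)" by (simp add: power2_eq_square mult.assoc)
  then have "?h * (k * ?X * \<bar>a\<bar>) \<le> ?Q * ?R" using mult_le_cancel_left_pos[OF hp] by blast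
  then have "k * (?h * ?X * \<bar>a\<bar>) \<le> ?Q * ?R" by (simp only: mult_ac)
  then have main2: "?h * ?X * \<bar>a\<bar> \<le> ?Q / k * ?R" using k by (simp add: field_simps)
  have \<gamma>cl: "closed \<gamma>"
  proof -
    have "\<gamma> = K \<inter> {x. \<nu> \<bullet> x = c}" using cf(1) unfolding cone_facet_def by blast
    moreover have "closed (K \<inter> {x. \<nu> \<bullet> x = c})" by (intro closed_Int compact_imp_closed[OF Kc(1)] closed_hyperplane)
    ultimately show ?thesis by metis
  qed
  have mu: "measure (hyperplane_measure (affine hull \<gamma>)) \<gamma> \<le> (1 / ?h + 1) * (unit_ball_vol DIM('a) * (2 * ?h) ^ DIM('a))"
    unfolding affine_hull_cone_facet[OF cf(1) mesh_facts(2)[OF K]]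
  proof (rule hyperplane_measure_le[OF cD(1) \<gamma>cl _ z hp])
    show "\<gamma> \<subseteq> {x. \<nu> \<bullet> x = c}" using cD(6) by blast
    show "dist x z \<le> ?h" if "x \<in> \<gamma>" for x
      using diameter_bounded_bound[OF compact_imp_bounded[OF Kc(1)]] that z cD(4) by blast
  qed
  have "?h ^ 3 * ((normal_jump \<T> zT \<gamma>)\<^sup>2 * measure (hyperplane_measure (affine hull \<gamma>)) \<gamma>) \<le>
     ?h ^ 3 * (a\<^sup>2 * ((1 / ?h + 1) * (unit_ball_vol DIM('a) * (2 * ?h) ^ DIM('a))))"
    unfolding J using hp mu by (intro mult_left_mono) auto
  \<comment> \<open>The identity h^3 (1/h + 1) = (1 + h) h^2 is where the bound on the diameters
    enters the constant.\<close>
  also have "\<dots> = (1 + ?h) * ((?h * a)\<^sup>2 * (unit_ball_vol DIM('a) * (2 * ?h) ^ DIM('a)))"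
    using hp by (simp add: field_simps power2_eq_square power3_eq_cube)
  also have "\<dots> \<le> (1 + D) * ((?h * a)\<^sup>2 * (unit_ball_vol DIM('a) * (2 * (m * r)) ^ DIM('a)))"
    using hp D[OF K] r by (intro mult_mono mult_left_mono power_mono) auto
  also have "unit_ball_vol DIM('a) * (2 * (m * r)) ^ DIM('a) = (2 * m) ^ DIM('a) * ?X\<^sup>2"
    using r by (simp add: measure_lebesgue_cball power_mult_distrib del: measure_completion)
  also have "(1 + D) * ((?h * a)\<^sup>2 * ((2 * m) ^ DIM('a) * ?X\<^sup>2)) = (1 + D) * (2 * m) ^ DIM('a) * (?h * ?X * \<bar>a\<bar>)\<^sup>2"
    by (simp only: power_mult_distrib power2_abs mult_ac)
  also have "\<dots> \<le> (1 + D) * (2 * m) ^ DIM('a) * (?Q / k * ?R)\<^sup>2"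
  proof (intro mult_left_mono power_mono main2)
    show "0 \<le> (1 + D) * (2 * m) ^ DIM('a)" using D[OF K] hp m0 by simp
  qed (use hp in simp)
  finally show ?thesis unfolding c0_def k_def .
qed

end

definition side_const :: "nat \<Rightarrow> real \<Rightarrow> real" where
  "side_const n M = ((152 + 4 * real n) * (2 * (M * (2 + M)))\<^sup>2 + 1 + element_const n (2 * M) * (1 + (1 + M)\<^sup>2)) /
      (exp (- 3) / (2 * 4 ^ n))"

text \<open>One element term and at most n + 1 sides, each with the constant of
  \<open>side_estimate\<close>; the square root undoes the squares in the indicator.\<close>

definition indicator_const :: "nat \<Rightarrow> real \<Rightarrow> real \<Rightarrow> real" where
  "indicator_const n M D = sqrt ((element_const n (2 * M))\<^sup>2 +
     (real n + 1) * ((1 + D) * (2 * (2 * (M * (2 + M)))) ^ n * (side_const n M)\<^sup>2))"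

lemma indicator_const_pos:
  assumes "0 \<le> M" "0 \<le> D" shows "0 < indicator_const n M D"
proof -
  have "0 < (element_const n (2 * M))\<^sup>2"
    using element_const_ge_1[of "2 * M" n] assms by (intro zero_less_power) linarith
  then show ?thesis
    unfolding indicator_const_def using assms
    by (intro real_sqrt_gt_zero add_pos_nonneg mult_nonneg_nonneg) auto
qed

context mesh_residual
begin

lemma indicator_le:
  assumes K: "K \<in> \<T>"
  shows "sqrt (diameter K ^ 4 * (L2_norm K (\<lambda>x. sT x + g x))\<^sup>2 + diameter K ^ 3 * (jump_norm \<T> zT K)\<^sup>2) \<le>
    indicator_const DIM('a) M D * patch_error K"
proof -
  let ?h = "diameter K" and ?R = "patch_error K" and ?C = "element_const DIM('a) (2 * M)"
  let ?S = "(1 + D) * (2 * (2 * (M * (2 + M)))) ^ DIM('a) * (side_const DIM('a) M)\<^sup>2"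
  have hp: "0 < ?h" using diameter_pos[OF K] .
  have S: "0 \<le> ?S" using D[OF K] hp M by simp
  have KK: "K \<in> patch \<T> K" using K by (simp add: patch_def)
  have "?h\<^sup>2 * L2_norm K (\<lambda>x. sT x + g x) \<le> ?C * ?R"
    using element_estimate_patch[OF K KK, of 1] by simp
  then have "(?h\<^sup>2 * L2_norm K (\<lambda>x. sT x + g x))\<^sup>2 \<le> (?C * ?R)\<^sup>2"
    by (rule power_mono) (simp add: L2_norm_nonneg)
  then have 1: "?h ^ 4 * (L2_norm K (\<lambda>x. sT x + g x))\<^sup>2 \<le> ?C\<^sup>2 * ?R\<^sup>2"
    by (simp add: power_mult_distrib flip: power_mult)
  have fs: "finite (sides_of \<T> K)" "card (sides_of \<T> K) \<le> DIM('a) + 1"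
  proof -
    have sub: "sides_of \<T> K \<subseteq> {\<gamma>. \<gamma> facet_of K}" by (auto simp: sides_of_def)
    show "finite (sides_of \<T> K)"
      using finite_subset[OF sub card_facets_simplex(1)[OF mesh_facts(2)[OF K]]] .
    show "card (sides_of \<T> K) \<le> DIM('a) + 1"
      using card_mono[OF card_facets_simplex(1)[OF mesh_facts(2)[OF K]] sub] card_facets_simplex(2)[OF mesh_facts(2)[OF K]] by linarith
  qed
  have "(jump_norm \<T> zT K)\<^sup>2 = (\<Sum>\<gamma>\<in>sides_of \<T> K. (normal_jump \<T> zT \<gamma>)\<^sup>2 * measure (hyperplane_measure (affine hull \<gamma>)) \<gamma>)"
  proof -
    \<comment> \<open>The jump is constant along a side, so the integral is a multiple of the
      surface measure.\<close>
    have "set_lebesgue_integral (hyperplane_measure (affine hull \<gamma>)) \<gamma> (\<lambda>x. (normal_jump \<T> zT \<gamma>)\<^sup>2) =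
        (normal_jump \<T> zT \<gamma>)\<^sup>2 * measure (hyperplane_measure (affine hull \<gamma>)) \<gamma>" for \<gamma>
      by (simp add: set_lebesgue_integral_def hyperplane_measure_def)
    moreover have "0 \<le> (\<Sum>\<gamma>\<in>sides_of \<T> K. (normal_jump \<T> zT \<gamma>)\<^sup>2 * measure (hyperplane_measure (affine hull \<gamma>)) \<gamma>)"
      by (intro sum_nonneg) simp
    ultimately show ?thesis unfolding jump_norm_def by simp
  qed
  then have "?h ^ 3 * (jump_norm \<T> zT K)\<^sup>2 = (\<Sum>\<gamma>\<in>sides_of \<T> K. ?h ^ 3 * ((normal_jump \<T> zT \<gamma>)\<^sup>2 * measure (hyperplane_measure (affine hull \<gamma>)) \<gamma>))"
    by (simp add: sum_distrib_left)
  also have "\<dots> \<le> (\<Sum>\<gamma>\<in>sides_of \<T> K. ?S * ?R\<^sup>2)"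
  proof (rule sum_mono)
    fix \<gamma> assume "\<gamma> \<in> sides_of \<T> K"
    from side_estimate[OF K this]
    show "?h ^ 3 * ((normal_jump \<T> zT \<gamma>)\<^sup>2 * measure (hyperplane_measure (affine hull \<gamma>)) \<gamma>) \<le> ?S * ?R\<^sup>2"
      unfolding side_const_def by (simp only: power_mult_distrib mult.assoc)
  qed
  also have "\<dots> \<le> (real DIM('a) + 1) * (?S * ?R\<^sup>2)"
    unfolding sum_constant using fs(2) S by (intro mult_right_mono) auto
  finally have "?h ^ 4 * (L2_norm K (\<lambda>x. sT x + g x))\<^sup>2 + ?h ^ 3 * (jump_norm \<T> zT K)\<^sup>2 \<le>
      (?C\<^sup>2 + (real DIM('a) + 1) * ?S) * ?R\<^sup>2"
    using 1 by (simp only: distrib_right mult.assoc)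
  then have "sqrt (?h ^ 4 * (L2_norm K (\<lambda>x. sT x + g x))\<^sup>2 + ?h ^ 3 * (jump_norm \<T> zT K)\<^sup>2) \<le>
      sqrt ((?C\<^sup>2 + (real DIM('a) + 1) * ?S) * ?R\<^sup>2)"
    by (rule real_sqrt_le_mono)
  also have "\<dots> = indicator_const DIM('a) M D * ?R"
    unfolding indicator_const_def by (simp add: real_sqrt_mult patch_error_nonneg)
  finally show ?thesis .
qed

end

section \<open>Indicators of the control and the subgradient\<close>

lemma AE_lebesgue_on_subset:
  assumes ae: "AE x in lebesgue_on \<Omega>. P x" and \<Omega>: "\<Omega> \<in> sets lebesgue" and S: "S \<in> sets lebesgue" and N: "negligible (S - \<Omega>)"
  shows "AE x in lebesgue_on S. P x"
proof -
  have "AE x in lebesgue. x \<in> \<Omega> \<longrightarrow> P x" using ae \<Omega> by (simp add: AE_restrict_space_iff)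
  moreover have "AE x in lebesgue. x \<notin> S - \<Omega>"
    using N by (intro AE_not_in) (simp add: negligible_iff_null_sets)
  ultimately have "AE x in lebesgue. x \<in> S \<longrightarrow> P x" by eventually_elim auto
  then show ?thesis using S by (simp add: AE_restrict_space_iff)
qed

lemma clip_diff_le: "\<bar>clip l r v x - clip l r w x\<bar> \<le> \<bar>v x - w x\<bar>"
  unfolding clip_def by linarith

lemma lambda_tilde_diff_le:
  assumes "0 < \<beta>" shows "\<bar>lambda_tilde \<beta> p x - lambda_tilde \<beta> p' x\<bar> \<le> 1 / \<beta> * \<bar>p x - p' x\<bar>"
proof -
  have "\<bar>- (1 / \<beta>) * p x - - (1 / \<beta>) * p' x\<bar> = \<bar>- (1 / \<beta>) * (p x - p' x)\<bar>" by (simp add: right_diff_distrib)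
  also have "\<dots> = 1 / \<beta> * \<bar>p x - p' x\<bar>" using assms by (simp only: abs_mult) simp
  finally show ?thesis
    unfolding lambda_tilde_def using clip_diff_le[of "- 1" 1 "\<lambda>x. - (1 / \<beta>) * p x" x "\<lambda>x. - (1 / \<beta>) * p' x"] by simp
qed

text \<open>The adjoint state enters twice, directly and through \<open>lambda_tilde\<close>, whose
  Lipschitz constant 1/\<beta> is cancelled by the factor \<beta>; hence the 2.\<close>

lemma u_tilde_diff_le:
  assumes "0 < \<alpha>" "0 < \<beta>" shows "\<bar>u_tilde \<alpha> \<beta> a b p x - u_tilde \<alpha> \<beta> a b p' x\<bar> \<le> 2 / \<alpha> * \<bar>p x - p' x\<bar>"
proof -
  let ?d = "p x - p' x" and ?e = "lambda_tilde \<beta> p x - lambda_tilde \<beta> p' x"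
  have "\<beta> * \<bar>?e\<bar> \<le> \<beta> * (1 / \<beta> * \<bar>?d\<bar>)"
    using assms by (intro mult_left_mono lambda_tilde_diff_le) auto
  then have e: "\<beta> * \<bar>?e\<bar> \<le> \<bar>?d\<bar>" using assms by simp
  have "\<bar>u_tilde \<alpha> \<beta> a b p x - u_tilde \<alpha> \<beta> a b p' x\<bar> \<le> \<bar>- (1 / \<alpha>) * (p x + \<beta> * lambda_tilde \<beta> p x) - - (1 / \<alpha>) * (p' x + \<beta> * lambda_tilde \<beta> p' x)\<bar>"
    unfolding u_tilde_def by (rule clip_diff_le)
  also have "\<dots> = \<bar>- (1 / \<alpha>) * (?d + \<beta> * ?e)\<bar>" by (simp add: algebra_simps)
  also have "\<dots> = 1 / \<alpha> * \<bar>?d + \<beta> * ?e\<bar>" using assms by (simp only: abs_mult) simp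
  also have "\<dots> \<le> 1 / \<alpha> * (2 * \<bar>?d\<bar>)"
  proof (rule mult_left_mono)
    have "\<bar>?d + \<beta> * ?e\<bar> \<le> \<bar>?d\<bar> + \<beta> * \<bar>?e\<bar>" using assms abs_triangle_ineq[of ?d "\<beta> * ?e"] by (simp add: abs_mult)
    also have "\<dots> \<le> \<bar>?d\<bar> + \<bar>?d\<bar>" by (rule add_left_mono[OF e])
    finally show "\<bar>?d + \<beta> * ?e\<bar> \<le> 2 * \<bar>?d\<bar>" by simp
  qed (use assms in simp)
  finally show ?thesis by simp
qed

lemma lambda_tilde_measurable:
  assumes [measurable]: "p \<in> borel_measurable M" shows "lambda_tilde \<beta> p \<in> borel_measurable M"
  unfolding lambda_tilde_def clip_def[abs_def] by measurable

lemma u_tilde_measurable: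
  assumes [measurable]: "p \<in> borel_measurable M" shows "u_tilde \<alpha> \<beta> a b p \<in> borel_measurable M"
proof -
  have [measurable]: "lambda_tilde \<beta> p \<in> borel_measurable M" by (rule lambda_tilde_measurable[OF assms])
  show ?thesis unfolding u_tilde_def clip_def[abs_def] by measurable
qed

lemma control_indicators_le:
  fixes \<Omega> :: "'a::euclidean_space set"
  assumes \<Omega>: "open \<Omega>" "bounded \<Omega>" "negligible (closure \<Omega> - \<Omega>)"
    and K: "compact K" "K \<subseteq> closure \<Omega>"
    and pos: "0 < \<alpha>" "0 < \<beta>" "a < 0" "0 < b"
    and sol: "continuous_solution \<Omega> f y\<^sub>\<Omega> \<alpha> \<beta> a b y p u lam"
    and disc: "uT \<in> L2_space K" "pT \<in> L2_space K" "lamT \<in> L2_space K"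
  shows "ind_u \<alpha> \<beta> a b pT uT K \<le> L2_norm K (\<lambda>x. u x - uT x) + 2 / \<alpha> * L2_norm K (\<lambda>x. p x - pT x)"
    and "ind_lambda \<beta> pT lamT K \<le> L2_norm K (\<lambda>x. lam x - lamT x) + 1 / \<beta> * L2_norm K (\<lambda>x. p x - pT x)"
proof -
  have \<Omega>l: "\<Omega> \<in> sets lebesgue" and Kl: "K \<in> sets lebesgue" using \<Omega> K by (auto simp: borel_open borel_compact)
  have N: "negligible (K - \<Omega>)" by (rule negligible_subset[OF \<Omega>(3)]) (use K in blast)
  have "p \<in> L2_space \<Omega>" "u \<in> L2_space \<Omega>" "lam \<in> L2_space \<Omega>"
    using sol by (auto simp: continuous_solution_def H1_0_def H1_def U_ad_def subdifferential_def)
  then have L: "p \<in> L2_space K" "u \<in> L2_space K" "lam \<in> L2_space K"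
    using L2_space_subset_AE(1)[OF _ \<Omega>l Kl N] by blast+
  have AE: "AE x in lebesgue_on K. lam x = lambda_tilde \<beta> p x \<and> u x = u_tilde \<alpha> \<beta> a b p x"
    by (rule AE_lebesgue_on_subset[OF continuous_solution_projection_formulas[OF \<Omega>(1,2) sol pos] \<Omega>l Kl N])
  show "ind_u \<alpha> \<beta> a b pT uT K \<le> L2_norm K (\<lambda>x. u x - uT x) + 2 / \<alpha> * L2_norm K (\<lambda>x. p x - pT x)"
    unfolding ind_u_def
  proof (rule L2_norm_dominated_add[OF L2_space_diff[OF L(2) disc(1)] L2_space_diff[OF L(1) disc(2)]])
    show "(\<lambda>x. u_tilde \<alpha> \<beta> a b pT x - uT x) \<in> borel_measurable (lebesgue_on K)"
      by (intro borel_measurable_diff u_tilde_measurable L2_spaceD(1) disc)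
    show "AE x in lebesgue_on K. \<bar>u_tilde \<alpha> \<beta> a b pT x - uT x\<bar> \<le> \<bar>u x - uT x\<bar> + 2 / \<alpha> * \<bar>p x - pT x\<bar>"
      using AE
    proof eventually_elim
      case (elim x)
      have "\<bar>u x - u_tilde \<alpha> \<beta> a b pT x\<bar> \<le> 2 / \<alpha> * \<bar>p x - pT x\<bar>"
        using u_tilde_diff_le[OF pos(1,2), of a b p x pT] elim by simp
      then show ?case by linarith
    qed
  qed (use pos in simp)
  show "ind_lambda \<beta> pT lamT K \<le> L2_norm K (\<lambda>x. lam x - lamT x) + 1 / \<beta> * L2_norm K (\<lambda>x. p x - pT x)"
    unfolding ind_lambda_def
  proof (rule L2_norm_dominated_add[OF L2_space_diff[OF L(3) disc(3)] L2_space_diff[OF L(1) disc(2)]])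
    show "(\<lambda>x. lambda_tilde \<beta> pT x - lamT x) \<in> borel_measurable (lebesgue_on K)"
      by (intro borel_measurable_diff lambda_tilde_measurable L2_spaceD(1) disc)
    show "AE x in lebesgue_on K. \<bar>lambda_tilde \<beta> pT x - lamT x\<bar> \<le> \<bar>lam x - lamT x\<bar> + 1 / \<beta> * \<bar>p x - pT x\<bar>"
      using AE
    proof eventually_elim
      case (elim x)
      have "\<bar>lam x - lambda_tilde \<beta> pT x\<bar> \<le> 1 / \<beta> * \<bar>p x - pT x\<bar>"
        using lambda_tilde_diff_le[OF pos(2), of p x pT] elim by simp
      then show ?case by linarith
    qed
  qed (use pos in simp)
qed

lemma L2_proj_affine_mesh:
  fixes \<Omega> :: "'a::euclidean_space set"
  assumes "open \<Omega>" "negligible (closure \<Omega> - \<Omega>)" "w \<in> L2_space \<Omega>" "l \<in> {0, 1}"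
    and K: "int DIM('a) simplex K" "K \<subseteq> closure \<Omega>"
  shows "\<exists>G C. L2_proj l K w = (\<lambda>x. G \<bullet> x + C)"
proof -
  have Kc: "compact K" using simplex_compact_convex(1)[OF K(1)] .
  obtain z r where zr: "0 < r" "cball z r \<subseteq> K" using simplex_cball[OF K(1)] .
  have "w \<in> L2_space K"
    by (rule L2_space_subset_AE(1)[OF assms(3)])
       (use assms Kc in \<open>auto simp: borel_open borel_compact intro: negligible_subset[OF assms(2)]\<close>)
  from L2_proj_affine[OF Kc zr(2,1) this assms(4)] show ?thesis by metis
qed

theorem theorem5p8:
  fixes \<Omega> :: "(real ^ 'n) set"
    and \<T>\<^sub>0 :: "(real ^ 'n) set set"
    and TT :: "(real ^ 'n) set set set"
    and l :: nat
  assumes dim: "CARD('n) \<in> {2, 3}"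
    and domain: "polytopal_lipschitz_domain \<Omega>"
    and meshes: "mesh_family \<Omega> \<T>\<^sub>0 TT"
    and l: "l \<in> {0, 1}"
  shows "\<exists>C>0. \<forall>(f :: real ^ 'n \<Rightarrow> real) (y\<^sub>\<Omega> :: real ^ 'n \<Rightarrow> real)
      (\<alpha> :: real) (\<beta> :: real) (a :: real) (b :: real) y p u lam \<T> yT pT uT lamT K.
      f \<in> L2_space \<Omega> \<longrightarrow> y\<^sub>\<Omega> \<in> L2_space \<Omega> \<longrightarrow> 0 < \<alpha> \<longrightarrow> 0 < \<beta> \<longrightarrow> a < 0 \<longrightarrow> 0 < b \<longrightarrow>
      continuous_solution \<Omega> f y\<^sub>\<Omega> \<alpha> \<beta> a b y p u lam \<longrightarrow>
      \<T> \<in> TT \<longrightarrow> discrete_solution \<Omega> \<T> f y\<^sub>\<Omega> \<alpha> \<beta> a b yT pT uT lamT \<longrightarrow>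
      K \<in> \<T> \<longrightarrow>
        ind_y f \<T> yT uT K \<le> C * (L2_norm (\<Union>(patch \<T> K)) (\<lambda>x. y x - yT x)
            + (diameter K)\<^sup>2 * L2_norm (\<Union>(patch \<T> K)) (\<lambda>x. u x - uT x)
            + osc l 1 f (patch \<T> K)) \<and>
        ind_p y\<^sub>\<Omega> \<T> yT pT K \<le> C * (L2_norm (\<Union>(patch \<T> K)) (\<lambda>x. p x - pT x)
            + (diameter K)\<^sup>2 * L2_norm (\<Union>(patch \<T> K)) (\<lambda>x. y x - yT x)
            + osc l 1 y\<^sub>\<Omega> (patch \<T> K)) \<and>
        ind_u \<alpha> \<beta> a b pT uT K \<le> L2_norm K (\<lambda>x. u x - uT x)
            + 2 / \<alpha> * L2_norm K (\<lambda>x. p x - pT x) \<and>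
        ind_lambda \<beta> pT lamT K \<le> L2_norm K (\<lambda>x. lam x - lamT x)
            + 1 / \<beta> * L2_norm K (\<lambda>x. p x - pT x)"
proof -
  have dim2: "2 \<le> DIM(real ^ 'n)" using dim by auto
  have \<Omega>: "open \<Omega>" "interior (closure \<Omega>) = \<Omega>" "bounded \<Omega>"
    using domain lipschitz_boundary_interior_closure[of \<Omega>] by (auto simp: polytopal_lipschitz_domain_def)
  obtain \<sigma> where \<sigma>: "0 < \<sigma>" "\<And>\<T> K. \<T> \<in> TT \<Longrightarrow> K \<in> \<T> \<Longrightarrow> diameter K \<le> \<sigma> * inball_diameter K"
    using meshes unfolding mesh_family_def uniformly_shape_regular_def by blast
  \<comment> \<open>\<open>M\<close> and \<open>D\<close> depend only on the mesh family and the
    domain, so the constant is fixed before the data, the solutions, the mesh and the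
    element.\<close>
  define M where "M = 4 * \<sigma>"
  define D where "D = diameter (closure \<Omega>)"
  have M: "0 < M" using \<sigma> by (simp add: M_def)
  have D: "0 \<le> D" unfolding D_def by (rule diameter_ge_0[OF bounded_closure[OF \<Omega>(3)]])
  show ?thesis
  proof (intro exI[of _ "indicator_const DIM(real ^ 'n) M D"] conjI allI impI)
    show "0 < indicator_const DIM(real ^ 'n) M D" using M D by (intro indicator_const_pos) auto
    fix f y\<^sub>\<Omega> :: "real ^ 'n \<Rightarrow> real" and \<alpha> \<beta> a b :: real and y p u lam \<T> yT pT uT lamT K
    assume f: "f \<in> L2_space \<Omega>" and y\<Omega>: "y\<^sub>\<Omega> \<in> L2_space \<Omega>" and pos: "0 < \<alpha>" "0 < \<beta>" "a < 0" "0 < b"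
      and sol: "continuous_solution \<Omega> f y\<^sub>\<Omega> \<alpha> \<beta> a b y p u lam" and T: "\<T> \<in> TT"
      and disc: "discrete_solution \<Omega> \<T> f y\<^sub>\<Omega> \<alpha> \<beta> a b yT pT uT lamT" and K: "K \<in> \<T>"
    have mesh: "conforming_mesh \<Omega> \<T>" using meshes T by (auto simp: mesh_family_def)
    have P: "yT \<in> P1_functions \<Omega> \<T>" "pT \<in> P1_functions \<Omega> \<T>" "uT \<in> P1_functions \<Omega> \<T>" "lamT \<in> P1_functions \<Omega> \<T>"
      using disc by (auto simp: discrete_solution_def P1_functions_0_def U_ad1_def subdifferential_def)
    have y: "y \<in> H1_0 \<Omega>" and p: "p \<in> H1_0 \<Omega>" and u: "u \<in> L2_space \<Omega>"
      and state: "\<And>v. v \<in> H1_0 \<Omega> \<Longrightarrow> L2_inner \<Omega> (weak_grad \<Omega> y) (weak_grad \<Omega> v) = L2_inner \<Omega> (\<lambda>x. u x + f x) v"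
      and adjoint: "\<And>w. w \<in> H1_0 \<Omega> \<Longrightarrow> L2_inner \<Omega> (weak_grad \<Omega> w) (weak_grad \<Omega> p) = L2_inner \<Omega> (\<lambda>x. y x - y\<^sub>\<Omega> x) w"
      using sol by (auto simp: continuous_solution_def U_ad_def)
    have yp: "y \<in> L2_space \<Omega>" "p \<in> L2_space \<Omega>" using y p by (auto simp: H1_0_def H1_def)
    note neg = negligible_closure_diff[OF \<Omega>(2) mesh]
    have inball: "\<exists>x \<rho>. 0 < \<rho> \<and> cball x \<rho> \<subseteq> K \<and> diameter K \<le> M * \<rho>" if "K \<in> \<T>" for K
      using shape_regular_cball[OF mesh_simplex[OF mesh that] \<sigma>(1) \<sigma>(2)[OF T that]] unfolding M_def by metis
    have diam: "diameter K \<le> D" if "K \<in> \<T>" for K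
      unfolding D_def by (rule diameter_subset[OF mesh_subset[OF mesh that] bounded_closure[OF \<Omega>(3)]])
    have proj: "\<exists>G C. L2_proj l K w = (\<lambda>x. G \<bullet> x + C)" if "K \<in> \<T>" "w \<in> L2_space \<Omega>" for K w
      by (rule L2_proj_affine_mesh[OF \<Omega>(1) neg that(2) l mesh_simplex[OF mesh that(1)] mesh_subset[OF mesh that(1)]])
    interpret st: mesh_residual \<Omega> \<T> M D y u f yT uT "\<lambda>K. L2_proj l K f"
      by unfold_locales
         (use dim2 \<Omega> mesh M inball diam yp u f P proj very_weak_form[OF \<Omega>(1) y state] in auto)
    show "ind_y f \<T> yT uT K \<le> indicator_const DIM(real ^ 'n) M D * (L2_norm (\<Union>(patch \<T> K)) (\<lambda>x. y x - yT x)
            + (diameter K)\<^sup>2 * L2_norm (\<Union>(patch \<T> K)) (\<lambda>x. u x - uT x)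
            + osc l 1 f (patch \<T> K))"
      using st.indicator_le[OF K] unfolding st.patch_error_def ind_y_def osc_def by simp
    \<comment> \<open>The adjoint residual is a difference; taking the negated target as datum
      matches it with \<open>s x + g x\<close> and leaves the oscillation unchanged.\<close>
    have negw: "(\<lambda>x. - y\<^sub>\<Omega> x) \<in> L2_space \<Omega>" using L2_space_cmult[OF y\<Omega>, of "- 1"] by simp
    have negproj: "\<exists>G C. (\<lambda>x. - L2_proj l K y\<^sub>\<Omega> x) = (\<lambda>x. G \<bullet> x + C)" if "K \<in> \<T>" for K
    proof -
      from proj[OF that y\<Omega>] obtain G C where "L2_proj l K y\<^sub>\<Omega> = (\<lambda>x. G \<bullet> x + C)" by blast
      then show ?thesis by (intro exI[of _ "- G"] exI[of _ "- C"]) simp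
    qed
    have adj: "L2_inner \<Omega> (weak_grad \<Omega> p) (weak_grad \<Omega> w) = L2_inner \<Omega> (\<lambda>x. y x + - y\<^sub>\<Omega> x) w" if "w \<in> H1_0 \<Omega>" for w
      using adjoint[OF that] by (simp add: L2_inner_def inner_commute)
    interpret ad: mesh_residual \<Omega> \<T> M D p y "\<lambda>x. - y\<^sub>\<Omega> x" pT yT "\<lambda>K x. - L2_proj l K y\<^sub>\<Omega> x"
    proof unfold_locales
      show "(LINT x|lebesgue_on \<Omega>. p x * laplace v x) = - (LINT x|lebesgue_on \<Omega>. (y x + - y\<^sub>\<Omega> x) * v x)"
        if "v \<in> test_functions \<Omega>" for v
        by (rule very_weak_form[OF \<Omega>(1) p adj that])
    qed (use dim2 \<Omega> mesh M inball diam yp negw P negproj in auto)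
    have "L2_norm K' (\<lambda>x. - y\<^sub>\<Omega> x - - L2_proj l K' y\<^sub>\<Omega> x) = L2_norm K' (\<lambda>x. y\<^sub>\<Omega> x - L2_proj l K' y\<^sub>\<Omega> x)" for K'
      using L2_norm_minus[of K' "\<lambda>x. y\<^sub>\<Omega> x - L2_proj l K' y\<^sub>\<Omega> x"] by simp
    then show "ind_p y\<^sub>\<Omega> \<T> yT pT K \<le> indicator_const DIM(real ^ 'n) M D * (L2_norm (\<Union>(patch \<T> K)) (\<lambda>x. p x - pT x)
            + (diameter K)\<^sup>2 * L2_norm (\<Union>(patch \<T> K)) (\<lambda>x. y x - yT x)
            + osc l 1 y\<^sub>\<Omega> (patch \<T> K))"
      using ad.indicator_le[OF K] unfolding ad.patch_error_def ind_p_def osc_def by simp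
    have Kc: "compact K" "K \<subseteq> closure \<Omega>" using mesh_compact[OF mesh K] mesh_subset[OF mesh K] .
    note control = control_indicators_le[OF \<Omega>(1,3) neg Kc pos sol st.P1_L2[OF P(3) Kc] st.P1_L2[OF P(2) Kc] st.P1_L2[OF P(4) Kc]]
    show "ind_u \<alpha> \<beta> a b pT uT K \<le> L2_norm K (\<lambda>x. u x - uT x) + 2 / \<alpha> * L2_norm K (\<lambda>x. p x - pT x)"
      by (rule control(1))
    show "ind_lambda \<beta> pT lamT K \<le> L2_norm K (\<lambda>x. lam x - lamT x) + 1 / \<beta> * L2_norm K (\<lambda>x. p x - pT x)"
      by (rule control(2))
  qed
qed

end
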